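(* Let $\mathbb{E} = \langle B,t;\,t^{-1}Ht = K,\,\varphi\rangle$ be an HNN-extension such that $H$ and $K$ are normal in $B$ and $L\varphi = L$, where $L = H\cap K$. Let $\mathcal{C}$ be a root class of groups closed under taking quotient groups, and suppose that at least one of the following statements holds: $(\alpha)$ $H/L\in\mathcal{C}$; $(\beta)$ there exists a homomorphism of $B$ onto a group from $\mathcal{C}$ acting injectively on $L$. Suppose also that $\mathfrak{U}=\mathfrak{H}$ or $\mathfrak{U}=\mathfrak{K}$, that $\mathfrak{V}\in\mathcal{C}$, and that $B$ is $\mathcal{C}$-quasi-regular with respect to $HK$. Then $\mathbb{E}$ is residually a $\mathcal{C}$-group if and only if the groups $B$, $B/H$, and $B/K$ are residually $\mathcal{C}$-groups.
   Context: Classes of groups are closed under isomorphism. Maps are written on the right and composed from left to right. $\mathbb{E} = \langle B,t;\,t^{-1}Ht = K,\,\varphi\rangle$ denotes the HNN-extension of a group $B$ with stable letter $t$ and subgroups $H,K\leqslant B$ associated according to an isomorphism $\varphi\colon H\to K$ (so $t^{-1}ht = h\varphi$ for $h\in H$); $B$ is identified with its image in $\mathbb{E}$. For a group $X$ with normal subgroup $Y$, $\operatorname{Aut}_X(Y)\leqslant\operatorname{Aut}Y$ is the group of restrictions to $Y$ of all inner automorphisms of $X$; $\operatorname{sgp}\{\cdot\}$ denotes the generated subgroup. With $H,K$ normal in $B$, $L=H\cap K$ and $L\varphi=L$, put $\mathfrak{H}=\operatorname{Aut}_B(H)$, $\mathfrak{K}=\varphi\operatorname{Aut}_B(K)\varphi^{-1}$,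 $\mathfrak{U}=\operatorname{sgp}\{\mathfrak{H},\mathfrak{K}\}$ (subgroups of $\operatorname{Aut}H$); and $\mathfrak{L}=\operatorname{Aut}_B(L)$, $\mathfrak{F}=\operatorname{sgp}\{\varphi|_L\}$, $\mathfrak{V}=\operatorname{sgp}\{\mathfrak{L},\mathfrak{F}\}$ (subgroups of $\operatorname{Aut}L$). A group $X$ is residually a $\mathcal{C}$-group if every non-trivial element of $X$ has non-trivial image under some homomorphism of $X$ onto a group from $\mathcal{C}$. $\mathcal{C}^{*}(X)$ denotes the family of normal subgroups $N$ of $X$ with $X/N\in\mathcal{C}$. A group $X$ is $\mathcal{C}$-quasi-regular with respect to its subgroup $Y$ if for each $M\in\mathcal{C}^{*}(Y)$ there exists $N\in\mathcal{C}^{*}(X)$ with $N\cap Y\leqslant M$. A class $\mathcal{C}$ is a root class if it contains non-trivial groups, is closed under taking subgroups, and satisfies any of the following (equivalent) conditions: (1) for every group $X$ and every subnormal series $1\leqslant Z\leqslant Y\leqslant X$ with $X/Y,Y/Z\in\mathcal{C}$ there is a normal subgroup $T$ of $X$ with $X/T\in\mathcal{C}$ and $T\leqslant Z$; (2) $\mathcal{C}$ is closed under unrestricted wreath products; (3) $\mathcal{C}$ is closed under extensions and, for any $X,Y\in\mathcal{C}$, contains the unrestricted direct product $\prod_{y\in Y}X_y$ with each $X_y\cong X$. *)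

theory Defs
  imports "HOL-Algebra.Bij" "HOL-Algebra.Coset" "HOL-Algebra.Generated_Groups" "HOL-Library.Equipollence"
begin

section \<open>Classes of groups\<close>

text \<open>
  A class of groups is an isomorphism-closed predicate on the groups whose elements are drawn
  from a type \<open>'u\<close>, which plays the part of a universe. A group over any other type belongs to
  the class if it is isomorphic to a member.
\<close>

definition group_class :: "('u monoid \<Rightarrow> bool) \<Rightarrow> bool" where
  "group_class \<C> \<longleftrightarrow>
     (\<forall>X. \<C> X \<longrightarrow> group X) \<and>
     (\<forall>X Y. \<C> X \<longrightarrow> group Y \<longrightarrow> X \<cong> Y \<longrightarrow> \<C> Y)"

definition in_class :: "('u monoid \<Rightarrow> bool) \<Rightarrow> ('a, 'm) monoid_scheme \<Rightarrow> bool" where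
  "in_class \<C> G \<longleftrightarrow> group G \<and> (\<exists>X. \<C> X \<and> G \<cong> X)"

lemma in_class_iff:
  fixes X :: "'u monoid"
  assumes "group_class \<C>"
  shows "in_class \<C> X \<longleftrightarrow> \<C> X"
proof
  assume "in_class \<C> X"
  then obtain Y where "\<C> Y" "X \<cong> Y" "group X"
    by (auto simp: in_class_def)
  moreover from this have "Y \<cong> X"
    by (simp add: group.iso_sym)
  ultimately show "\<C> X"
    using assms unfolding group_class_def by blast
next
  assume "\<C> X"
  then show "in_class \<C> X"
    using assms iso_refl[of X] unfolding group_class_def in_class_def by blast
qed

text \<open>
  The last conjunct is Gruenberg's condition on subnormal series
  \<open>1 \<le> Z \<le> Y \<le> X\<close>. It is the one of the usual equivalent conditions that does not lead out of
  a universe of bounded cardinality: if \<open>'u\<close> is infinite, then the root classes of groups in the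
  ordinary sense, intersected with the groups over \<open>'u\<close>, satisfy it.
\<close>

definition root_class :: "('u monoid \<Rightarrow> bool) \<Rightarrow> bool" where
  "root_class \<C> \<longleftrightarrow>
     group_class \<C> \<and>
     (\<exists>X. \<C> X \<and> carrier X \<noteq> {\<one>\<^bsub>X\<^esub>}) \<and>
     (\<forall>X Y. \<C> X \<longrightarrow> subgroup Y X \<longrightarrow> \<C> (X\<lparr>carrier := Y\<rparr>)) \<and>
     (\<forall>(X :: 'u monoid) Y Z.
        group X \<longrightarrow> Y \<lhd> X \<longrightarrow> Z \<lhd> X\<lparr>carrier := Y\<rparr> \<longrightarrow>
        in_class \<C> (X Mod Y) \<longrightarrow> in_class \<C> (X\<lparr>carrier := Y\<rparr> Mod Z) \<longrightarrow>
        (\<exists>T. T \<lhd> X \<and> in_class \<C> (X Mod T) \<and> T \<subseteq> Z))"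

definition quotient_closed :: "('u monoid \<Rightarrow> bool) \<Rightarrow> bool" where
  "quotient_closed \<C> \<longleftrightarrow> (\<forall>X N. \<C> X \<longrightarrow> N \<lhd> X \<longrightarrow> in_class \<C> (X Mod N))"

definition residually :: "('u monoid \<Rightarrow> bool) \<Rightarrow> ('a, 'm) monoid_scheme \<Rightarrow> bool" where
  "residually \<C> X \<longleftrightarrow>
     (\<forall>x \<in> carrier X. x \<noteq> \<one>\<^bsub>X\<^esub> \<longrightarrow>
        (\<exists>G f. \<C> G \<and> f \<in> hom X G \<and> f ` carrier X = carrier G \<and> f x \<noteq> \<one>\<^bsub>G\<^esub>))"

definition class_normals ::
    "('u monoid \<Rightarrow> bool) \<Rightarrow> ('a, 'm) monoid_scheme \<Rightarrow> 'a set set" where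
  "class_normals \<C> X = {N. N \<lhd> X \<and> in_class \<C> (X Mod N)}"

definition quasi_regular ::
    "('u monoid \<Rightarrow> bool) \<Rightarrow> ('a, 'm) monoid_scheme \<Rightarrow> 'a set \<Rightarrow> bool" where
  "quasi_regular \<C> X Y \<longleftrightarrow>
     (\<forall>M \<in> class_normals \<C> (X\<lparr>carrier := Y\<rparr>). \<exists>N \<in> class_normals \<C> X. N \<inter> Y \<subseteq> M)"


section \<open>HNN-extensions\<close>

text \<open>
  The group presented by the multiplication table of \<open>B\<close>, the stable letter \<open>t\<close> and the
  relations \<open>t\<^sup>-\<^sup>1 h t = \<phi> h\<close> for \<open>h \<in> H\<close>, as the quotient of the monoid of words in the
  letters \<open>b \<in> B\<close>, \<open>t\<close> and \<open>t\<^sup>-\<^sup>1\<close> by the congruence that these relations generate. The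
  second associated subgroup is \<open>\<phi> ` H\<close>.
\<close>

datatype 'b hnn_letter = Base 'b | Stable | StableInv

definition hnn_words :: "('b, 'm) monoid_scheme \<Rightarrow> 'b hnn_letter list set" where
  "hnn_words B = lists (Base ` carrier B \<union> {Stable, StableInv})"

inductive hnn_eq ::
    "('b, 'm) monoid_scheme \<Rightarrow> 'b set \<Rightarrow> ('b \<Rightarrow> 'b) \<Rightarrow>
     'b hnn_letter list \<Rightarrow> 'b hnn_letter list \<Rightarrow> bool"
  for B H \<phi> where
  refl: "w \<in> hnn_words B \<Longrightarrow> hnn_eq B H \<phi> w w"
| sym: "hnn_eq B H \<phi> v w \<Longrightarrow> hnn_eq B H \<phi> w v"
| trans: "hnn_eq B H \<phi> u v \<Longrightarrow> hnn_eq B H \<phi> v w \<Longrightarrow> hnn_eq B H \<phi> u w"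
| append: "hnn_eq B H \<phi> u u' \<Longrightarrow> hnn_eq B H \<phi> v v' \<Longrightarrow> hnn_eq B H \<phi> (u @ v) (u' @ v')"
| base_one: "hnn_eq B H \<phi> [Base \<one>\<^bsub>B\<^esub>] []"
| base_mult: "x \<in> carrier B \<Longrightarrow> y \<in> carrier B \<Longrightarrow>
    hnn_eq B H \<phi> [Base x, Base y] [Base (x \<otimes>\<^bsub>B\<^esub> y)]"
| stable_inv_right: "hnn_eq B H \<phi> [Stable, StableInv] []"
| stable_inv_left: "hnn_eq B H \<phi> [StableInv, Stable] []"
| stable_conj: "h \<in> H \<Longrightarrow> hnn_eq B H \<phi> [StableInv, Base h, Stable] [Base (\<phi> h)]"

definition hnn_class ::
    "('b, 'm) monoid_scheme \<Rightarrow> 'b set \<Rightarrow> ('b \<Rightarrow> 'b) \<Rightarrow>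
     'b hnn_letter list \<Rightarrow> 'b hnn_letter list set" where
  "hnn_class B H \<phi> w = {v. hnn_eq B H \<phi> w v}"

definition hnn_extension ::
    "('b, 'm) monoid_scheme \<Rightarrow> 'b set \<Rightarrow> ('b \<Rightarrow> 'b) \<Rightarrow> 'b hnn_letter list set monoid" where
  "hnn_extension B H \<phi> =
     \<lparr>carrier = hnn_class B H \<phi> ` hnn_words B,
      mult = (\<lambda>P Q. \<Union>p\<in>P. \<Union>q\<in>Q. hnn_class B H \<phi> (p @ q)),
      one = hnn_class B H \<phi> []\<rparr>"

lemma hnn_class_eqI: "hnn_eq B H \<phi> v w \<Longrightarrow> hnn_class B H \<phi> v = hnn_class B H \<phi> w"
  unfolding hnn_class_def
  using hnn_eq.trans[of B H \<phi> v w] hnn_eq.trans[OF hnn_eq.sym, of B H \<phi> v w] by auto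

lemma hnn_mult_class:
  assumes "v \<in> hnn_words B" "w \<in> hnn_words B"
  shows "hnn_class B H \<phi> v \<otimes>\<^bsub>hnn_extension B H \<phi>\<^esub> hnn_class B H \<phi> w
           = hnn_class B H \<phi> (v @ w)"
proof -
  have eq: "hnn_class B H \<phi> (p @ q) = hnn_class B H \<phi> (v @ w)"
    if "p \<in> hnn_class B H \<phi> v" "q \<in> hnn_class B H \<phi> w" for p q
    using hnn_class_eqI[OF hnn_eq.append[of B H \<phi> v p w q]] that
    by (simp add: hnn_class_def)
  have vw: "v \<in> hnn_class B H \<phi> v" "w \<in> hnn_class B H \<phi> w"
    using assms by (simp_all add: hnn_class_def hnn_eq.refl)
  have "(\<Union>p\<in>hnn_class B H \<phi> v. \<Union>q\<in>hnn_class B H \<phi> w. hnn_class B H \<phi> (p @ q))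
          = (\<Union>p\<in>hnn_class B H \<phi> v. \<Union>q\<in>hnn_class B H \<phi> w. hnn_class B H \<phi> (v @ w))"
    by (rule SUP_cong[OF HOL.refl], rule SUP_cong[OF HOL.refl], rule eq)
  also have "\<dots> = hnn_class B H \<phi> (v @ w)"
    using vw by blast
  finally show ?thesis
    by (simp add: hnn_extension_def)
qed

lemma hnn_words_append: "v \<in> hnn_words B \<Longrightarrow> w \<in> hnn_words B \<Longrightarrow> v @ w \<in> hnn_words B"
  by (simp add: hnn_words_def)

lemma hnn_words_left_inverse:
  assumes "group B" "w \<in> hnn_words B"
  shows "\<exists>v \<in> hnn_words B. hnn_eq B H \<phi> (v @ w) []"
  using assms(2)
proof (induction w)
  case Nil
  show ?case by (rule bexI[of _ "[]"]) (auto simp: hnn_words_def intro: hnn_eq.refl)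
next
  case (Cons a w)
  interpret group B by fact
  have w: "w \<in> hnn_words B" and a: "a \<in> Base ` carrier B \<union> {Stable, StableInv}"
    using Cons.prems by (auto simp: hnn_words_def)
  from Cons.IH[OF w] obtain v where v: "v \<in> hnn_words B" "hnn_eq B H \<phi> (v @ w) []"
    by blast
  obtain c where c: "[c] \<in> hnn_words B" "hnn_eq B H \<phi> [c, a] []"
  proof -
    from a consider b where "b \<in> carrier B" "a = Base b" | "a = Stable" | "a = StableInv"
      by blast
    then show ?thesis
    proof cases
      case 1
      have "hnn_eq B H \<phi> [Base (inv\<^bsub>B\<^esub> b), Base b] []"
        using hnn_eq.trans[OF hnn_eq.base_mult[of "inv\<^bsub>B\<^esub> b" B b H \<phi>]] 1
        by (simp add: hnn_eq.base_one)
      with 1 show ?thesis by (intro that[of "Base (inv\<^bsub>B\<^esub> b)"]) (auto simp: hnn_words_def)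
    next
      case 2
      then show ?thesis
        by (intro that[of StableInv]) (auto simp: hnn_words_def intro: hnn_eq.stable_inv_left)
    next
      case 3
      then show ?thesis
        by (intro that[of Stable]) (auto simp: hnn_words_def intro: hnn_eq.stable_inv_right)
    qed
  qed
  have "hnn_eq B H \<phi> (v @ ([c, a] @ w)) (v @ ([] @ w))"
    using c v w by (intro hnn_eq.append hnn_eq.refl)
  then have "hnn_eq B H \<phi> ((v @ [c]) @ (a # w)) (v @ w)"
    by simp
  then have "hnn_eq B H \<phi> ((v @ [c]) @ (a # w)) []"
    using v(2) by (rule hnn_eq.trans)
  moreover have "v @ [c] \<in> hnn_words B"
    using v(1) c(1) by (rule hnn_words_append)
  ultimately show ?case
    by (rule bexI)
qed

lemma group_hnn_extension:
  assumes "group B"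
  shows "group (hnn_extension B H \<phi>)"
proof -
  let ?E = "hnn_extension B H \<phi>"
  have carr: "carrier ?E = hnn_class B H \<phi> ` hnn_words B" "\<one>\<^bsub>?E\<^esub> = hnn_class B H \<phi> []"
    by (simp_all add: hnn_extension_def)
  have nil: "[] \<in> hnn_words B" by (simp add: hnn_words_def)
  have mult: "hnn_class B H \<phi> v \<otimes>\<^bsub>?E\<^esub> hnn_class B H \<phi> w = hnn_class B H \<phi> (v @ w)"
    if "v \<in> hnn_words B" "w \<in> hnn_words B" for v w
    using that by (rule hnn_mult_class)
  show ?thesis
  proof (rule groupI)
    fix P assume "P \<in> carrier ?E"
    then obtain w where w: "w \<in> hnn_words B" "P = hnn_class B H \<phi> w"
      unfolding carr by blast
    obtain v where v: "v \<in> hnn_words B" "hnn_eq B H \<phi> (v @ w) []"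
      using hnn_words_left_inverse[OF assms w(1)] by blast
    have "hnn_class B H \<phi> v \<otimes>\<^bsub>?E\<^esub> P = \<one>\<^bsub>?E\<^esub>"
      unfolding w(2) mult[OF v(1) w(1)] carr(2) using v(2) by (rule hnn_class_eqI)
    moreover have "hnn_class B H \<phi> v \<in> carrier ?E"
      using v(1) unfolding carr by (rule imageI)
    ultimately show "\<exists>Q\<in>carrier ?E. Q \<otimes>\<^bsub>?E\<^esub> P = \<one>\<^bsub>?E\<^esub>"
      by (rule bexI)
  next
    fix P Q assume "P \<in> carrier ?E" "Q \<in> carrier ?E"
    then show "P \<otimes>\<^bsub>?E\<^esub> Q \<in> carrier ?E"
      unfolding carr by (auto simp: mult hnn_words_append)
  next
    show "\<one>\<^bsub>?E\<^esub> \<in> carrier ?E"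
      unfolding carr using nil by (rule imageI)
  next
    fix P Q R assume "P \<in> carrier ?E" "Q \<in> carrier ?E" "R \<in> carrier ?E"
    then show "P \<otimes>\<^bsub>?E\<^esub> Q \<otimes>\<^bsub>?E\<^esub> R = P \<otimes>\<^bsub>?E\<^esub> (Q \<otimes>\<^bsub>?E\<^esub> R)"
      unfolding carr by (auto simp: mult hnn_words_append)
  next
    fix P assume "P \<in> carrier ?E"
    then show "\<one>\<^bsub>?E\<^esub> \<otimes>\<^bsub>?E\<^esub> P = P"
      unfolding carr by (auto simp: mult nil)
  qed
qed

lemma hnn_base_hom: "(\<lambda>b. hnn_class B H \<phi> [Base b]) \<in> hom B (hnn_extension B H \<phi>)"
proof (rule homI)
  fix x y assume xy: "x \<in> carrier B" "y \<in> carrier B"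
  then have "[Base x] \<in> hnn_words B" "[Base y] \<in> hnn_words B" by (auto simp: hnn_words_def)
  with xy show "hnn_class B H \<phi> [Base (x \<otimes>\<^bsub>B\<^esub> y)] =
      hnn_class B H \<phi> [Base x] \<otimes>\<^bsub>hnn_extension B H \<phi>\<^esub> hnn_class B H \<phi> [Base y]"
    by (simp add: hnn_mult_class hnn_class_eqI[OF hnn_eq.base_mult])
next
  fix x assume "x \<in> carrier B"
  then have "[Base x] \<in> hnn_words B" by (simp add: hnn_words_def)
  then show "hnn_class B H \<phi> [Base x] \<in> carrier (hnn_extension B H \<phi>)"
    by (simp add: hnn_extension_def)
qed


section \<open>Groups of automorphisms\<close>

text \<open>
  The automorphism sets below are subsets of the library's \<open>AutoGroup\<close>, whose elements are
  extensional functions composed from right to left. Composing from left to right instead gives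
  the opposite group, which has the same subgroups, and each of these is isomorphic to its
  opposite via inversion.
\<close>

definition Aut_restr :: "('a, 'm) monoid_scheme \<Rightarrow> 'a set \<Rightarrow> ('a \<Rightarrow> 'a) set" where
  "Aut_restr X Y = (\<lambda>x. \<lambda>y\<in>Y. inv\<^bsub>X\<^esub> x \<otimes>\<^bsub>X\<^esub> y \<otimes>\<^bsub>X\<^esub> x) ` carrier X"

abbreviation AutGrp :: "('a, 'm) monoid_scheme \<Rightarrow> 'a set \<Rightarrow> ('a \<Rightarrow> 'a) monoid" where
  "AutGrp X Y \<equiv> AutoGroup (X\<lparr>carrier := Y\<rparr>)"

definition frakH :: "('b, 'm) monoid_scheme \<Rightarrow> 'b set \<Rightarrow> ('b \<Rightarrow> 'b) set" where
  "frakH B H = Aut_restr B H"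

text \<open>
  With maps written on the right, \<open>\<phi>\<alpha>\<phi>\<^sup>-\<^sup>1\<close> applies \<open>\<phi>\<close> first and \<open>\<phi>\<^sup>-\<^sup>1\<close> last.
\<close>

definition frakK ::
    "('b, 'm) monoid_scheme \<Rightarrow> 'b set \<Rightarrow> 'b set \<Rightarrow> ('b \<Rightarrow> 'b) \<Rightarrow> ('b \<Rightarrow> 'b) set" where
  "frakK B H K \<phi> = (\<lambda>\<alpha>. \<lambda>h\<in>H. inv_into H \<phi> (\<alpha> (\<phi> h))) ` Aut_restr B K"

definition frakU ::
    "('b, 'm) monoid_scheme \<Rightarrow> 'b set \<Rightarrow> 'b set \<Rightarrow> ('b \<Rightarrow> 'b) \<Rightarrow> ('b \<Rightarrow> 'b) set" where
  "frakU B H K \<phi> = generate (AutGrp B H) (frakH B H \<union> frakK B H K \<phi>)"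

definition frakL :: "('b, 'm) monoid_scheme \<Rightarrow> 'b set \<Rightarrow> ('b \<Rightarrow> 'b) set" where
  "frakL B L = Aut_restr B L"

definition frakF ::
    "('b, 'm) monoid_scheme \<Rightarrow> 'b set \<Rightarrow> ('b \<Rightarrow> 'b) \<Rightarrow> ('b \<Rightarrow> 'b) set" where
  "frakF B L \<phi> = generate (AutGrp B L) {restrict \<phi> L}"

definition frakV ::
    "('b, 'm) monoid_scheme \<Rightarrow> 'b set \<Rightarrow> ('b \<Rightarrow> 'b) \<Rightarrow> ('b \<Rightarrow> 'b) set" where
  "frakV B L \<phi> = generate (AutGrp B L) (frakL B L \<union> frakF B L \<phi>)"

end

theory Submission
  imports Defs "HOL-Algebra.SndIsomorphismGrp"
begin

text \<open>
  Let \<open>E\<close> be the HNN-extension, \<open>\<iota>\<close> the canonical map of \<open>B\<close> into it and \<open>t\<close> the stable letter.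
  All quotients of \<open>E\<close> that lie in the class are found in the same way. Suppose that \<open>E / T0\<close> is in the class. A
  homomorphism of \<open>E\<close> into a wreath product of a member \<open>\<Gamma>\<close> of the class with \<open>E\<close>, whose
  component in \<open>E\<close> is the identity and whose other component is constant on the cosets of
  \<open>T0\<close>, restricts to a homomorphism \<open>T0 \<rightarrow> \<Gamma>\<close>, and Gruenberg's condition yields a smaller normal
  subgroup \<open>T\<close> of \<open>E\<close>, again with quotient in the class, on which that homomorphism vanishes. By the
  universal property of \<open>E\<close> such maps can be prescribed on \<open>B\<close> and \<open>t\<close>
  (\<open>crossed_function\<close>), and any family of homomorphisms on the part of \<open>T0\<close> that lies in \<open>B\<close> can be
  realized in this way as soon as it is compatible with conjugation by \<open>B\<close> and with \<open>\<phi>\<close>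
  (\<open>induced_function\<close>).

  Sufficiency. Call a normal subgroup \<open>N\<close> of \<open>B\<close> with quotient in the class compatible if \<open>\<phi>\<close>
  carries \<open>N \<inter> H\<close> to \<open>N \<inter> K\<close> and the images of \<open>H\<close> and \<open>K\<close> in \<open>B / N\<close> meet in the image of \<open>L\<close>.
  Quasi-regularity with respect to \<open>HK\<close> produces compatible subgroups from suitable normal
  subgroups of \<open>H\<close>, and either of the alternatives \<open>(\<alpha>)\<close> and \<open>(\<beta>)\<close> controls their traces on \<open>L\<close>;
  since \<open>B\<close>, \<open>B / H\<close> and \<open>B / K\<close> are residually in the class, some compatible \<open>N\<close> keeps any given
  reduced word reduced modulo \<open>N\<close> (\<open>compatible_exists\<close>). For a compatible \<open>N\<close> there is a quotient of
  \<open>E\<close> in the class in which no element of \<open>B\<close> outside \<open>N\<close> dies. It is obtained first modulo \<open>L\<close>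
  (\<open>base_mod_L\<close>), where the images of \<open>H\<close> and \<open>K\<close> can be seen over two different points of an
  auxiliary quotient, one of which \<open>t\<close> carries to the other; this uses that \<open>\<UU>\<close> is \<open>\<HH>\<close> or \<open>\<KK>\<close> and
  therefore becomes a member of the class modulo \<open>N\<close>. Then \<open>L\<close> is treated by the action of
  \<open>E\<close> on it, which is governed by \<open>\<VV>\<close> (\<open>base_mod_N\<close>). Finally, reduced words that still
  die are separated from \<open>B\<close> by refining the quotient step by step, as one separates an element of a
  free group by coverings of a graph (\<open>separating_class_normal\<close>).

  Necessity. The same constructions for the class of all groups and \<open>N = 1\<close> give Britton's lemma.
  If \<open>\<UU> = \<HH>\<close>, then for each \<open>c\<close> in \<open>B\<close> the element \<open>t c t\<^sup>-\<^sup>1\<close> acts on \<open>H\<close> like some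
  \<open>c'\<close> in \<open>B\<close>, so that \<open>t c t\<^sup>-\<^sup>1 c'\<^sup>-\<^sup>1\<close> centralizes \<open>H\<close>. By Britton's lemma an element
  outside \<open>H\<close> does not commute with it when \<open>c\<close> is outside \<open>K\<close>, and in a residually \<open>\<C>\<close> group this
  separates the element from \<open>H\<close>; the argument for \<open>K\<close> is similar.

  The case \<open>\<UU> = \<KK>\<close> is the case \<open>\<UU> = \<HH>\<close> for \<open>\<phi>\<^sup>-\<^sup>1\<close>: replacing \<open>t\<close> by its inverse
  identifies the two HNN-extensions.
\<close>


section \<open>Normal subgroups with quotient in a root class\<close>

lemma subgroup_image:
  assumes "group G" "group G'" "f \<in> hom G G'"
  shows "subgroup (f ` carrier G) G'"
  using assms group_hom.img_is_subgroup[of G G' f] by (simp add: group_hom_def group_hom_axioms_def)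

lemma normal_kernel_hom:
  assumes "group G" "group G'" "f \<in> hom G G'"
  shows "kernel G G' f \<lhd> G"
  using assms group_hom.normal_kernel[of G G' f] by (simp add: group_hom_def group_hom_axioms_def)

lemma Mod_kernel_iso:
  assumes "group G" "group G'" "f \<in> hom G G'"
  shows "G Mod kernel G G' f \<cong> G'\<lparr>carrier := f ` carrier G\<rparr>"
proof -
  let ?I = "G'\<lparr>carrier := f ` carrier G\<rparr>"
  have I: "group ?I"
    using subgroup.subgroup_is_group[OF subgroup_image[OF assms] assms(2)] .
  have f: "f \<in> hom G ?I"
    using assms(3) by (auto simp: hom_def)
  have "kernel G ?I f = kernel G G' f"
    by (simp add: kernel_def)
  then show ?thesis
    using group_hom.FactGroup_iso[of G ?I f] assms(1) I f
    by (simp add: group_hom_def group_hom_axioms_def)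
qed

lemma hom_restrict_carrier:
  "f \<in> hom X G \<Longrightarrow> S \<subseteq> carrier X \<Longrightarrow> f \<in> hom (X\<lparr>carrier := S\<rparr>) G"
  by (auto simp: hom_def)

lemma coset_eq_iff:
  assumes "group G" "N \<lhd> G" "x \<in> carrier G" "y \<in> carrier G"
  shows "N #>\<^bsub>G\<^esub> x = N #>\<^bsub>G\<^esub> y \<longleftrightarrow> x \<otimes>\<^bsub>G\<^esub> inv\<^bsub>G\<^esub> y \<in> N"
proof -
  interpret group G by fact
  interpret normal N G by fact
  have "y \<in> N #>\<^bsub>G\<^esub> y" "x \<in> N #>\<^bsub>G\<^esub> x"
    using assms rcos_self is_subgroup by blast+
  then have "N #>\<^bsub>G\<^esub> x = N #>\<^bsub>G\<^esub> y \<longleftrightarrow> x \<in> N #>\<^bsub>G\<^esub> y"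
    using repr_independence[OF _ assms(4) is_subgroup] by blast
  then show ?thesis
    using rcos_module[OF is_group assms(4,3)] by blast
qed

lemma coset_eq_self_iff:
  assumes "group G" "N \<lhd> G" "x \<in> carrier G"
  shows "N #>\<^bsub>G\<^esub> x = N \<longleftrightarrow> x \<in> N"
proof -
  interpret group G by fact
  interpret normal N G by fact
  show ?thesis
    using coset_join1[OF _ assms(3) is_subgroup] coset_join2[OF assms(3) is_subgroup] by blast
qed

lemma hom_Mod: "N \<lhd> G \<Longrightarrow> (\<lambda>x. N #>\<^bsub>G\<^esub> x) \<in> hom G (G Mod N)"
  by (rule normal.r_coset_hom_Mod)

lemma kernel_Mod:
  assumes "group G" "N \<lhd> G"
  shows "kernel G (G Mod N) (\<lambda>x. N #>\<^bsub>G\<^esub> x) = N"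
  using assms normal_imp_subgroup[OF assms(2)] coset_eq_self_iff[OF assms]
  by (auto simp: kernel_def dest: subgroup.mem_carrier)

lemma kernel_subset_normal_image:
  assumes "group X" "group G" "f \<in> hom X G" "f ` carrier X = carrier G" "N \<lhd> X" "kernel X G f \<subseteq> N"
  shows "f ` N \<lhd> G" "\<And>x. x \<in> carrier X \<Longrightarrow> f x \<in> f ` N \<Longrightarrow> x \<in> N"
proof -
  interpret X: group X by fact
  interpret G: group G by fact
  have hom: "group_hom X G f"
    using assms by (simp add: group_hom_def group_hom_axioms_def)
  show "f ` N \<lhd> G"
    using normal.surj_hom_normal_subgroup[OF assms(5) hom assms(4)] .
  fix x assume x: "x \<in> carrier X" "f x \<in> f ` N"
  then obtain n where n: "n \<in> N" "f x = f n" by auto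
  have nX: "n \<in> carrier X"
    using n assms(5) normal_imp_subgroup subgroup.mem_carrier by metis
  interpret group_hom X G f by (rule hom)
  have "f (x \<otimes>\<^bsub>X\<^esub> inv\<^bsub>X\<^esub> n) = \<one>\<^bsub>G\<^esub>"
    using x nX n by simp
  then have "x \<otimes>\<^bsub>X\<^esub> inv\<^bsub>X\<^esub> n \<in> N"
    using assms(6) x nX by (auto simp: kernel_def)
  then have "x \<otimes>\<^bsub>X\<^esub> inv\<^bsub>X\<^esub> n \<otimes>\<^bsub>X\<^esub> n \<in> N"
    using n assms(5) normal_imp_subgroup subgroup.m_closed by metis
  then show "x \<in> N"
    using x nX by (simp add: X.m_assoc)
qed

text \<open>
  The carrier of the copy lies in the universe, which makes Gruenberg's condition available for
  groups such as the HNN-extension, whose elements are sets of words.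
\<close>

lemma transported_group:
  fixes G :: "('a, 'm) monoid_scheme"
  assumes "group G" "inj_on i (carrier G)"
  obtains X :: "'u monoid" where "group X" "i \<in> iso G X" "carrier X = i ` carrier G"
proof -
  let ?j = "inv_into (carrier G) i"
  define X :: "'u monoid" where
    "X = \<lparr>carrier = i ` carrier G, mult = (\<lambda>x y. i (?j x \<otimes>\<^bsub>G\<^esub> ?j y)), one = i \<one>\<^bsub>G\<^esub>\<rparr>"
  interpret group G by fact
  have i: "i \<in> hom G X"
    using assms(2) by (auto simp: hom_def X_def)
  have "i \<in> iso G X"
    using i assms(2) by (auto simp: iso_def bij_betw_def X_def)
  moreover have "group X"
  proof (rule groupI)
    fix x assume "x \<in> carrier X"
    then obtain g where g: "g \<in> carrier G" "x = i g"
      by (auto simp: X_def)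
    show "\<exists>y\<in>carrier X. y \<otimes>\<^bsub>X\<^esub> x = \<one>\<^bsub>X\<^esub>"
      by (rule bexI[of _ "i (inv\<^bsub>G\<^esub> g)"]) (use g assms(2) in \<open>auto simp: X_def\<close>)
  qed (use assms(2) in \<open>auto simp: X_def m_assoc\<close>)
  ultimately show thesis
    using that[of X] by (simp add: X_def)
qed

lemma lepoll_prod_infinite:
  assumes "infinite (UNIV :: 'u set)" "A \<lesssim> (UNIV :: 'u set)" "C \<lesssim> (UNIV :: 'u set)"
  shows "A \<times> C \<lesssim> (UNIV :: 'u set)"
proof -
  have "(UNIV :: 'u set) \<times> (UNIV :: 'u set) \<approx> (UNIV :: 'u set)"
    using card_of_Times_same_infinite[OF assms(1)] by (simp add: eqpoll_iff_card_of_ordIso)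
  then show ?thesis
    using times_lepoll_mono[OF assms(2,3)] lepoll_trans2 by blast
qed

lemma lists_lepoll_infinite:
  fixes A :: "'a set"
  assumes "infinite (UNIV :: 'u set)" "A \<lesssim> (UNIV :: 'u set)"
  shows "lists A \<lesssim> (UNIV :: 'u set)"
proof -
  have "(UNIV :: nat set) \<lesssim> (UNIV :: 'u set)"
    using assms(1) infinite_le_lepoll by blast
  then have "(UNIV :: nat set) \<times> (UNIV :: 'u set) \<lesssim> (UNIV :: 'u set)"
    and "A \<times> (UNIV :: 'u set) \<lesssim> (UNIV :: 'u set)"
    using assms lepoll_prod_infinite by blast+
  then obtain p :: "nat \<times> 'u \<Rightarrow> 'u" and q :: "'a \<times> 'u \<Rightarrow> 'u" where p: "inj p" and q: "inj_on q (A \<times> (UNIV :: 'u set))"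
    unfolding lepoll_def UNIV_Times_UNIV by blast
  define enc where "enc xs = foldr (\<lambda>a u. q (a, u)) xs (undefined :: 'u)" for xs
  have enc: "xs = ys" if "length xs = length ys" "xs \<in> lists A" "ys \<in> lists A" "enc xs = enc ys" for xs ys
    using that
  proof (induction xs ys rule: list_induct2)
    case (Cons x xs y ys)
    then show ?case
      using q by (auto simp: enc_def inj_on_def)
  qed simp
  have "inj_on (\<lambda>xs. p (length xs, enc xs)) (lists A)"
  proof (rule inj_onI)
    fix xs ys
    assume xy: "xs \<in> lists A" "ys \<in> lists A" "p (length xs, enc xs) = p (length ys, enc ys)"
    have "(length xs, enc xs) = (length ys, enc ys)"
      using injD[OF p xy(3)] .
    then show "xs = ys"
      using enc[OF _ xy(1,2)] by blast
  qed
  then show ?thesis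
    unfolding lepoll_def by auto
qed

locale quotient_closed_root_class =
  fixes \<C> :: "'u monoid \<Rightarrow> bool"
  assumes root: "root_class \<C>"
    and quotients: "quotient_closed \<C>"
    and infinite_universe: "infinite (UNIV :: 'u set)"
begin

lemma class_group: "\<C> X \<Longrightarrow> group X"
  using root by (auto simp: root_class_def group_class_def)

lemma in_class_self: "\<C> X \<Longrightarrow> in_class \<C> X"
  using root by (simp add: root_class_def in_class_iff)

lemma in_class_group: "in_class \<C> G \<Longrightarrow> group G"
  by (simp add: in_class_def)

lemma in_class_hom_image:
  assumes "in_class \<C> G" "group G'" "f \<in> hom G G'" "f ` carrier G = carrier G'"
  shows "in_class \<C> G'"
proof -
  obtain X i where X: "\<C> X" "i \<in> iso X G"
    using assms(1) group.iso_sym[of G] unfolding in_class_def is_iso_def by blast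
  have gX: "group X"
    using X class_group by blast
  let ?g = "f \<circ> i"
  have g: "?g \<in> hom X G'" "?g ` carrier X = carrier G'"
    using X(2) assms(3,4) hom_compose[of i X G f G']
    by (simp_all add: iso_def bij_betw_def image_comp[symmetric] del: image_comp o_apply)
  have "X Mod kernel X G' ?g \<cong> G'"
    using group_hom.FactGroup_iso[of X G' ?g] g gX assms(2)
    by (simp add: group_hom_def group_hom_axioms_def)
  moreover have "in_class \<C> (X Mod kernel X G' ?g)"
    using quotients X(1) normal_kernel_hom[OF gX assms(2) g(1)] by (auto simp: quotient_closed_def)
  ultimately show ?thesis
    unfolding in_class_def using assms(2) group.iso_sym iso_trans by blast
qed

lemma in_class_iso:
  assumes "in_class \<C> G" "group G'" "G \<cong> G'"
  shows "in_class \<C> G'"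
  using assms in_class_hom_image by (fastforce simp: is_iso_def iso_def bij_betw_def)

lemma in_class_subgroup:
  assumes "in_class \<C> G" "subgroup S G"
  shows "in_class \<C> (G\<lparr>carrier := S\<rparr>)"
proof -
  obtain X i where X: "\<C> X" "i \<in> iso G X" and G: "group G"
    using assms(1) unfolding in_class_def is_iso_def by blast
  have gX: "group X"
    using X class_group by blast
  have hom: "group_hom G X i"
    using X gX G by (simp add: group_hom_def group_hom_axioms_def iso_def)
  have S: "subgroup (i ` S) X"
    using group_hom.subgroup_img_is_subgroup[OF hom assms(2)] .
  have "\<C> (X\<lparr>carrier := i ` S\<rparr>)"
    using root X(1) S by (simp add: root_class_def)
  moreover have "i \<in> iso (G\<lparr>carrier := S\<rparr>) (X\<lparr>carrier := i ` S\<rparr>)"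
    using X(2) subgroup.subset[OF assms(2)]
      hom_restrict_carrier[of i G X S]
    by (auto simp: iso_def bij_betw_def intro: inj_on_subset homI hom_mult hom_in_carrier)
      (auto simp: hom_def Pi_def)
  ultimately show ?thesis
    using assms(2) G subgroup.subgroup_is_group unfolding in_class_def is_iso_def by blast
qed

lemma in_class_lepoll:
  assumes "in_class \<C> G"
  shows "carrier G \<lesssim> (UNIV :: 'u set)"
proof -
  obtain X :: "'u monoid" and i where "i \<in> iso G X"
    using assms unfolding in_class_def is_iso_def by blast
  then have "inj_on i (carrier G)"
    by (simp add: iso_def bij_betw_def)
  then show ?thesis
    unfolding lepoll_def by auto
qed

lemma nontrivial_member:
  obtains X s where "\<C> X" "group X" "s \<in> carrier X" "s \<noteq> \<one>\<^bsub>X\<^esub>"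
proof -
  obtain X where X: "\<C> X" "carrier X \<noteq> {\<one>\<^bsub>X\<^esub>}"
    using root by (auto simp: root_class_def)
  moreover have "group X" using X class_group by blast
  moreover have "\<one>\<^bsub>X\<^esub> \<in> carrier X"
    using \<open>group X\<close> by (meson group.is_monoid monoid.one_closed)
  ultimately show thesis using that by blast
qed

lemma kernel_class_normal:
  assumes "group X" "group G" "in_class \<C> G" "f \<in> hom X G"
  shows "kernel X G f \<in> class_normals \<C> X"
proof -
  have n: "kernel X G f \<lhd> X"
    using normal_kernel_hom assms by blast
  have "in_class \<C> (G\<lparr>carrier := f ` carrier X\<rparr>)"
    using in_class_subgroup[OF assms(3)] subgroup_image[OF assms(1,2,4)] by blast
  then have "in_class \<C> (X Mod kernel X G f)"
    using in_class_iso Mod_kernel_iso[OF assms(1,2,4)] normal.factorgroup_is_group[OF n]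
      group.iso_sym in_class_group by blast
  with n show ?thesis
    by (simp add: class_normals_def)
qed

lemma class_normal_superset:
  assumes "group X" "T \<in> class_normals \<C> X" "N \<lhd> X" "T \<subseteq> N"
  shows "N \<in> class_normals \<C> X"
proof -
  have T: "T \<lhd> X" "in_class \<C> (X Mod T)"
    using assms(2) by (auto simp: class_normals_def)
  have hom: "group_hom X (X Mod N) (\<lambda>x. N #>\<^bsub>X\<^esub> x)"
    using assms(1,3) hom_Mod normal.factorgroup_is_group[OF assms(3)]
    by (simp add: group_hom_def group_hom_axioms_def)
  obtain g where g: "g \<in> hom (X Mod T) (X Mod N)"
      "\<And>x. x \<in> carrier X \<Longrightarrow> g (T #>\<^bsub>X\<^esub> x) = N #>\<^bsub>X\<^esub> x"
    using group_hom.FactGroup_universal_kernel[OF hom T(1)] assms kernel_Mod by metis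
  have "g ` carrier (X Mod T) = carrier (X Mod N)"
    using g(2) by (auto simp: carrier_FactGroup image_iff)
  then have "in_class \<C> (X Mod N)"
    using in_class_hom_image[OF T(2) normal.factorgroup_is_group[OF assms(3)] g(1)] by blast
  with assms(3) show ?thesis
    by (simp add: class_normals_def)
qed

text \<open>
  A homomorphic image of \<open>X\<close> is an image of \<open>X / N\<close> if \<open>N\<close> lies in the kernel.
\<close>

lemma in_class_if_class_normal_kernel:
  assumes "group X" "group G" "f \<in> hom X G" "f ` carrier X = carrier G"
    and "N \<in> class_normals \<C> X" "N \<subseteq> kernel X G f"
  shows "in_class \<C> G"
proof -
  have "kernel X G f \<in> class_normals \<C> X"
    using class_normal_superset assms normal_kernel_hom by blast
  then have "in_class \<C> (X Mod kernel X G f)"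
    by (simp add: class_normals_def)
  moreover have "X Mod kernel X G f \<cong> G"
    using Mod_kernel_iso[OF assms(1-3)] assms(4) by simp
  ultimately show ?thesis
    using in_class_iso assms(2) by blast
qed

lemma class_normal_vimage:
  assumes "group X" "group G" "f \<in> hom X G" "N \<in> class_normals \<C> G"
  shows "{x \<in> carrier X. f x \<in> N} \<in> class_normals \<C> X"
proof -
  have N: "N \<lhd> G" "in_class \<C> (G Mod N)"
    using assms(4) by (auto simp: class_normals_def)
  let ?g = "(\<lambda>x. N #>\<^bsub>G\<^esub> x) \<circ> f"
  have "?g \<in> hom X (G Mod N)"
    using assms(3) hom_Mod[OF N(1)] by (rule hom_compose)
  then have "kernel X (G Mod N) ?g \<in> class_normals \<C> X"
    using kernel_class_normal[OF assms(1) normal.factorgroup_is_group[OF N(1)] N(2)] by blast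
  moreover have "kernel X (G Mod N) ?g = {x \<in> carrier X. f x \<in> N}"
    using coset_eq_self_iff[OF assms(2) N(1) hom_in_carrier[OF assms(3)]]
    unfolding kernel_def by (intro Collect_cong) (simp cong: conj_cong)
  ultimately show ?thesis by simp
qed

lemma class_normal_restrict:
  assumes "group X" "subgroup S X" "N \<in> class_normals \<C> X"
  shows "N \<inter> S \<in> class_normals \<C> (X\<lparr>carrier := S\<rparr>)"
proof -
  have "(\<lambda>x. x) \<in> hom (X\<lparr>carrier := S\<rparr>) X"
    using subgroup.subset[OF assms(2)] by (auto simp: hom_def)
  then have "{x \<in> carrier (X\<lparr>carrier := S\<rparr>). x \<in> N} \<in> class_normals \<C> (X\<lparr>carrier := S\<rparr>)"
    using class_normal_vimage[OF subgroup.subgroup_is_group[OF assms(2,1)] assms(1) _ assms(3)] by blast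
  moreover have "{x \<in> carrier (X\<lparr>carrier := S\<rparr>). x \<in> N} = N \<inter> S"
    by auto
  ultimately show ?thesis by simp
qed

lemma Gruenberg_in_universe:
  fixes X :: "'u monoid"
  assumes "group X" "Y \<in> class_normals \<C> X" "Z \<in> class_normals \<C> (X\<lparr>carrier := Y\<rparr>)"
  obtains T where "T \<in> class_normals \<C> X" "T \<subseteq> Z"
  using root assms unfolding root_class_def class_normals_def by blast

text \<open>
  The lower term \<open>Z\<close> of the subnormal series is the kernel of \<open>f\<close>. In this form the condition takes the
  place of embeddings into wreath products, which may be too large for the universe.
\<close>

lemma Gruenberg:
  assumes "group X" "carrier X \<lesssim> (UNIV :: 'u set)" "Y \<in> class_normals \<C> X"
    and "group G" "in_class \<C> G" "f \<in> hom (X\<lparr>carrier := Y\<rparr>) G"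
  obtains T where "T \<in> class_normals \<C> X" "T \<subseteq> Y" "\<And>x. x \<in> T \<Longrightarrow> f x = \<one>\<^bsub>G\<^esub>"
proof -
  obtain i :: "_ \<Rightarrow> 'u" where "inj_on i (carrier X)"
    using assms(2) unfolding lepoll_def by blast
  then obtain X' :: "'u monoid" where X': "group X'" "i \<in> iso X X'" "carrier X' = i ` carrier X"
    using transported_group[OF assms(1)] by blast
  define j where "j = inv_into (carrier X) i"
  have j: "j \<in> iso X' X"
    unfolding j_def using group.iso_set_sym[OF assms(1) X'(2)] .
  have ji: "j (i x) = x" if "x \<in> carrier X" for x
    using that \<open>inj_on i _\<close> by (simp add: j_def)
  have ij: "i (j x) = x" "j x \<in> carrier X" if "x \<in> carrier X'" for x
    using that by (auto simp: j_def X'(3) inv_into_into f_inv_into_f)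
  have jh: "j \<in> hom X' X" and ih: "i \<in> hom X X'"
    using j X' by (auto simp: iso_def)
  define Y' where "Y' = {x \<in> carrier X'. j x \<in> Y}"
  have Y': "Y' \<in> class_normals \<C> X'"
    unfolding Y'_def using class_normal_vimage[OF X'(1) assms(1) jh assms(3)] .
  have sY': "subgroup Y' X'" and sY: "subgroup Y X"
    using Y' assms(3) normal_imp_subgroup by (auto simp: class_normals_def)
  have jY: "j \<in> hom (X'\<lparr>carrier := Y'\<rparr>) (X\<lparr>carrier := Y\<rparr>)"
    using jh by (auto simp: hom_def Y'_def)
  let ?Z = "kernel (X'\<lparr>carrier := Y'\<rparr>) G (f \<circ> j)"
  have "?Z \<in> class_normals \<C> (X'\<lparr>carrier := Y'\<rparr>)"
    by (rule kernel_class_normal[OF _ assms(4,5) hom_compose[OF jY assms(6)]])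
      (rule subgroup.subgroup_is_group[OF sY' X'(1)])
  then obtain T' where T': "T' \<in> class_normals \<C> X'" "T' \<subseteq> ?Z"
    using Gruenberg_in_universe[OF X'(1) Y'] by blast
  let ?T = "{x \<in> carrier X. i x \<in> T'}"
  have *: "x \<in> Y \<and> f x = \<one>\<^bsub>G\<^esub>" if "x \<in> ?T" for x
    using that T'(2) ji by (auto simp: kernel_def Y'_def)
  show thesis
    by (rule that[OF class_normal_vimage[OF assms(1) X'(1) ih T'(1)]]) (use * in blast)+
qed

lemma carrier_class_normal:
  assumes "group X"
  shows "carrier X \<in> class_normals \<C> X"
proof -
  obtain G :: "'u monoid" where "\<C> G" "group G"
    by (rule nontrivial_member)
  moreover have "(\<lambda>_. \<one>\<^bsub>G\<^esub>) \<in> hom X G"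
  proof -
    interpret G: group G by fact
    show ?thesis by (rule homI) simp_all
  qed
  ultimately have "kernel X G (\<lambda>_. \<one>\<^bsub>G\<^esub>) \<in> class_normals \<C> X"
    using kernel_class_normal[OF assms] in_class_self by blast
  moreover have "kernel X G (\<lambda>_. \<one>\<^bsub>G\<^esub>) = carrier X"
    by (auto simp: kernel_def)
  ultimately show ?thesis by simp
qed

text \<open>
  In the series \<open>N \<inter> N' \<le> N \<le> X\<close> the lower factor embeds in \<open>X / N'\<close>, so Gruenberg's condition
  provides a member of the family inside \<open>N \<inter> N'\<close>.
\<close>

lemma class_normal_Int:
  assumes "group X" "carrier X \<lesssim> (UNIV :: 'u set)" "N \<in> class_normals \<C> X" "N' \<in> class_normals \<C> X"
  shows "N \<inter> N' \<in> class_normals \<C> X"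
proof -
  have N: "N \<lhd> X" "N' \<lhd> X" "in_class \<C> (X Mod N')"
    using assms by (auto simp: class_normals_def)
  have "(\<lambda>x. N' #>\<^bsub>X\<^esub> x) \<in> hom (X\<lparr>carrier := N\<rparr>) (X Mod N')"
    using hom_restrict_carrier[OF hom_Mod[OF N(2)] subgroup.subset[OF normal_imp_subgroup[OF N(1)]]] .
  then obtain T where T: "T \<in> class_normals \<C> X" "T \<subseteq> N" "\<And>x. x \<in> T \<Longrightarrow> N' #>\<^bsub>X\<^esub> x = N'"
    using Gruenberg[OF assms(1-3) normal.factorgroup_is_group[OF N(2)] N(3)] one_FactGroup by auto
  have "T \<subseteq> N'"
    using T coset_eq_self_iff[OF assms(1) N(2)] subgroup.mem_carrier[OF normal_imp_subgroup[OF N(1)]] by blast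
  then show ?thesis
    using class_normal_superset[OF assms(1) T(1)] T(2) group.normal_subgroup_intersect[OF assms(1) N(1,2)]
    by blast
qed

lemma residually_iff:
  assumes "group X"
  shows "residually \<C> X \<longleftrightarrow> (\<forall>x \<in> carrier X. x \<noteq> \<one>\<^bsub>X\<^esub> \<longrightarrow> (\<exists>N \<in> class_normals \<C> X. x \<notin> N))"
proof
  assume r: "residually \<C> X"
  show "\<forall>x \<in> carrier X. x \<noteq> \<one>\<^bsub>X\<^esub> \<longrightarrow> (\<exists>N \<in> class_normals \<C> X. x \<notin> N)"
  proof (intro ballI impI)
    fix x assume "x \<in> carrier X" "x \<noteq> \<one>\<^bsub>X\<^esub>"
    then obtain G f where f: "\<C> G" "f \<in> hom X G" "f x \<noteq> \<one>\<^bsub>G\<^esub>"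
      using r unfolding residually_def by blast
    then have "kernel X G f \<in> class_normals \<C> X" "x \<notin> kernel X G f"
      using kernel_class_normal[OF assms] class_group in_class_self by (auto simp: kernel_def)
    then show "\<exists>N \<in> class_normals \<C> X. x \<notin> N" by blast
  qed
next
  assume r: "\<forall>x \<in> carrier X. x \<noteq> \<one>\<^bsub>X\<^esub> \<longrightarrow> (\<exists>N \<in> class_normals \<C> X. x \<notin> N)"
  show "residually \<C> X"
    unfolding residually_def
  proof (intro ballI impI)
    fix x assume x: "x \<in> carrier X" "x \<noteq> \<one>\<^bsub>X\<^esub>"
    then obtain N where N: "N \<lhd> X" "in_class \<C> (X Mod N)" "x \<notin> N"
      using r by (auto simp: class_normals_def)
    obtain G i where G: "\<C> G" "i \<in> iso (X Mod N) G"
      using N(2) by (auto simp: in_class_def is_iso_def)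
    have gG: "group G" using G class_group by blast
    let ?f = "i \<circ> (\<lambda>x. N #>\<^bsub>X\<^esub> x)"
    have "?f \<in> hom X G"
      using hom_compose[OF hom_Mod[OF N(1)]] G(2) by (auto simp: iso_def)
    moreover have "?f ` carrier X = carrier G"
      using G(2) by (auto simp: iso_def bij_betw_def carrier_FactGroup)
    moreover have "?f x \<noteq> \<one>\<^bsub>G\<^esub>"
    proof
      assume "?f x = \<one>\<^bsub>G\<^esub>"
      moreover have "i (\<one>\<^bsub>X Mod N\<^esub>) = \<one>\<^bsub>G\<^esub>"
        using hom_one[of i "X Mod N" G] G(2) gG normal.factorgroup_is_group[OF N(1)] by (auto simp: iso_def)
      moreover have "inj_on i (carrier (X Mod N))"
        using G(2) by (auto simp: iso_def bij_betw_def)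
      moreover have "\<one>\<^bsub>X Mod N\<^esub> \<in> carrier (X Mod N)"
        using normal.factorgroup_is_group[OF N(1)] by (meson group.is_monoid monoid.one_closed)
      moreover have "N #>\<^bsub>X\<^esub> x \<in> carrier (X Mod N)"
        using x(1) by (simp add: carrier_FactGroup)
      ultimately have "N #>\<^bsub>X\<^esub> x = \<one>\<^bsub>X Mod N\<^esub>"
        by (intro inj_onD[of i "carrier (X Mod N)"]) simp_all
      then have "N #>\<^bsub>X\<^esub> x = N"
        by simp
      then show False
        using coset_eq_self_iff[OF assms N(1) x(1)] N(3) by simp
    qed
    ultimately show "\<exists>G f. \<C> G \<and> f \<in> hom X G \<and> f ` carrier X = carrier G \<and> f x \<noteq> \<one>\<^bsub>G\<^esub>"
      using G(1) by blast
  qed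
qed

lemma residually_Mod_iff:
  assumes "group X" "A \<lhd> X"
  shows "residually \<C> (X Mod A) \<longleftrightarrow>
    (\<forall>x \<in> carrier X. x \<notin> A \<longrightarrow> (\<exists>N \<in> class_normals \<C> X. A \<subseteq> N \<and> x \<notin> N))"
proof -
  let ?p = "\<lambda>x. A #>\<^bsub>X\<^esub> x"
  have gQ: "group (X Mod A)"
    using normal.factorgroup_is_group[OF assms(2)] .
  have p: "?p \<in> hom X (X Mod A)" "?p ` carrier X = carrier (X Mod A)"
    using hom_Mod[OF assms(2)] by (auto simp: carrier_FactGroup)
  show ?thesis
    unfolding residually_iff[OF gQ]
  proof (intro iffI ballI impI)
    fix x assume r: "\<forall>q \<in> carrier (X Mod A). q \<noteq> \<one>\<^bsub>X Mod A\<^esub> \<longrightarrow> (\<exists>N \<in> class_normals \<C> (X Mod A). q \<notin> N)"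
      and x: "x \<in> carrier X" "x \<notin> A"
    have "?p x \<in> carrier (X Mod A)" "?p x \<noteq> \<one>\<^bsub>X Mod A\<^esub>"
      using x coset_eq_self_iff[OF assms x(1)] by (auto simp: carrier_FactGroup)
    then obtain N where N: "N \<in> class_normals \<C> (X Mod A)" "?p x \<notin> N"
      using r by blast
    have "\<one>\<^bsub>X Mod A\<^esub> \<in> N"
      using N(1) normal_imp_subgroup subgroup.one_closed by (fastforce simp: class_normals_def)
    then have "A \<subseteq> {x \<in> carrier X. ?p x \<in> N}"
      using coset_eq_self_iff[OF assms] subgroup.mem_carrier[OF normal_imp_subgroup[OF assms(2)]] by fastforce
    then show "\<exists>N \<in> class_normals \<C> X. A \<subseteq> N \<and> x \<notin> N"
      using class_normal_vimage[OF assms(1) gQ p(1) N(1)] N(2) by blast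
  next
    fix q assume r: "\<forall>x \<in> carrier X. x \<notin> A \<longrightarrow> (\<exists>N \<in> class_normals \<C> X. A \<subseteq> N \<and> x \<notin> N)"
      and q: "q \<in> carrier (X Mod A)" "q \<noteq> \<one>\<^bsub>X Mod A\<^esub>"
    then obtain x where x: "x \<in> carrier X" "q = ?p x"
      using p(2) by blast
    have "x \<notin> A"
      using q x coset_eq_self_iff[OF assms x(1)] by auto
    then obtain N where N: "N \<in> class_normals \<C> X" "A \<subseteq> N" "x \<notin> N"
      using r x by blast
    have nN: "N \<lhd> X" using N by (simp add: class_normals_def)
    have k: "kernel X (X Mod A) ?p \<subseteq> N"
      using kernel_Mod[OF assms] N by simp
    note im = kernel_subset_normal_image[OF assms(1) gQ p nN k]
    have sN: "subgroup N X" using nN normal_imp_subgroup by blast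
    let ?f = "(\<lambda>y. (?p ` N) #>\<^bsub>X Mod A\<^esub> y) \<circ> ?p"
    have f: "?f \<in> hom X (X Mod A Mod ?p ` N)"
      using p(1) hom_Mod[OF im(1)] by (rule hom_compose)
    have "in_class \<C> (X Mod A Mod ?p ` N)"
    proof (rule in_class_if_class_normal_kernel[OF assms(1) _ f _ N(1)])
      show "group (X Mod A Mod ?p ` N)"
        using normal.factorgroup_is_group[OF im(1)] .
      show "?f ` carrier X = carrier (X Mod A Mod ?p ` N)"
        unfolding carrier_FactGroup[of "X Mod A"] p(2)[symmetric] by (simp add: image_comp)
      show "N \<subseteq> kernel X (X Mod A Mod ?p ` N) ?f"
      proof
        fix y assume y: "y \<in> N"
        then have "y \<in> carrier X" using subgroup.mem_carrier[OF sN] by blast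
        moreover have "?p y \<in> carrier (X Mod A)" using \<open>y \<in> carrier X\<close> p(2) by blast
        ultimately show "y \<in> kernel X (X Mod A Mod ?p ` N) ?f"
          using coset_eq_self_iff[OF gQ im(1)] y by (simp add: kernel_def)
      qed
    qed
    then have "?p ` N \<in> class_normals \<C> (X Mod A)"
      using im(1) by (simp add: class_normals_def)
    moreover have "q \<notin> ?p ` N"
      using im(2) x N(3) by auto
    ultimately show "\<exists>N \<in> class_normals \<C> (X Mod A). q \<notin> N"
      by blast
  qed
qed

lemma class_normal_avoiding_finite:
  assumes "group X" "carrier X \<lesssim> (UNIV :: 'u set)" "A \<subseteq> carrier X" "finite S"
    and "\<And>x. x \<in> S \<Longrightarrow> \<exists>N \<in> class_normals \<C> X. A \<subseteq> N \<and> x \<notin> N"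
  shows "\<exists>N \<in> class_normals \<C> X. A \<subseteq> N \<and> N \<inter> S = {}"
  using assms(4,5)
proof (induction S)
  case empty
  then show ?case
    using carrier_class_normal[OF assms(1)] assms(3) by auto
next
  case (insert x S)
  have "\<exists>N \<in> class_normals \<C> X. A \<subseteq> N \<and> N \<inter> S = {}"
    by (rule insert.IH) (rule insert.prems, simp)
  then obtain N where N: "N \<in> class_normals \<C> X" "A \<subseteq> N" "N \<inter> S = {}"
    by blast
  obtain N' where N': "N' \<in> class_normals \<C> X" "A \<subseteq> N'" "x \<notin> N'"
    using insert.prems[of x] by blast
  show ?case
    using class_normal_Int[OF assms(1,2) N(1) N'(1)] N N' by (intro bexI[of _ "N \<inter> N'"]) auto
qed

end

lemma in_class_all_groups:
  fixes G :: "('a, 'm) monoid_scheme"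
  assumes "group G" "carrier G \<lesssim> (UNIV :: 'u set)"
  shows "in_class (group :: 'u monoid \<Rightarrow> bool) G"
proof -
  obtain i :: "'a \<Rightarrow> 'u" where i: "inj_on i (carrier G)"
    using assms(2) unfolding lepoll_def by blast
  obtain X :: "'u monoid" where "group X" "i \<in> iso G X"
    using transported_group[OF assms(1) i] by blast
  then show ?thesis
    using assms(1) unfolding in_class_def is_iso_def by blast
qed

text \<open>
  In the class of all groups Gruenberg's condition is satisfied by \<open>T = 1\<close>. Results about
  root classes, applied to this class, become results about the HNN-extension itself.
\<close>

lemma all_groups_root_class:
  fixes X :: "'u monoid"
  assumes "infinite (UNIV :: 'u set)" "group X" "carrier X \<noteq> {\<one>\<^bsub>X\<^esub>}"
  shows "quotient_closed_root_class (group :: 'u monoid \<Rightarrow> bool)"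
proof
  have Mod: "in_class (group :: 'u monoid \<Rightarrow> bool) (G Mod N)" if "N \<lhd> G" for G :: "'u monoid" and N
  proof (rule in_class_all_groups)
    show "group (G Mod N)"
      using that by (rule normal.factorgroup_is_group)
    have "carrier (G Mod N) \<lesssim> carrier G"
      by (simp add: carrier_FactGroup image_lepoll)
    then show "carrier (G Mod N) \<lesssim> (UNIV :: 'u set)"
      using subset_imp_lepoll[of "carrier G" UNIV] lepoll_trans by blast
  qed
  show "quotient_closed (group :: 'u monoid \<Rightarrow> bool)"
    using Mod by (auto simp: quotient_closed_def)
  show "root_class (group :: 'u monoid \<Rightarrow> bool)"
    unfolding root_class_def group_class_def
  proof (intro conjI allI impI)
    show "\<exists>X :: 'u monoid. group X \<and> carrier X \<noteq> {\<one>\<^bsub>X\<^esub>}"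
      using assms by blast
    fix G :: "'u monoid" and Y Z
    assume G: "group G" and YZ: "Y \<lhd> G" "Z \<lhd> G\<lparr>carrier := Y\<rparr>"
    have "{\<one>\<^bsub>G\<^esub>} \<lhd> G"
      using G by (rule group.one_is_normal)
    moreover have "{\<one>\<^bsub>G\<^esub>} \<subseteq> Z"
      using YZ(2) normal_imp_subgroup subgroup.one_closed by fastforce
    ultimately show "\<exists>T. T \<lhd> G \<and> in_class (group :: 'u monoid \<Rightarrow> bool) (G Mod T) \<and> T \<subseteq> Z"
      using Mod by (intro exI[of _ "{\<one>\<^bsub>G\<^esub>}"] conjI) simp_all
  qed (simp_all add: subgroup.subgroup_is_group)
qed (rule assms)


section \<open>Unrestricted wreath products\<close>

text \<open>
  The pair \<open>(p, f)\<close> stands for the map \<open>(x, g) \<mapsto> (p x, f x \<cdot> g)\<close> of \<open>P \<times> \<Gamma>\<close> to itself, and the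
  multiplication is the composition of such maps.
\<close>

definition wreath ::
    "('p, 'm) monoid_scheme \<Rightarrow> ('g, 'n) monoid_scheme \<Rightarrow> ('p \<times> ('p \<Rightarrow> 'g)) monoid" where
  "wreath P \<Gamma> =
     \<lparr>carrier = carrier P \<times> (carrier P \<rightarrow>\<^sub>E carrier \<Gamma>),
      mult = (\<lambda>(p, f) (q, g). (p \<otimes>\<^bsub>P\<^esub> q, \<lambda>x\<in>carrier P. f (q \<otimes>\<^bsub>P\<^esub> x) \<otimes>\<^bsub>\<Gamma>\<^esub> g x)),
      one = (\<one>\<^bsub>P\<^esub>, \<lambda>x\<in>carrier P. \<one>\<^bsub>\<Gamma>\<^esub>)\<rparr>"

lemma group_wreath:
  assumes "group P" "group \<Gamma>"
  shows "group (wreath P \<Gamma>)"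
proof -
  interpret P: group P by fact
  interpret \<Gamma>: group \<Gamma> by fact
  show ?thesis
  proof (rule groupI)
    fix w assume "w \<in> carrier (wreath P \<Gamma>)"
    then obtain p f where w: "w = (p, f)" "p \<in> carrier P" "f \<in> carrier P \<rightarrow>\<^sub>E carrier \<Gamma>"
      by (auto simp: wreath_def)
    let ?v = "(inv\<^bsub>P\<^esub> p, \<lambda>x\<in>carrier P. inv\<^bsub>\<Gamma>\<^esub> (f (inv\<^bsub>P\<^esub> p \<otimes>\<^bsub>P\<^esub> x)))"
    have f: "f x \<in> carrier \<Gamma>" if "x \<in> carrier P" for x
      using w(3) that by auto
    show "\<exists>v\<in>carrier (wreath P \<Gamma>). v \<otimes>\<^bsub>wreath P \<Gamma>\<^esub> w = \<one>\<^bsub>wreath P \<Gamma>\<^esub>"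
    proof (rule bexI)
      show "?v \<otimes>\<^bsub>wreath P \<Gamma>\<^esub> w = \<one>\<^bsub>wreath P \<Gamma>\<^esub>"
        using w(2) f by (auto simp: w(1) wreath_def restrict_def P.m_assoc[symmetric])
      show "?v \<in> carrier (wreath P \<Gamma>)"
        using w(2) f by (auto simp: wreath_def)
    qed
  next
    fix u v w
    assume "u \<in> carrier (wreath P \<Gamma>)" "v \<in> carrier (wreath P \<Gamma>)" "w \<in> carrier (wreath P \<Gamma>)"
    then obtain p f q g r k where "u = (p, f)" "v = (q, g)" "w = (r, k)"
      and "p \<in> carrier P" "q \<in> carrier P" "r \<in> carrier P"
      and fgk: "f \<in> carrier P \<rightarrow>\<^sub>E carrier \<Gamma>" "g \<in> carrier P \<rightarrow>\<^sub>E carrier \<Gamma>" "k \<in> carrier P \<rightarrow>\<^sub>E carrier \<Gamma>"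
      by (auto simp: wreath_def)
    moreover have "f x \<in> carrier \<Gamma>" "g x \<in> carrier \<Gamma>" "k x \<in> carrier \<Gamma>" if "x \<in> carrier P" for x
      using fgk that by auto
    ultimately show "u \<otimes>\<^bsub>wreath P \<Gamma>\<^esub> v \<otimes>\<^bsub>wreath P \<Gamma>\<^esub> w = u \<otimes>\<^bsub>wreath P \<Gamma>\<^esub> (v \<otimes>\<^bsub>wreath P \<Gamma>\<^esub> w)"
      by (simp add: wreath_def restrict_def P.m_assoc \<Gamma>.m_assoc fun_eq_iff)
  next
    fix w assume w: "w \<in> carrier (wreath P \<Gamma>)"
    then obtain p f where "w = (p, f)" "p \<in> carrier P" and f: "f \<in> carrier P \<rightarrow>\<^sub>E carrier \<Gamma>"
      by (auto simp: wreath_def)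
    moreover have "(\<lambda>x\<in>carrier P. \<one>\<^bsub>\<Gamma>\<^esub> \<otimes>\<^bsub>\<Gamma>\<^esub> f x) = f"
      using f by (intro ext) (auto simp: PiE_arb[OF f] intro!: \<Gamma>.l_one)
    ultimately show "\<one>\<^bsub>wreath P \<Gamma>\<^esub> \<otimes>\<^bsub>wreath P \<Gamma>\<^esub> w = w"
      by (simp add: wreath_def cong: restrict_cong)
  next
    fix u v
    assume "u \<in> carrier (wreath P \<Gamma>)" "v \<in> carrier (wreath P \<Gamma>)"
    then show "u \<otimes>\<^bsub>wreath P \<Gamma>\<^esub> v \<in> carrier (wreath P \<Gamma>)"
      by (auto simp: wreath_def intro!: \<Gamma>.m_closed) (rule PiE_mem, assumption, simp)+
  next
    show "\<one>\<^bsub>wreath P \<Gamma>\<^esub> \<in> carrier (wreath P \<Gamma>)"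
      by (auto simp: wreath_def)
  qed
qed


section \<open>Homomorphisms of HNN-extensions\<close>

lemma (in group) inv_mult_cancel:
  "x \<in> carrier G \<Longrightarrow> y \<in> carrier G \<Longrightarrow> inv x \<otimes> (x \<otimes> y) = y"
  "x \<in> carrier G \<Longrightarrow> y \<in> carrier G \<Longrightarrow> x \<otimes> (inv x \<otimes> y) = y"
  by (simp_all add: m_assoc[symmetric])

lemmas (in group) word_simps = m_assoc inv_mult_group inv_mult_cancel

text \<open>
  Von Dyck's theorem: the value of a word in \<open>G\<close> depends only on its class, by induction on the
  derivation of a congruence from the defining relations.
\<close>

lemma hnn_lift:
  assumes "group B" "group G" "f \<in> hom B G" "s \<in> carrier G" "H \<subseteq> carrier B" "\<phi> ` H \<subseteq> carrier B"
    and rel: "\<And>h. h \<in> H \<Longrightarrow> f h \<otimes>\<^bsub>G\<^esub> s = s \<otimes>\<^bsub>G\<^esub> f (\<phi> h)"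
  obtains F where "F \<in> hom (hnn_extension B H \<phi>) G"
    "\<And>b. b \<in> carrier B \<Longrightarrow> F (hnn_class B H \<phi> [Base b]) = f b" "F (hnn_class B H \<phi> [Stable]) = s"
proof -
  interpret B: group B by fact
  interpret G: group G by fact
  interpret f: group_hom B G f
    using assms by (simp add: group_hom_def group_hom_axioms_def)
  define ev where "ev = rec_hnn_letter f s (inv\<^bsub>G\<^esub> s)"
  define evs where "evs w = foldr (\<lambda>a g. ev a \<otimes>\<^bsub>G\<^esub> g) w \<one>\<^bsub>G\<^esub>" for w
  have ev [simp]: "ev (Base b) = f b" "ev Stable = s" "ev StableInv = inv\<^bsub>G\<^esub> s" for b
    by (simp_all add: ev_def)
  have ev_closed [simp]: "ev a \<in> carrier G" if "a \<in> Base ` carrier B \<union> {Stable, StableInv}" for a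
    using that assms(4) by auto
  have evs_simps [simp]: "evs [] = \<one>\<^bsub>G\<^esub>" "evs (a # w) = ev a \<otimes>\<^bsub>G\<^esub> evs w" for a w
    by (simp_all add: evs_def)
  have evs_closed [simp]: "evs w \<in> carrier G" if "w \<in> hnn_words B" for w
    using that unfolding hnn_words_def by (induction w) auto
  have evs_append: "evs (v @ w) = evs v \<otimes>\<^bsub>G\<^esub> evs w" if "v \<in> hnn_words B" "w \<in> hnn_words B" for v w
    using that(1) evs_closed[OF that(2)] unfolding hnn_words_def
    by (induction v) (auto simp: G.m_assoc hnn_words_def evs_closed[unfolded hnn_words_def])
  have sound: "v \<in> hnn_words B \<and> w \<in> hnn_words B \<and> evs v = evs w" if "hnn_eq B H \<phi> v w" for v w
    using that
  proof induction
    case (append u u' v v')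
    then show ?case
      by (simp add: hnn_words_append evs_append)
  next
    case (stable_conj h)
    then have h: "h \<in> carrier B" "\<phi> h \<in> carrier B"
      using assms(5,6) by auto
    have "inv\<^bsub>G\<^esub> s \<otimes>\<^bsub>G\<^esub> (f h \<otimes>\<^bsub>G\<^esub> s) = f (\<phi> h)"
      using rel[OF stable_conj] h assms(4) by (simp add: G.m_assoc[symmetric])
    with h assms(4) show ?case
      by (simp add: hnn_words_def)
  qed (use assms(4) in \<open>auto simp: hnn_words_def\<close>)
  let ?E = "hnn_extension B H \<phi>"
  define F where "F X = evs (SOME w. w \<in> X)" for X
  have F: "F (hnn_class B H \<phi> w) = evs w" if "w \<in> hnn_words B" for w
  proof -
    have "w \<in> hnn_class B H \<phi> w"
      using that by (simp add: hnn_class_def hnn_eq.refl)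
    then have "(SOME v. v \<in> hnn_class B H \<phi> w) \<in> hnn_class B H \<phi> w"
      by (rule someI)
    then show ?thesis
      using sound by (simp add: F_def hnn_class_def)
  qed
  have "F \<in> hom ?E G"
  proof (rule homI)
    fix X assume "X \<in> carrier ?E"
    then show "F X \<in> carrier G"
      by (auto simp: hnn_extension_def F)
  next
    fix X Y assume "X \<in> carrier ?E" "Y \<in> carrier ?E"
    then obtain v w where "v \<in> hnn_words B" "w \<in> hnn_words B" "X = hnn_class B H \<phi> v" "Y = hnn_class B H \<phi> w"
      by (auto simp: hnn_extension_def)
    then show "F (X \<otimes>\<^bsub>?E\<^esub> Y) = F X \<otimes>\<^bsub>G\<^esub> F Y"
      by (simp add: hnn_mult_class F hnn_words_append evs_append)
  qed
  moreover have "F (hnn_class B H \<phi> [Base b]) = f b" if "b \<in> carrier B" for b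
    using that F[of "[Base b]"] by (simp add: hnn_words_def)
  moreover have "F (hnn_class B H \<phi> [Stable]) = s"
    using F[of "[Stable]"] assms(4) by (simp add: hnn_words_def)
  ultimately show thesis
    by (rule that)
qed

lemma insert_lepoll_infinite:
  assumes "infinite (UNIV :: 'u set)" "A \<lesssim> (UNIV :: 'u set)"
  shows "insert a A \<lesssim> (UNIV :: 'u set)"
proof (cases "finite A")
  case True
  then show ?thesis
    using finite_lepoll_infinite[OF assms(1), of "insert a A"] by simp
next
  case False
  then show ?thesis
    using lepoll_trans[OF infinite_insert_lepoll assms(2)] by blast
qed

locale normal_hnn = B?: group B for B :: "('b, 'm) monoid_scheme" (structure) +
  fixes H K :: "'b set" and \<phi> :: "'b \<Rightarrow> 'b"
  assumes H_normal: "H \<lhd> B" and K_normal: "K \<lhd> B"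
    and \<phi>_iso: "\<phi> \<in> iso (B\<lparr>carrier := H\<rparr>) (B\<lparr>carrier := K\<rparr>)"
begin

abbreviation E :: "'b hnn_letter list set monoid" where
  "E \<equiv> hnn_extension B H \<phi>"

abbreviation E_mult (infixl "\<cdot>" 70) where
  "x \<cdot> y \<equiv> x \<otimes>\<^bsub>E\<^esub> y"

abbreviation \<iota> :: "'b \<Rightarrow> 'b hnn_letter list set" where
  "\<iota> b \<equiv> hnn_class B H \<phi> [Base b]"

abbreviation t :: "'b hnn_letter list set" where
  "t \<equiv> hnn_class B H \<phi> [Stable]"

sublocale E: group E
  by (rule group_hnn_extension[OF B.is_group])

sublocale \<iota>: group_hom B E \<iota>
  using hnn_base_hom by unfold_locales

lemma H_subgroup: "subgroup H B" and K_subgroup: "subgroup K B"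
  using H_normal K_normal by (simp_all add: normal_imp_subgroup)

lemmas H_closed = subgroup.m_closed[OF H_subgroup] subgroup.m_inv_closed[OF H_subgroup]
  and K_closed = subgroup.m_closed[OF K_subgroup] subgroup.m_inv_closed[OF K_subgroup]

lemma H_carrier [simp]: "h \<in> H \<Longrightarrow> h \<in> carrier B"
  and K_carrier [simp]: "k \<in> K \<Longrightarrow> k \<in> carrier B"
  using H_subgroup K_subgroup by (auto dest: subgroup.mem_carrier)

lemma \<phi>_mem [simp]: "h \<in> H \<Longrightarrow> \<phi> h \<in> K"
  and \<phi>_mult [simp]: "h \<in> H \<Longrightarrow> h' \<in> H \<Longrightarrow> \<phi> (h \<otimes> h') = \<phi> h \<otimes> \<phi> h'"
  and \<phi>_image: "\<phi> ` H = K"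
  and \<phi>_inj: "inj_on \<phi> H"
  using \<phi>_iso by (auto simp: iso_def hom_def bij_betw_def)

abbreviation \<psi> :: "'b \<Rightarrow> 'b" where
  "\<psi> \<equiv> inv_into H \<phi>"

lemma \<psi> [simp]: "k \<in> K \<Longrightarrow> \<psi> k \<in> H" "k \<in> K \<Longrightarrow> \<phi> (\<psi> k) = k"
  and \<psi>_\<phi> [simp]: "h \<in> H \<Longrightarrow> \<psi> (\<phi> h) = h"
  using \<phi>_image \<phi>_inj by (auto simp: inv_into_into f_inv_into_f)

lemma \<phi>_one [simp]: "\<phi> \<one> = \<one>"
proof -
  have "\<phi> \<one> = \<phi> \<one> \<otimes> \<phi> \<one>"
    using \<phi>_mult[of \<one> \<one>] subgroup.one_closed[OF H_subgroup] by simp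
  then show ?thesis
    using subgroup.one_closed[OF H_subgroup] by (simp add: B.l_cancel_one')
qed

lemma \<phi>_inv [simp]: "h \<in> H \<Longrightarrow> \<phi> (inv h) = inv \<phi> h"
  using \<phi>_mult[of "inv h" h] subgroup.m_inv_closed[OF H_subgroup]
  by (intro B.inv_equality[symmetric]) auto

lemma t_closed [simp]: "t \<in> carrier E"
  by (simp add: hnn_extension_def hnn_words_def)

lemma t_relation: "h \<in> H \<Longrightarrow> \<iota> h \<cdot> t = t \<cdot> \<iota> (\<phi> h)"
proof -
  assume h: "h \<in> H"
  have w: "[StableInv] \<in> hnn_words B" "[Stable] \<in> hnn_words B" "[Base h] \<in> hnn_words B" "[Base (\<phi> h)] \<in> hnn_words B"
    using h by (auto simp: hnn_words_def)
  let ?s = "hnn_class B H \<phi> [StableInv]"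
  have s: "?s \<in> carrier E"
    by (simp add: hnn_extension_def hnn_words_def)
  have "t \<cdot> ?s = \<one>\<^bsub>E\<^esub>"
    using hnn_mult_class[OF w(2,1)] hnn_class_eqI[OF hnn_eq.stable_inv_right]
    by (simp add: hnn_extension_def)
  moreover have "?s \<cdot> (\<iota> h \<cdot> t) = \<iota> (\<phi> h)"
    using hnn_mult_class[OF w(3,2)] hnn_mult_class[OF w(1), of "[Base h, Stable]"]
      hnn_class_eqI[OF hnn_eq.stable_conj[OF h]] h by (simp add: hnn_words_def)
  ultimately show "\<iota> h \<cdot> t = t \<cdot> \<iota> (\<phi> h)"
    using h s E.m_assoc[of t ?s "\<iota> h \<cdot> t"] by simp
qed

lemma E_induct [consumes 1, case_names one base stable stable_inv]:
  assumes "x \<in> carrier E" "P \<one>\<^bsub>E\<^esub>"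
    and "\<And>b x. b \<in> carrier B \<Longrightarrow> x \<in> carrier E \<Longrightarrow> P x \<Longrightarrow> P (\<iota> b \<cdot> x)"
    and "\<And>x. x \<in> carrier E \<Longrightarrow> P x \<Longrightarrow> P (t \<cdot> x)"
    and "\<And>x. x \<in> carrier E \<Longrightarrow> P x \<Longrightarrow> P (inv\<^bsub>E\<^esub> t \<cdot> x)"
  shows "P x"
proof -
  let ?s = "hnn_class B H \<phi> [StableInv]"
  have s: "?s \<in> carrier E"
    by (simp add: hnn_extension_def hnn_words_def)
  have "?s \<cdot> t = \<one>\<^bsub>E\<^esub>"
    using hnn_mult_class[of "[StableInv]" B "[Stable]" H \<phi>] hnn_class_eqI[OF hnn_eq.stable_inv_left]
    by (simp add: hnn_extension_def hnn_words_def)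
  then have s_eq: "?s = inv\<^bsub>E\<^esub> t"
    using s E.inv_equality by simp
  have "P (hnn_class B H \<phi> w)" if "w \<in> hnn_words B" for w
    using that
  proof (induction w)
    case Nil
    then show ?case
      using assms(2) by (simp add: hnn_extension_def)
  next
    case (Cons a w)
    then have w: "w \<in> hnn_words B" "[a] \<in> hnn_words B" and a: "a \<in> Base ` carrier B \<union> {Stable, StableInv}"
      by (auto simp: hnn_words_def)
    have "hnn_class B H \<phi> (a # w) = hnn_class B H \<phi> [a] \<cdot> hnn_class B H \<phi> w"
      using hnn_mult_class[OF w(2,1)] by simp
    moreover have "hnn_class B H \<phi> w \<in> carrier E"
      using w(1) by (simp add: hnn_extension_def)
    ultimately show ?case
      using a assms(3-5) Cons.IH[OF w(1)] s_eq by auto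
  qed
  then show ?thesis
    using assms(1) by (auto simp: hnn_extension_def)
qed

lemma E_lepoll:
  assumes "infinite (UNIV :: 'u set)" "carrier B \<lesssim> (UNIV :: 'u set)"
  shows "carrier E \<lesssim> (UNIV :: 'u set)"
proof -
  have "Base ` carrier B \<lesssim> (UNIV :: 'u set)"
    using image_lepoll assms(2) lepoll_trans by blast
  then have "insert Stable (insert StableInv (Base ` carrier B)) \<lesssim> (UNIV :: 'u set)"
    by (intro insert_lepoll_infinite assms(1))
  then have "hnn_words B \<lesssim> (UNIV :: 'u set)"
    using lists_lepoll_infinite[OF assms(1)] by (simp add: hnn_words_def insert_commute)
  then show ?thesis
    using image_lepoll lepoll_trans by (fastforce simp: hnn_extension_def)
qed

end

locale class_hnn = quotient_closed_root_class \<C> + normal_hnn B H K \<phi>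
  for \<C> :: "'u monoid \<Rightarrow> bool" and B :: "('b, 'm) monoid_scheme" (structure) and H K \<phi> +
  assumes B_lepoll: "carrier B \<lesssim> (UNIV :: 'u set)"
begin

lemma E_small: "carrier E \<lesssim> (UNIV :: 'u set)"
  by (rule E_lepoll[OF infinite_universe B_lepoll])

text \<open>
  The maps \<open>\<beta> b\<close> and \<open>\<tau>\<close> prescribe a homomorphism from \<open>E\<close> to the wreath product of \<open>\<Gamma>\<close> with
  \<open>E\<close> whose first component is the identity; \<open>\<tau>_relation\<close> is the relation \<open>h t = t \<phi>(h)\<close> in the wreath
  product. The second component of the image of \<open>x\<close> is a map \<open>f\<close> from \<open>E\<close> to \<open>\<Gamma>\<close>, and
  \<open>\<Phi> x\<close> is its value at \<open>1\<close>. As all these maps are constant on the cosets of \<open>T0\<close>, one has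
  \<open>\<Phi> (x y) = \<Phi> x \<cdot> \<Phi> y\<close> for \<open>y\<close> in \<open>T0\<close>. So \<open>\<Phi>\<close> is a homomorphism on \<open>T0\<close>, and Gruenberg's
  condition gives a subgroup \<open>T\<close> modulo which \<open>\<Phi>\<close> is a well-defined function on a quotient in the
  class.
\<close>

lemma crossed_function:
  fixes \<Gamma> :: "('g, 'n) monoid_scheme"
  assumes T0: "T0 \<in> class_normals \<C> E" and \<Gamma>: "group \<Gamma>" "in_class \<C> \<Gamma>"
    and \<beta>_closed: "\<And>b x. b \<in> carrier B \<Longrightarrow> x \<in> carrier E \<Longrightarrow> \<beta> b x \<in> carrier \<Gamma>"
    and \<tau>_closed: "\<And>x. x \<in> carrier E \<Longrightarrow> \<tau> x \<in> carrier \<Gamma>"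
    and \<beta>_invariant: "\<And>b x y. b \<in> carrier B \<Longrightarrow> x \<in> carrier E \<Longrightarrow> y \<in> T0 \<Longrightarrow> \<beta> b (x \<cdot> y) = \<beta> b x"
    and \<tau>_invariant: "\<And>x y. x \<in> carrier E \<Longrightarrow> y \<in> T0 \<Longrightarrow> \<tau> (x \<cdot> y) = \<tau> x"
    and \<beta>_mult: "\<And>b c x. b \<in> carrier B \<Longrightarrow> c \<in> carrier B \<Longrightarrow> x \<in> carrier E \<Longrightarrow>
      \<beta> (b \<otimes> c) x = \<beta> b (\<iota> c \<cdot> x) \<otimes>\<^bsub>\<Gamma>\<^esub> \<beta> c x"
    and \<tau>_relation: "\<And>h x. h \<in> H \<Longrightarrow> x \<in> carrier E \<Longrightarrow>
      \<beta> h (t \<cdot> x) \<otimes>\<^bsub>\<Gamma>\<^esub> \<tau> x = \<tau> (\<iota> (\<phi> h) \<cdot> x) \<otimes>\<^bsub>\<Gamma>\<^esub> \<beta> (\<phi> h) x"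
  shows "\<exists>T \<Phi>. T \<in> class_normals \<C> E \<and> T \<subseteq> T0 \<and> \<Phi> \<one>\<^bsub>E\<^esub> = \<one>\<^bsub>\<Gamma>\<^esub> \<and> (\<forall>x\<in>carrier E. \<Phi> x \<in> carrier \<Gamma> \<and>
    (\<forall>b\<in>carrier B. \<Phi> (\<iota> b \<cdot> x) = \<beta> b x \<otimes>\<^bsub>\<Gamma>\<^esub> \<Phi> x) \<and> \<Phi> (t \<cdot> x) = \<tau> x \<otimes>\<^bsub>\<Gamma>\<^esub> \<Phi> x \<and>
    (\<forall>y\<in>T. \<Phi> (x \<cdot> y) = \<Phi> x))"
proof -
  interpret \<Gamma>: group \<Gamma> by fact
  let ?W = "wreath E \<Gamma>"
  interpret W: group ?W
    by (rule group_wreath[OF E.is_group \<Gamma>(1)])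
  have T0E: "y \<in> carrier E" if "y \<in> T0" for y
    using T0 that normal_imp_subgroup subgroup.mem_carrier by (fastforce simp: class_normals_def)
  have W_mult: "(p, f) \<otimes>\<^bsub>?W\<^esub> (q, g) = (p \<cdot> q, \<lambda>x\<in>carrier E. f (q \<cdot> x) \<otimes>\<^bsub>\<Gamma>\<^esub> g x)" for p q f g
    by (simp add: wreath_def)
  define fB where "fB b = (\<iota> b, \<lambda>x\<in>carrier E. \<beta> b x)" for b
  define s where "s = (t, \<lambda>x\<in>carrier E. \<tau> x)"
  have fB: "fB \<in> hom B ?W"
  proof (rule homI)
    fix b assume "b \<in> carrier B"
    then show "fB b \<in> carrier ?W"
      using \<beta>_closed by (auto simp: fB_def wreath_def)
  next
    fix b c assume "b \<in> carrier B" "c \<in> carrier B"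
    then show "fB (b \<otimes> c) = fB b \<otimes>\<^bsub>?W\<^esub> fB c"
      by (auto simp: fB_def W_mult \<beta>_mult restrict_def)
  qed
  have s: "s \<in> carrier ?W"
    using \<tau>_closed by (auto simp: s_def wreath_def)
  have rel: "fB h \<otimes>\<^bsub>?W\<^esub> s = s \<otimes>\<^bsub>?W\<^esub> fB (\<phi> h)" if "h \<in> H" for h
    using that \<tau>_relation[OF that] t_relation[OF that] by (auto simp: fB_def s_def W_mult restrict_def)
  obtain F where F: "F \<in> hom E ?W" "\<And>b. b \<in> carrier B \<Longrightarrow> F (\<iota> b) = fB b" "F t = s"
    using hnn_lift[OF B.is_group W.is_group fB s _ _ rel] \<phi>_image subgroup.subset[OF H_subgroup] subgroup.subset[OF K_subgroup] by metis
  interpret F: group_hom E ?W F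
    using F(1) by unfold_locales
  have F_mult: "fst (F (x \<cdot> y)) = fst (F x) \<cdot> fst (F y)"
      "z \<in> carrier E \<Longrightarrow> snd (F (x \<cdot> y)) z = snd (F x) (fst (F y) \<cdot> z) \<otimes>\<^bsub>\<Gamma>\<^esub> snd (F y) z"
    if "x \<in> carrier E" "y \<in> carrier E" for x y z
    using F.hom_mult[OF that] W_mult[of "fst (F x)" "snd (F x)" "fst (F y)" "snd (F y)"] by simp_all
  have F_one: "F \<one>\<^bsub>E\<^esub> = (\<one>\<^bsub>E\<^esub>, \<lambda>x\<in>carrier E. \<one>\<^bsub>\<Gamma>\<^esub>)"
    by (simp add: wreath_def)
  note F.hom_mult [simp del] F.hom_one [simp del] F.hom_inv [simp del]
  have F_closed: "fst (F x) \<in> carrier E" "z \<in> carrier E \<Longrightarrow> snd (F x) z \<in> carrier \<Gamma>" if "x \<in> carrier E" for x z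
    using F.hom_closed[OF that] by (auto simp: wreath_def)
  have fst_F: "fst (F x) = x" if "x \<in> carrier E" for x
    using that
  proof (induction rule: E_induct)
    case (stable_inv x)
    define y where "y = fst (F (inv\<^bsub>E\<^esub> t \<cdot> x))"
    have "y \<in> carrier E"
      unfolding y_def by (intro F_closed(1)) (use stable_inv in simp)
    moreover have "fst (F (t \<cdot> (inv\<^bsub>E\<^esub> t \<cdot> x))) = t \<cdot> y"
      unfolding y_def using stable_inv F_mult(1)[of t "inv\<^bsub>E\<^esub> t \<cdot> x"] F(3)
      by (simp add: s_def del: F.hom_mult F.hom_inv)
    then have "x = t \<cdot> y"
      using stable_inv by (simp add: E.m_assoc[symmetric])
    ultimately show ?case
      unfolding y_def[symmetric] by (simp add: E.m_assoc[symmetric])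
  qed (simp_all add: F_one F_mult F fB_def s_def)
  have snd_F_t: "snd (F (t \<cdot> x)) z = \<tau> (x \<cdot> z) \<otimes>\<^bsub>\<Gamma>\<^esub> snd (F x) z"
    if "x \<in> carrier E" "z \<in> carrier E" for x z
    using that by (simp add: F_mult fst_F F s_def)
  have snd_F_\<iota>: "snd (F (\<iota> b \<cdot> x)) z = \<beta> b (x \<cdot> z) \<otimes>\<^bsub>\<Gamma>\<^esub> snd (F x) z"
    if "b \<in> carrier B" "x \<in> carrier E" "z \<in> carrier E" for b x z
    using that by (simp add: F_mult fst_F F fB_def)
  have invariant: "\<forall>z\<in>carrier E. \<forall>y\<in>T0. snd (F x) (z \<cdot> y) = snd (F x) z" if "x \<in> carrier E" for x
    using that
  proof (induction rule: E_induct)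
    case one
    then show ?case by (simp add: F_one T0E)
  next
    case (base b x)
    then show ?case
      by (simp add: snd_F_\<iota> T0E E.m_assoc[symmetric] \<beta>_invariant)
  next
    case (stable x)
    then show ?case
      by (simp add: snd_F_t T0E E.m_assoc[symmetric] \<tau>_invariant)
  next
    case (stable_inv x)
    have *: "snd (F x) z = \<tau> (inv\<^bsub>E\<^esub> t \<cdot> x \<cdot> z) \<otimes>\<^bsub>\<Gamma>\<^esub> snd (F (inv\<^bsub>E\<^esub> t \<cdot> x)) z" if "z \<in> carrier E" for z
      using snd_F_t[of "inv\<^bsub>E\<^esub> t \<cdot> x" z] stable_inv(1) that by (simp add: E.m_assoc[symmetric])
    show ?case
    proof (intro ballI)
      fix z y assume zy: "z \<in> carrier E" "y \<in> T0"
      let ?x = "inv\<^bsub>E\<^esub> t \<cdot> x"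
      have x: "?x \<in> carrier E" using stable_inv by simp
      have "\<tau> (?x \<cdot> z) \<otimes>\<^bsub>\<Gamma>\<^esub> snd (F ?x) (z \<cdot> y) = \<tau> (?x \<cdot> z) \<otimes>\<^bsub>\<Gamma>\<^esub> snd (F ?x) z"
        using *[of z] *[of "z \<cdot> y"] stable_inv zy x T0E[OF zy(2)] \<tau>_invariant[of "?x \<cdot> z" y]
        by (simp add: E.m_assoc)
      then show "snd (F ?x) (z \<cdot> y) = snd (F ?x) z"
        using x zy T0E[OF zy(2)] F_closed \<tau>_closed by simp
    qed
  qed
  define \<Phi> where "\<Phi> x = snd (F x) \<one>\<^bsub>E\<^esub>" for x
  have \<Phi>_mult: "\<Phi> (x \<cdot> y) = \<Phi> x \<otimes>\<^bsub>\<Gamma>\<^esub> \<Phi> y" if "x \<in> carrier E" "y \<in> T0" for x y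
  proof -
    have y: "y \<in> carrier E" using that T0E by blast
    have "snd (F x) (\<one>\<^bsub>E\<^esub> \<cdot> y) = snd (F x) \<one>\<^bsub>E\<^esub>"
      using invariant[OF that(1)] that(2) E.one_closed by blast
    then show ?thesis
      using that(1) y by (simp add: \<Phi>_def F_mult fst_F)
  qed
  have \<Phi>_closed: "\<Phi> x \<in> carrier \<Gamma>" if "x \<in> carrier E" for x
    using that F_closed by (simp add: \<Phi>_def)
  have "\<Phi> \<in> hom (E\<lparr>carrier := T0\<rparr>) \<Gamma>"
    using \<Phi>_mult \<Phi>_closed T0E by (auto simp: hom_def)
  then obtain T where T: "T \<in> class_normals \<C> E" "T \<subseteq> T0" "\<And>x. x \<in> T \<Longrightarrow> \<Phi> x = \<one>\<^bsub>\<Gamma>\<^esub>"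
    using Gruenberg[OF E.is_group E_small T0 \<Gamma>] by blast
  have \<Phi>_T: "\<Phi> (x \<cdot> y) = \<Phi> x" if "x \<in> carrier E" "y \<in> T" for x y
    using that T \<Phi>_mult \<Phi>_closed by auto
  show ?thesis
    by (rule exI[of _ T], rule exI[of _ \<Phi>]) (use T(1,2) \<Phi>_closed \<Phi>_T in \<open>auto simp: \<Phi>_def snd_F_\<iota> snd_F_t F_one\<close>)
qed

end

context normal_hnn
begin

lemma t_\<iota>_\<phi>: "h \<in> H \<Longrightarrow> x \<in> carrier E \<Longrightarrow> t \<cdot> (\<iota> (\<phi> h) \<cdot> x) = \<iota> h \<cdot> (t \<cdot> x)"
  using t_relation[of h] by (simp add: E.m_assoc[symmetric])

text \<open>
  The element \<open>\<rho> x\<close> represents the double coset of \<open>x\<close> with respect to \<open>\<iota> S\<close> and \<open>T\<close>, and \<open>\<sigma> x\<close>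
  moves it into the coset \<open>x T\<close>. Both are chosen as functions of \<open>x T\<close>.
\<close>

lemma double_coset_transversal:
  assumes T: "T \<lhd> E" and S: "subgroup S B"
  shows "\<exists>\<rho> \<sigma>. \<forall>x\<in>carrier E. \<rho> x \<in> carrier E \<and> \<sigma> x \<in> S \<and> (\<exists>y\<in>T. x \<cdot> y = \<iota> (\<sigma> x) \<cdot> \<rho> x) \<and>
    (\<forall>y\<in>T. \<rho> (x \<cdot> y) = \<rho> x \<and> \<sigma> (x \<cdot> y) = \<sigma> x) \<and> (\<forall>c\<in>S. \<rho> (\<iota> c \<cdot> x) = \<rho> x)"
proof -
  interpret T: normal T E by (rule T)
  interpret S: subgroup S B by (rule S)
  have TE [simp]: "y \<in> carrier E" if "y \<in> T" for y using that T.mem_carrier by blast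
  have SB [simp]: "b \<in> carrier B" if "b \<in> S" for b using that S.mem_carrier by blast
  define D where "D x = {\<iota> b \<cdot> x \<cdot> y | b y. b \<in> S \<and> y \<in> T}" for x
  define \<rho> where "\<rho> x = (SOME r. r \<in> D x)" for x
  define \<sigma> where "\<sigma> x = (SOME b. b \<in> S \<and> (\<exists>y\<in>T. x \<cdot> y = \<iota> b \<cdot> \<rho> x))" for x
  have D_E: "r \<in> carrier E" if "r \<in> D x" "x \<in> carrier E" for r x
    using that by (auto simp: D_def)
  have D_sub: "D (\<iota> c \<cdot> x \<cdot> z) \<subseteq> D x" if "c \<in> S" "x \<in> carrier E" "z \<in> T" for c x z
  proof
    fix r assume "r \<in> D (\<iota> c \<cdot> x \<cdot> z)"
    then obtain b y where b: "b \<in> S" "y \<in> T" "r = \<iota> b \<cdot> (\<iota> c \<cdot> x \<cdot> z) \<cdot> y"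
      by (auto simp: D_def)
    have eq: "r = \<iota> (b \<otimes> c) \<cdot> x \<cdot> (z \<cdot> y)"
      using b that by (simp add: E.m_assoc)
    show "r \<in> D x"
      unfolding D_def eq using b that by blast
  qed
  have D_eq: "D (\<iota> c \<cdot> x \<cdot> z) = D x" if c: "c \<in> S" "x \<in> carrier E" "z \<in> T" for c x z
  proof
    have "x = \<iota> (inv c) \<cdot> (\<iota> c \<cdot> x \<cdot> z) \<cdot> inv\<^bsub>E\<^esub> z"
      using that by (simp add: E.word_simps)
    then show "D x \<subseteq> D (\<iota> c \<cdot> x \<cdot> z)"
      using D_sub[of "inv c" "\<iota> c \<cdot> x \<cdot> z" "inv\<^bsub>E\<^esub> z"] that by simp
  qed (rule D_sub[OF that])
  have D_T: "D (x \<cdot> z) = D x" if "x \<in> carrier E" "z \<in> T" for x z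
    using D_eq[of \<one> x z] that S.one_closed by simp
  have D_S: "D (\<iota> c \<cdot> x) = D x" if "c \<in> S" "x \<in> carrier E" for c x
    using D_eq[of c x "\<one>\<^bsub>E\<^esub>"] that T.one_closed by simp
  have self: "x \<in> D x" if "x \<in> carrier E" for x
    using that S.one_closed T.one_closed unfolding D_def
    by (intro CollectI exI[of _ \<one>] exI[of _ "\<one>\<^bsub>E\<^esub>"]) simp
  have \<rho>: "\<rho> x \<in> D x" if "x \<in> carrier E" for x
    unfolding \<rho>_def using self[OF that] by (rule someI)
  have \<rho>_T: "\<rho> (x \<cdot> y) = \<rho> x" if "x \<in> carrier E" "y \<in> T" for x y
    using that by (simp add: \<rho>_def D_T)
  have ex: "\<exists>b. b \<in> S \<and> (\<exists>y\<in>T. x \<cdot> y = \<iota> b \<cdot> \<rho> x)" if x: "x \<in> carrier E" for x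
  proof -
    obtain b y where b: "b \<in> S" "y \<in> T" "\<rho> x = \<iota> b \<cdot> x \<cdot> y"
      using \<rho>[OF x] by (auto simp: D_def)
    then show ?thesis
      using x by (intro exI[of _ "inv b"]) (auto simp: E.word_simps intro!: bexI[of _ y])
  qed
  have \<sigma>: "\<sigma> x \<in> S \<and> (\<exists>y\<in>T. x \<cdot> y = \<iota> (\<sigma> x) \<cdot> \<rho> x)" if "x \<in> carrier E" for x
    unfolding \<sigma>_def using ex[OF that] by (rule someI_ex)
  have \<sigma>_T: "\<sigma> (x \<cdot> z) = \<sigma> x" if x: "x \<in> carrier E" and z: "z \<in> T" for x z
  proof -
    have "(\<exists>y\<in>T. x \<cdot> z \<cdot> y = e) \<longleftrightarrow> (\<exists>y\<in>T. x \<cdot> y = e)" for e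
    proof
      assume "\<exists>y\<in>T. x \<cdot> z \<cdot> y = e"
      then show "\<exists>y\<in>T. x \<cdot> y = e"
        using x z by (auto simp: E.m_assoc intro!: bexI[of _ "z \<cdot> _"])
    next
      assume "\<exists>y\<in>T. x \<cdot> y = e"
      then obtain y where "y \<in> T" "x \<cdot> y = e" by blast
      then show "\<exists>y\<in>T. x \<cdot> z \<cdot> y = e"
        using x z by (intro bexI[of _ "inv\<^bsub>E\<^esub> z \<cdot> y"]) (simp_all add: E.word_simps)
    qed
    then show ?thesis
      using \<rho>_T[OF x z] by (simp add: \<sigma>_def)
  qed
  have \<rho>_S: "\<rho> (\<iota> c \<cdot> x) = \<rho> x" if "c \<in> S" "x \<in> carrier E" for c x
    using D_S[OF that] by (simp add: \<rho>_def)
  show ?thesis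
    by (rule exI[of _ \<rho>], rule exI[of _ \<sigma>]) (simp add: \<sigma> \<rho>_T \<sigma>_T \<rho>_S D_E[OF \<rho>])
qed

end

context class_hnn
begin

text \<open>
  This is Shapiro's lemma made explicit. On the elements of \<open>B\<close> that \<open>\<iota>\<close> sends into \<open>T0\<close> the family
  \<open>\<theta>\<close> is given. It is induced to all of \<open>B\<close>: the element \<open>m b x = \<sigma>(b x)\<^sup>-\<^sup>1 b \<sigma>(x)\<close> is sent into
  \<open>T0\<close>, and \<open>\<beta> b x\<close> is the value of \<open>\<theta>\<close> at \<open>\<rho> x\<close> on it. By \<open>base\<close> this extends \<open>\<theta>\<close>. It remains
  to find \<open>\<tau>\<close> with \<open>\<tau>(\<phi>(h) x) = \<beta>(h, t x) \<tau>(x) \<beta>(\<phi>(h), x)\<^sup>-\<^sup>1\<close>. On each double coset of \<open>\<iota> K\<close> and \<open>T0\<close> one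
  value of \<open>\<tau>\<close> can be taken to be \<open>1\<close>; this determines the others, consistently because
  \<open>\<beta>\<close> satisfies \<open>stable\<close> on the part of \<open>K\<close> that lies in \<open>T0\<close>.
\<close>

lemma induced_function:
  fixes \<Gamma> :: "('g, 'n) monoid_scheme"
  assumes T0: "T0 \<in> class_normals \<C> E" and \<Gamma>: "group \<Gamma>" "in_class \<C> \<Gamma>"
    and closed: "\<And>x b. x \<in> carrier E \<Longrightarrow> b \<in> carrier B \<Longrightarrow> \<iota> b \<in> T0 \<Longrightarrow> \<theta> x b \<in> carrier \<Gamma>"
    and mult: "\<And>x b c. x \<in> carrier E \<Longrightarrow> b \<in> carrier B \<Longrightarrow> c \<in> carrier B \<Longrightarrow> \<iota> b \<in> T0 \<Longrightarrow> \<iota> c \<in> T0 \<Longrightarrow>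
      \<theta> x (b \<otimes> c) = \<theta> x b \<otimes>\<^bsub>\<Gamma>\<^esub> \<theta> x c"
    and invariant: "\<And>x y b. x \<in> carrier E \<Longrightarrow> y \<in> T0 \<Longrightarrow> b \<in> carrier B \<Longrightarrow> \<iota> b \<in> T0 \<Longrightarrow>
      \<theta> (x \<cdot> y) b = \<theta> x b"
    and base: "\<And>x b c. x \<in> carrier E \<Longrightarrow> b \<in> carrier B \<Longrightarrow> c \<in> carrier B \<Longrightarrow> \<iota> c \<in> T0 \<Longrightarrow>
      \<theta> (\<iota> b \<cdot> x) (b \<otimes> c \<otimes> inv b) = \<theta> x c"
    and stable: "\<And>x h. x \<in> carrier E \<Longrightarrow> h \<in> H \<Longrightarrow> \<iota> h \<in> T0 \<Longrightarrow> \<theta> (t \<cdot> x) h = \<theta> x (\<phi> h)"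
  obtains T where "T \<in> class_normals \<C> E" "T \<subseteq> T0"
    "\<And>x b. x \<in> carrier E \<Longrightarrow> b \<in> carrier B \<Longrightarrow> \<iota> b \<in> T \<Longrightarrow> \<theta> x b = \<one>\<^bsub>\<Gamma>\<^esub>"
proof -
  interpret \<Gamma>: group \<Gamma> by fact
  have T0n: "T0 \<lhd> E" using T0 by (simp add: class_normals_def)
  interpret T0: normal T0 E by (rule T0n)
  have T0E [simp]: "y \<in> carrier E" if "y \<in> T0" for y using that T0.mem_carrier by blast
  obtain \<rho> \<sigma> where transversal: "\<forall>x\<in>carrier E. \<rho> x \<in> carrier E \<and> \<sigma> x \<in> carrier B \<and>
      (\<exists>y\<in>T0. x \<cdot> y = \<iota> (\<sigma> x) \<cdot> \<rho> x) \<and>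
      (\<forall>y\<in>T0. \<rho> (x \<cdot> y) = \<rho> x \<and> \<sigma> (x \<cdot> y) = \<sigma> x) \<and> (\<forall>c\<in>carrier B. \<rho> (\<iota> c \<cdot> x) = \<rho> x)"
    using double_coset_transversal[OF T0n B.subgroup_self] by (elim exE)
  have \<rho> [simp]: "\<rho> x \<in> carrier E" and \<sigma> [simp]: "\<sigma> x \<in> carrier B"
    and \<sigma>\<rho>: "\<exists>y\<in>T0. x \<cdot> y = \<iota> (\<sigma> x) \<cdot> \<rho> x"
    and \<rho>_T0: "y \<in> T0 \<Longrightarrow> \<rho> (x \<cdot> y) = \<rho> x"
    and \<sigma>_T0: "y \<in> T0 \<Longrightarrow> \<sigma> (x \<cdot> y) = \<sigma> x"
    and \<rho>_B: "c \<in> carrier B \<Longrightarrow> \<rho> (\<iota> c \<cdot> x) = \<rho> x" if "x \<in> carrier E" for x y c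
    using transversal that by blast+
  have conj_T0: "x \<cdot> y \<cdot> inv\<^bsub>E\<^esub> x \<in> T0" "inv\<^bsub>E\<^esub> x \<cdot> y \<cdot> x \<in> T0" if "x \<in> carrier E" "y \<in> T0" for x y
    using that T0.inv_op_closed1 T0.inv_op_closed2 by blast+
  have move: "y \<cdot> x = x \<cdot> (inv\<^bsub>E\<^esub> x \<cdot> y \<cdot> x)" if "x \<in> carrier E" "y \<in> T0" for x y
    using that by (simp add: E.word_simps)
  define m where "m b x = inv \<sigma> (\<iota> b \<cdot> x) \<otimes> (b \<otimes> \<sigma> x)" for b x
  have m_B [simp]: "m b x \<in> carrier B" if "b \<in> carrier B" "x \<in> carrier E" for b x
    using that by (simp add: m_def)
  have m_T0: "\<iota> (m b x) \<in> T0" if bx: "b \<in> carrier B" "x \<in> carrier E" for b x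
  proof -
    obtain y where y: "y \<in> T0" "x \<cdot> y = \<iota> (\<sigma> x) \<cdot> \<rho> x"
      using \<sigma>\<rho> bx by blast
    obtain z where z: "z \<in> T0" "\<iota> b \<cdot> x \<cdot> z = \<iota> (\<sigma> (\<iota> b \<cdot> x)) \<cdot> \<rho> x"
      using \<sigma>\<rho>[of "\<iota> b \<cdot> x"] \<rho>_B[of x b] bx by auto
    have \<sigma>x: "\<iota> (\<sigma> x) = x \<cdot> y \<cdot> inv\<^bsub>E\<^esub> \<rho> x" and \<sigma>bx: "\<iota> (\<sigma> (\<iota> b \<cdot> x)) = \<iota> b \<cdot> x \<cdot> z \<cdot> inv\<^bsub>E\<^esub> \<rho> x"
      using y z bx by (simp_all add: E.word_simps)
    have "\<iota> (m b x) = inv\<^bsub>E\<^esub> \<iota> (\<sigma> (\<iota> b \<cdot> x)) \<cdot> (\<iota> b \<cdot> \<iota> (\<sigma> x))"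
      using bx by (simp add: m_def)
    also have "\<dots> = \<rho> x \<cdot> (inv\<^bsub>E\<^esub> z \<cdot> y) \<cdot> inv\<^bsub>E\<^esub> \<rho> x"
      unfolding \<sigma>x \<sigma>bx using bx y(1) z(1) by (simp add: E.word_simps)
    finally show ?thesis
      using conj_T0(1)[of "\<rho> x" "inv\<^bsub>E\<^esub> z \<cdot> y"] bx y z by simp
  qed
  define \<beta> where "\<beta> b x = \<theta> (\<rho> x) (m b x)" for b x
  have \<beta>_closed [simp]: "\<beta> b x \<in> carrier \<Gamma>" if "b \<in> carrier B" "x \<in> carrier E" for b x
    using that by (simp add: \<beta>_def closed m_T0)
  have \<beta>_T0: "\<beta> b (x \<cdot> y) = \<beta> b x" if "b \<in> carrier B" "x \<in> carrier E" "y \<in> T0" for b x y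
    using that by (simp add: \<beta>_def m_def \<rho>_T0 \<sigma>_T0 E.m_assoc[symmetric])
  have \<beta>_mult: "\<beta> (b \<otimes> c) x = \<beta> b (\<iota> c \<cdot> x) \<otimes>\<^bsub>\<Gamma>\<^esub> \<beta> c x"
    if "b \<in> carrier B" "c \<in> carrier B" "x \<in> carrier E" for b c x
  proof -
    have "m (b \<otimes> c) x = m b (\<iota> c \<cdot> x) \<otimes> m c x"
      using that by (simp add: m_def B.word_simps E.m_assoc)
    then show ?thesis
      using that by (simp add: \<beta>_def mult m_T0 \<rho>_B)
  qed
  \<comment> \<open>Left multiplication by an element of \<open>T0\<close> fixes the coset \<open>x T0\<close>, hence \<open>\<sigma>\<close>.\<close>
  have \<beta>_\<theta>: "\<beta> b x = \<theta> x b" if b: "b \<in> carrier B" "\<iota> b \<in> T0" and x: "x \<in> carrier E" for b x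
  proof -
    have "\<sigma> (\<iota> b \<cdot> x) = \<sigma> x"
      using \<sigma>_T0[OF x, of "inv\<^bsub>E\<^esub> x \<cdot> \<iota> b \<cdot> x"] conj_T0(2)[OF x b(2)] move[OF x b(2)] by simp
    then have m: "m b x = inv \<sigma> x \<otimes> (b \<otimes> \<sigma> x)"
      by (simp add: m_def)
    obtain y where y: "y \<in> T0" "x \<cdot> y = \<iota> (\<sigma> x) \<cdot> \<rho> x"
      using \<sigma>\<rho> x by blast
    have "\<beta> b x = \<theta> (\<iota> (\<sigma> x) \<cdot> \<rho> x) (\<sigma> x \<otimes> m b x \<otimes> inv \<sigma> x)"
      using base[of "\<rho> x" "\<sigma> x" "m b x"] b x m_T0 by (simp add: \<beta>_def)
    also have "\<sigma> x \<otimes> m b x \<otimes> inv \<sigma> x = b"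
      unfolding m using b x by (simp add: B.word_simps)
    finally show ?thesis
      using invariant[OF x y(1) b] y(2) by simp
  qed
  obtain \<rho>' \<kappa> where transversal': "\<forall>x\<in>carrier E. \<rho>' x \<in> carrier E \<and> \<kappa> x \<in> K \<and>
      (\<exists>y\<in>T0. x \<cdot> y = \<iota> (\<kappa> x) \<cdot> \<rho>' x) \<and>
      (\<forall>y\<in>T0. \<rho>' (x \<cdot> y) = \<rho>' x \<and> \<kappa> (x \<cdot> y) = \<kappa> x) \<and> (\<forall>c\<in>K. \<rho>' (\<iota> c \<cdot> x) = \<rho>' x)"
    using double_coset_transversal[OF T0n K_subgroup] by (elim exE)
  have \<rho>' [simp]: "\<rho>' x \<in> carrier E" and \<kappa> [simp]: "\<kappa> x \<in> K"
    and \<kappa>\<rho>': "\<exists>y\<in>T0. x \<cdot> y = \<iota> (\<kappa> x) \<cdot> \<rho>' x"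
    and \<rho>'_T0: "y \<in> T0 \<Longrightarrow> \<rho>' (x \<cdot> y) = \<rho>' x"
    and \<kappa>_T0: "y \<in> T0 \<Longrightarrow> \<kappa> (x \<cdot> y) = \<kappa> x"
    and \<rho>'_K: "c \<in> K \<Longrightarrow> \<rho>' (\<iota> c \<cdot> x) = \<rho>' x" if "x \<in> carrier E" for x y c
    using transversal' that by blast+
  have \<psi>_mult [simp]: "\<psi> (k \<otimes> k') = \<psi> k \<otimes> \<psi> k'" if "k \<in> K" "k' \<in> K" for k k'
    using that \<psi>_\<phi>[of "\<psi> k \<otimes> \<psi> k'"] subgroup.m_closed[OF H_subgroup] by simp
  \<comment> \<open>The value that the relation forces on \<open>\<tau>\<close> at \<open>\<iota> k \<cdot> r\<close> if its value at \<open>r\<close> is \<open>1\<close>.\<close>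
  define g where "g k r = \<beta> (\<psi> k) (t \<cdot> r) \<otimes>\<^bsub>\<Gamma>\<^esub> inv\<^bsub>\<Gamma>\<^esub> (\<beta> k r)" for k r
  define \<tau> where "\<tau> x = g (\<kappa> x) (\<rho>' x)" for x
  have g_eq: "g k r = g k' r"
    if k: "k \<in> K" "k' \<in> K" and r: "r \<in> carrier E" and y: "y \<in> T0" "\<iota> k' \<cdot> r = \<iota> k \<cdot> r \<cdot> y" for k k' r y
  proof -
    define k0 where "k0 = inv k \<otimes> k'"
    have k0: "k0 \<in> K" "k' = k \<otimes> k0"
      using k K_closed
      by (simp_all add: k0_def B.word_simps)
    have "\<iota> k' = \<iota> k \<cdot> r \<cdot> y \<cdot> inv\<^bsub>E\<^esub> r"
      using y k r by (simp add: E.word_simps flip: y(2))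
    then have "\<iota> k0 = r \<cdot> y \<cdot> inv\<^bsub>E\<^esub> r"
      using k r y(1) by (simp add: k0_def E.word_simps)
    then have k0T: "\<iota> k0 \<in> T0"
      using conj_T0(1) r y(1) by simp
    have "\<iota> (\<psi> k0) = t \<cdot> \<iota> k0 \<cdot> inv\<^bsub>E\<^esub> t"
      using t_relation[of "\<psi> k0"] k0(1) by (intro E.inv_solve_right[THEN iffD2]) simp_all
    then have \<psi>k0T: "\<iota> (\<psi> k0) \<in> T0"
      using conj_T0(1) k0T by simp
    have 1: "\<beta> (\<psi> k) (\<iota> (\<psi> k0) \<cdot> (t \<cdot> r)) = \<beta> (\<psi> k) (t \<cdot> r)"
      using move[OF _ \<psi>k0T, of "t \<cdot> r"] \<beta>_T0[of "\<psi> k" "t \<cdot> r"] conj_T0(2)[OF _ \<psi>k0T, of "t \<cdot> r"] k r by simp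
    have 2: "\<beta> k (\<iota> k0 \<cdot> r) = \<beta> k r"
      using move[OF _ k0T, of r] \<beta>_T0[of k r] conj_T0(2)[OF _ k0T, of r] k r by simp
    have 3: "\<beta> (\<psi> k0) (t \<cdot> r) = \<beta> k0 r"
      using \<beta>_\<theta>[of "\<psi> k0" "t \<cdot> r"] \<beta>_\<theta>[of k0 r] stable[of r "\<psi> k0"] k0 k0T \<psi>k0T r by simp
    show ?thesis
      using k r k0(1) by (simp add: g_def k0(2) \<beta>_mult 1 2 3 \<Gamma>.word_simps)
  qed
  have g_closed [simp]: "g k r \<in> carrier \<Gamma>" if "k \<in> K" "r \<in> carrier E" for k r
    using that by (simp add: g_def)
  have \<tau>_relation: "\<beta> h (t \<cdot> x) \<otimes>\<^bsub>\<Gamma>\<^esub> \<tau> x = \<tau> (\<iota> (\<phi> h) \<cdot> x) \<otimes>\<^bsub>\<Gamma>\<^esub> \<beta> (\<phi> h) x"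
    if h: "h \<in> H" and x: "x \<in> carrier E" for h x
  proof -
    let ?r = "\<rho>' x" and ?k = "\<kappa> x"
    obtain y where y: "y \<in> T0" "x \<cdot> y = \<iota> ?k \<cdot> ?r"
      using \<kappa>\<rho>' x by blast
    obtain z where z: "z \<in> T0" "\<iota> (\<phi> h) \<cdot> x \<cdot> z = \<iota> (\<kappa> (\<iota> (\<phi> h) \<cdot> x)) \<cdot> ?r"
      using \<kappa>\<rho>'[of "\<iota> (\<phi> h) \<cdot> x"] \<rho>'_K[of x "\<phi> h"] h x by auto
    have "\<tau> (\<iota> (\<phi> h) \<cdot> x) = g (\<phi> h \<otimes> ?k) ?r"
      unfolding \<tau>_def using h x
    proof (subst \<rho>'_K, simp_all, intro g_eq)
      have "\<iota> (\<phi> h \<otimes> ?k) \<cdot> ?r = \<iota> (\<phi> h) \<cdot> (x \<cdot> y)"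
        using h x by (simp add: y(2) E.m_assoc)
      also have "\<dots> = \<iota> (\<phi> h) \<cdot> x \<cdot> z \<cdot> (inv\<^bsub>E\<^esub> z \<cdot> y)"
        using h x y(1) z(1) by (simp add: E.word_simps)
      finally show "\<iota> (\<phi> h \<otimes> ?k) \<cdot> ?r = \<iota> (\<kappa> (\<iota> (\<phi> h) \<cdot> x)) \<cdot> ?r \<cdot> (inv\<^bsub>E\<^esub> z \<cdot> y)"
        unfolding z(2) .
    qed (use h x y z subgroup.m_closed[OF K_subgroup] in simp_all)
    also have "\<dots> = \<beta> h (\<iota> (\<psi> ?k) \<cdot> (t \<cdot> ?r)) \<otimes>\<^bsub>\<Gamma>\<^esub> \<beta> (\<psi> ?k) (t \<cdot> ?r) \<otimes>\<^bsub>\<Gamma>\<^esub>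
        inv\<^bsub>\<Gamma>\<^esub> (\<beta> (\<phi> h) (\<iota> ?k \<cdot> ?r) \<otimes>\<^bsub>\<Gamma>\<^esub> \<beta> ?k ?r)"
      using h x by (simp add: g_def \<beta>_mult)
    also have "\<iota> (\<psi> ?k) \<cdot> (t \<cdot> ?r) = t \<cdot> x \<cdot> y"
      using t_\<iota>_\<phi>[of "\<psi> ?k" ?r] x y by (simp add: E.m_assoc)
    also have "\<beta> h (t \<cdot> x \<cdot> y) = \<beta> h (t \<cdot> x)"
      using h x y by (simp add: \<beta>_T0)
    also have "\<beta> (\<phi> h) (\<iota> ?k \<cdot> ?r) = \<beta> (\<phi> h) x"
      using h x y \<beta>_T0[of "\<phi> h" x y] by simp
    finally show ?thesis
      using h x by (simp add: \<tau>_def g_def \<Gamma>.word_simps)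
  qed
  have \<tau>: "\<tau> x \<in> carrier \<Gamma>" "y \<in> T0 \<Longrightarrow> \<tau> (x \<cdot> y) = \<tau> x" if "x \<in> carrier E" for x y
    using that by (simp_all add: \<tau>_def \<rho>'_T0 \<kappa>_T0)
  have "\<exists>T \<Phi>. T \<in> class_normals \<C> E \<and> T \<subseteq> T0 \<and> \<Phi> \<one>\<^bsub>E\<^esub> = \<one>\<^bsub>\<Gamma>\<^esub> \<and> (\<forall>x\<in>carrier E. \<Phi> x \<in> carrier \<Gamma> \<and>
      (\<forall>b\<in>carrier B. \<Phi> (\<iota> b \<cdot> x) = \<beta> b x \<otimes>\<^bsub>\<Gamma>\<^esub> \<Phi> x) \<and> \<Phi> (t \<cdot> x) = \<tau> x \<otimes>\<^bsub>\<Gamma>\<^esub> \<Phi> x \<and>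
      (\<forall>y\<in>T. \<Phi> (x \<cdot> y) = \<Phi> x))"
    by (rule crossed_function[OF T0 \<Gamma>]) (simp_all add: \<tau> \<beta>_T0 \<beta>_mult \<tau>_relation)
  then obtain T \<Phi> where T: "T \<in> class_normals \<C> E" "T \<subseteq> T0"
    and \<Phi>: "\<forall>x\<in>carrier E. \<Phi> x \<in> carrier \<Gamma> \<and>
      (\<forall>b\<in>carrier B. \<Phi> (\<iota> b \<cdot> x) = \<beta> b x \<otimes>\<^bsub>\<Gamma>\<^esub> \<Phi> x) \<and> \<Phi> (t \<cdot> x) = \<tau> x \<otimes>\<^bsub>\<Gamma>\<^esub> \<Phi> x \<and>
      (\<forall>y\<in>T. \<Phi> (x \<cdot> y) = \<Phi> x)"
    by blast
  have Tn: "T \<lhd> E" using T(1) by (simp add: class_normals_def)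
  show thesis
  proof (rule that[OF T(1,2)])
    fix x b assume x: "x \<in> carrier E" and b: "b \<in> carrier B" "\<iota> b \<in> T"
    have "inv\<^bsub>E\<^esub> x \<cdot> \<iota> b \<cdot> x \<in> T"
      using normal.inv_op_closed1[OF Tn x b(2)] .
    then have "\<Phi> (x \<cdot> (inv\<^bsub>E\<^esub> x \<cdot> \<iota> b \<cdot> x)) = \<Phi> x"
      using \<Phi> x by blast
    then have "\<Phi> (\<iota> b \<cdot> x) = \<Phi> x"
      using move[OF x, of "\<iota> b"] b(2) T(2) by auto
    then have "\<beta> b x \<otimes>\<^bsub>\<Gamma>\<^esub> \<Phi> x = \<Phi> x"
      using \<Phi> x b(1) by auto
    then have "\<beta> b x = \<one>\<^bsub>\<Gamma>\<^esub>"
      using \<Gamma>.r_cancel_one[of "\<Phi> x" "\<beta> b x"] \<Phi> x b(1) \<beta>_closed by blast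
    then show "\<theta> x b = \<one>\<^bsub>\<Gamma>\<^esub>"
      using \<beta>_\<theta> b x T(2) by auto
  qed
qed

end


section \<open>Congruence modulo normal subgroups\<close>

lemma coset_mult_cong:
  assumes "group G" "N \<lhd> G" "x \<in> carrier G" "x' \<in> carrier G" "y \<in> carrier G" "y' \<in> carrier G"
    and "N #>\<^bsub>G\<^esub> x = N #>\<^bsub>G\<^esub> x'" "N #>\<^bsub>G\<^esub> y = N #>\<^bsub>G\<^esub> y'"
  shows "N #>\<^bsub>G\<^esub> (x \<otimes>\<^bsub>G\<^esub> y) = N #>\<^bsub>G\<^esub> (x' \<otimes>\<^bsub>G\<^esub> y')"
  using assms normal.rcos_sum[OF assms(2)] by metis

lemma coset_conj_cong:
  assumes "group G" "N \<lhd> G" "x \<in> carrier G" "y \<in> carrier G" "y' \<in> carrier G"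
    and "N #>\<^bsub>G\<^esub> y = N #>\<^bsub>G\<^esub> y'"
  shows "N #>\<^bsub>G\<^esub> (x \<otimes>\<^bsub>G\<^esub> y \<otimes>\<^bsub>G\<^esub> inv\<^bsub>G\<^esub> x) = N #>\<^bsub>G\<^esub> (x \<otimes>\<^bsub>G\<^esub> y' \<otimes>\<^bsub>G\<^esub> inv\<^bsub>G\<^esub> x)"
proof -
  interpret group G by fact
  show ?thesis
    using assms by (intro coset_mult_cong) simp_all
qed

lemma coset_cong_mono:
  assumes "group G" "N \<lhd> G" "N' \<lhd> G" "N \<subseteq> N'" "x \<in> carrier G" "y \<in> carrier G"
    and "N #>\<^bsub>G\<^esub> x = N #>\<^bsub>G\<^esub> y"
  shows "N' #>\<^bsub>G\<^esub> x = N' #>\<^bsub>G\<^esub> y"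
  using assms by (auto simp: coset_eq_iff)

lemma set_mult_iff: "x \<in> A <#>\<^bsub>G\<^esub> C \<longleftrightarrow> (\<exists>a\<in>A. \<exists>c\<in>C. x = a \<otimes>\<^bsub>G\<^esub> c)"
  by (auto simp: set_mult_def)

lemma normal_set_mult:
  assumes "group G" "A \<lhd> G" "C \<lhd> G"
  shows "A <#>\<^bsub>G\<^esub> C \<lhd> G" "A \<subseteq> A <#>\<^bsub>G\<^esub> C" "C \<subseteq> A <#>\<^bsub>G\<^esub> C"
proof -
  interpret group G by fact
  interpret A: normal A G by fact
  interpret C: normal C G by fact
  show "A <#>\<^bsub>G\<^esub> C \<lhd> G"
    using normal_subgroup_set_mult_closed assms by blast
  show "A \<subseteq> A <#>\<^bsub>G\<^esub> C"
  proof
    fix a assume "a \<in> A"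
    then have "a = a \<otimes>\<^bsub>G\<^esub> \<one>\<^bsub>G\<^esub>" by simp
    then show "a \<in> A <#>\<^bsub>G\<^esub> C"
      using \<open>a \<in> A\<close> C.one_closed unfolding set_mult_iff by blast
  qed
  show "C \<subseteq> A <#>\<^bsub>G\<^esub> C"
  proof
    fix c assume "c \<in> C"
    then have "c = \<one>\<^bsub>G\<^esub> \<otimes>\<^bsub>G\<^esub> c" by simp
    then show "c \<in> A <#>\<^bsub>G\<^esub> C"
      using \<open>c \<in> C\<close> A.one_closed unfolding set_mult_iff by blast
  qed
qed


section \<open>The action on the intersection of the associated subgroups\<close>

locale invariant_hnn = class_hnn \<C> B H K \<phi>
  for \<C> :: "'u monoid \<Rightarrow> bool" and B :: "('b, 'm) monoid_scheme" (structure) and H K \<phi> +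
  assumes \<phi>_L: "\<phi> ` (H \<inter> K) = H \<inter> K"
    and V_class: "in_class \<C> ((AutGrp B (H \<inter> K))\<lparr>carrier := frakV B (H \<inter> K) \<phi>\<rparr>)"
begin

abbreviation L where "L \<equiv> H \<inter> K"

lemma coset_eqI: "A \<lhd> B \<Longrightarrow> x \<in> carrier B \<Longrightarrow> y \<in> carrier B \<Longrightarrow> x \<otimes> inv y \<in> A \<Longrightarrow> A #> x = A #> y"
  and coset_eqD: "A \<lhd> B \<Longrightarrow> x \<in> carrier B \<Longrightarrow> y \<in> carrier B \<Longrightarrow> A #> x = A #> y \<Longrightarrow> x \<otimes> inv y \<in> A"
  using coset_eq_iff[OF B.is_group] by blast+

lemma coset_self_iff: "A \<lhd> B \<Longrightarrow> x \<in> carrier B \<Longrightarrow> A #> x = A \<longleftrightarrow> x \<in> A"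
  by (rule coset_eq_self_iff[OF B.is_group])

lemma right_factor_coset: "g \<in> carrier B \<Longrightarrow> a \<in> A \<Longrightarrow> A \<lhd> B \<Longrightarrow> A #> (g \<otimes> a) = A #> g"
  using normal.inv_op_closed2[of A B g a] subgroup.mem_carrier[OF normal_imp_subgroup, of A B a]
  by (intro coset_eqI) simp_all

lemma coset_sum: "A \<lhd> B \<Longrightarrow> x \<in> carrier B \<Longrightarrow> y \<in> carrier B \<Longrightarrow> (A #> x) <#> (A #> y) = A #> (x \<otimes> y)"
  by (rule normal.rcos_sum)

lemma L_normal: "L \<lhd> B"
  using B.normal_subgroup_intersect[OF H_normal K_normal] .

lemma L_subgroup: "subgroup L B"
  using L_normal normal_imp_subgroup by blast

lemma \<phi>_L_mem [simp]: "l \<in> H \<Longrightarrow> l \<in> K \<Longrightarrow> \<phi> l \<in> H"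
  using \<phi>_L by blast

lemma H_conj: "b \<in> carrier B \<Longrightarrow> h \<in> H \<Longrightarrow> b \<otimes> h \<otimes> inv b \<in> H"
  and K_conj: "b \<in> carrier B \<Longrightarrow> h \<in> K \<Longrightarrow> b \<otimes> h \<otimes> inv b \<in> K"
  using normal.inv_op_closed2[OF H_normal] normal.inv_op_closed2[OF K_normal] by blast+

lemma AutGrp_L:
  shows "group (AutGrp B L)"
    and "f \<in> carrier (AutGrp B L) \<Longrightarrow> l \<in> L \<Longrightarrow> f l \<in> L"
    and "f \<in> carrier (AutGrp B L) \<Longrightarrow> g \<in> carrier (AutGrp B L) \<Longrightarrow> l \<in> L \<Longrightarrow>
      (f \<otimes>\<^bsub>AutGrp B L\<^esub> g) l = f (g l)"
    and "f \<in> carrier (AutGrp B L) \<Longrightarrow> l \<in> L \<Longrightarrow> l' \<in> L \<Longrightarrow> f (l \<otimes> l') = f l \<otimes> f l'"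
proof -
  interpret L: group "B\<lparr>carrier := L\<rparr>"
    using subgroup.subgroup_is_group[OF L_subgroup B.is_group] .
  show "group (AutGrp B L)"
    by (rule L.AutoGroup)
qed (auto simp: AutoGroup_def BijGroup_def auto_def compose_def hom_def Pi_def)

lemma AutGrp_LI:
  assumes "bij_betw f L L" "\<And>l l'. l \<in> L \<Longrightarrow> l' \<in> L \<Longrightarrow> f (l \<otimes> l') = f l \<otimes> f l'"
  shows "restrict f L \<in> carrier (AutGrp B L)"
proof -
  have "l \<otimes> l' \<in> L" if "l \<in> L" "l' \<in> L" for l l'
    using that subgroup.m_closed[OF L_subgroup] by blast
  moreover have "f l \<in> L" if "l \<in> L" for l
    using assms(1) that by (auto simp: bij_betw_def)
  ultimately show ?thesis
    using assms by (auto simp: AutoGroup_def auto_def Bij_def hom_def)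
qed

lemma conj_bij_L:
  assumes "b \<in> carrier B"
  shows "bij_betw (\<lambda>l. b \<otimes> l \<otimes> inv b) L L"
proof (rule bij_betwI[where g = "\<lambda>l. inv b \<otimes> l \<otimes> b"])
  show "(\<lambda>l. b \<otimes> l \<otimes> inv b) \<in> L \<rightarrow> L"
    using assms normal.inv_op_closed2[OF L_normal] by auto
  show "(\<lambda>l. inv b \<otimes> l \<otimes> b) \<in> L \<rightarrow> L"
    using assms normal.inv_op_closed1[OF L_normal] by auto
qed (use assms in \<open>simp_all add: B.word_simps\<close>)

lemma frakV_subgroup: "subgroup (frakV B L \<phi>) (AutGrp B L)"
  and conj_in_frakV: "b \<in> carrier B \<Longrightarrow> (\<lambda>l\<in>L. b \<otimes> l \<otimes> inv b) \<in> frakV B L \<phi>"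
  and \<phi>_in_frakV: "restrict \<phi> L \<in> frakV B L \<phi>"
proof -
  interpret A: group "AutGrp B L" by (rule AutGrp_L(1))
  have conj: "(\<lambda>l\<in>L. b \<otimes> l \<otimes> inv b) \<in> carrier (AutGrp B L)" if "b \<in> carrier B" for b
    using that by (intro AutGrp_LI conj_bij_L) (auto simp: B.word_simps)
  have L: "Aut_restr B L \<subseteq> carrier (AutGrp B L)"
    unfolding Aut_restr_def
  proof (rule image_subsetI)
    show "(\<lambda>y\<in>L. inv b \<otimes> y \<otimes> b) \<in> carrier (AutGrp B L)" if "b \<in> carrier B" for b
      using conj[of "inv b"] that by simp
  qed
  have "bij_betw \<phi> L L"
    using \<phi>_inj \<phi>_L by (auto simp: bij_betw_def intro: inj_on_subset)
  then have \<phi>: "restrict \<phi> L \<in> carrier (AutGrp B L)"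
    by (rule AutGrp_LI) simp
  then have F: "frakF B L \<phi> \<subseteq> carrier (AutGrp B L)"
    unfolding frakF_def by (intro A.generate_incl) simp
  show "subgroup (frakV B L \<phi>) (AutGrp B L)"
    unfolding frakV_def frakL_def using L F by (intro A.generate_is_subgroup) blast
  show "restrict \<phi> L \<in> frakV B L \<phi>"
    unfolding frakV_def frakF_def by (intro generate.incl) (auto intro: generate.incl)
  show "(\<lambda>l\<in>L. b \<otimes> l \<otimes> inv b) \<in> frakV B L \<phi>" if "b \<in> carrier B"
  proof -
    have "(\<lambda>l\<in>L. b \<otimes> l \<otimes> inv b) \<in> Aut_restr B L"
      unfolding Aut_restr_def using that by (intro image_eqI[of _ _ "inv b"]) auto
    then show ?thesis
      unfolding frakV_def frakL_def by (intro generate.incl) blast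
  qed
qed

text \<open>
  The action is \<open>l \<mapsto> x l x\<^sup>-\<^sup>1\<close>, described without reference to the image of \<open>L\<close> in \<open>E\<close>: it is the homomorphism
  to \<open>\<VV>\<close> that sends \<open>b\<close> to conjugation by \<open>b\<close> and \<open>t\<close> to the inverse of \<open>\<phi>\<close>. Its kernel \<open>T\<close> has a
  quotient in the class because \<open>\<VV>\<close> is in the class.
\<close>

lemma action_on_L:
  "\<exists>T \<alpha>. T \<in> class_normals \<C> E \<and> (\<forall>l\<in>L.
    (\<forall>x\<in>carrier E. \<alpha> x l \<in> L \<and> (\<forall>y\<in>carrier E. \<alpha> (x \<cdot> y) l = \<alpha> x (\<alpha> y l)) \<and>
      (\<forall>l'\<in>L. \<alpha> x (l \<otimes> l') = \<alpha> x l \<otimes> \<alpha> x l')) \<and>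
    (\<forall>b\<in>carrier B. \<alpha> (\<iota> b) l = b \<otimes> l \<otimes> inv b) \<and> \<alpha> t (\<phi> l) = l \<and> (\<forall>y\<in>T. \<alpha> y l = l))"
proof -
  interpret A: group "AutGrp B L" by (rule AutGrp_L(1))
  let ?V = "(AutGrp B L)\<lparr>carrier := frakV B L \<phi>\<rparr>"
  interpret V: subgroup "frakV B L \<phi>" "AutGrp B L" by (rule frakV_subgroup)
  have V: "group ?V" by (rule V.subgroup_is_group[OF A.is_group])
  let ?c = "\<lambda>b. \<lambda>l\<in>L. b \<otimes> l \<otimes> inv b"
  let ?s = "inv\<^bsub>AutGrp B L\<^esub> restrict \<phi> L"
  have ext: "f = g" if "f \<in> carrier (AutGrp B L)" "g \<in> carrier (AutGrp B L)" "\<And>l. l \<in> L \<Longrightarrow> f l = g l" for f g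
    using that by (intro extensionalityI[of f L g]) (auto simp: AutoGroup_def auto_def Bij_def)
  have c_A: "?c b \<in> carrier (AutGrp B L)" if "b \<in> carrier B" for b
    using conj_in_frakV[OF that] V.subset by blast
  have \<phi>_A: "restrict \<phi> L \<in> carrier (AutGrp B L)"
    using \<phi>_in_frakV V.subset by blast
  have conj_L: "b \<otimes> l \<otimes> inv b \<in> L" if "b \<in> carrier B" "l \<in> L" for b l
    using that normal.inv_op_closed2[OF L_normal] by blast
  have c: "?c \<in> hom B ?V"
  proof (rule homI)
    fix b c assume bc: "b \<in> carrier B" "c \<in> carrier B"
    have "?c (b \<otimes> c) = ?c b \<otimes>\<^bsub>AutGrp B L\<^esub> ?c c"
    proof (rule ext)
      fix l assume l: "l \<in> L"
      then show "?c (b \<otimes> c) l = (?c b \<otimes>\<^bsub>AutGrp B L\<^esub> ?c c) l"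
        using bc conj_L[OF bc(2) l] AutGrp_L(3)[OF c_A[OF bc(1)] c_A[OF bc(2)] l]
        by (simp add: B.word_simps)
    qed (use bc c_A in simp_all)
    then show "?c (b \<otimes> c) = ?c b \<otimes>\<^bsub>?V\<^esub> ?c c" by simp
  qed (simp add: conj_in_frakV)
  have s: "?s \<in> carrier ?V"
    using V.m_inv_closed \<phi>_in_frakV by simp
  have rel: "?c h \<otimes>\<^bsub>?V\<^esub> ?s = ?s \<otimes>\<^bsub>?V\<^esub> ?c (\<phi> h)" if h: "h \<in> H" for h
  proof -
    have "restrict \<phi> L \<otimes>\<^bsub>AutGrp B L\<^esub> ?c h = ?c (\<phi> h) \<otimes>\<^bsub>AutGrp B L\<^esub> restrict \<phi> L"
    proof (rule ext)
      fix l assume l: "l \<in> L"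
      have hl: "h \<otimes> l \<otimes> inv h \<in> L" "\<phi> l \<in> L"
        using conj_L[of h l] h l \<phi>_L by auto
      have "\<phi> (h \<otimes> l \<otimes> inv h) = \<phi> h \<otimes> \<phi> l \<otimes> inv \<phi> h"
        using h l H_closed by simp
      then show "(restrict \<phi> L \<otimes>\<^bsub>AutGrp B L\<^esub> ?c h) l = (?c (\<phi> h) \<otimes>\<^bsub>AutGrp B L\<^esub> restrict \<phi> L) l"
        using h hl AutGrp_L(3)[OF \<phi>_A c_A l] AutGrp_L(3)[OF c_A \<phi>_A l] l by auto
    qed (use h \<phi>_A c_A in \<open>simp_all\<close>)
    then have "?s \<otimes>\<^bsub>AutGrp B L\<^esub> (restrict \<phi> L \<otimes>\<^bsub>AutGrp B L\<^esub> ?c h) \<otimes>\<^bsub>AutGrp B L\<^esub> ?s =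
        ?s \<otimes>\<^bsub>AutGrp B L\<^esub> (?c (\<phi> h) \<otimes>\<^bsub>AutGrp B L\<^esub> restrict \<phi> L) \<otimes>\<^bsub>AutGrp B L\<^esub> ?s"
      by simp
    then show ?thesis
      using h \<phi>_A c_A[of h] c_A[of "\<phi> h"] by (simp add: A.word_simps)
  qed
  obtain F where F: "F \<in> hom E ?V" "\<And>b. b \<in> carrier B \<Longrightarrow> F (\<iota> b) = ?c b" "F t = ?s"
    using hnn_lift[OF B.is_group V c s _ _ rel] \<phi>_image subgroup.subset[OF H_subgroup]
      subgroup.subset[OF K_subgroup] by metis
  have FA: "F x \<in> carrier (AutGrp B L)" if "x \<in> carrier E" for x
    using F(1) that V.subset by (auto simp: hom_def)
  have F_mult: "F (x \<cdot> y) = F x \<otimes>\<^bsub>AutGrp B L\<^esub> F y" if "x \<in> carrier E" "y \<in> carrier E" for x y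
    using hom_mult[OF F(1) that] by simp
  have ker: "kernel E ?V F \<in> class_normals \<C> E"
    using kernel_class_normal[OF E.is_group V V_class F(1)] .
  have F_comp: "F (x \<cdot> y) l = F x (F y l)" if "x \<in> carrier E" "y \<in> carrier E" "l \<in> L" for x y l
    using that F_mult AutGrp_L(3) FA by simp
  have F_t: "F t (\<phi> l) = l" if l: "l \<in> L" for l
  proof -
    have "(?s \<otimes>\<^bsub>AutGrp B L\<^esub> restrict \<phi> L) l = ?s (restrict \<phi> L l)"
      using AutGrp_L(3)[OF A.inv_closed[OF \<phi>_A] \<phi>_A l] .
    moreover have "\<one>\<^bsub>AutGrp B L\<^esub> l = l"
      using l by (simp add: AutoGroup_def BijGroup_def)
    ultimately show ?thesis
      using l \<phi>_A F(3) by (simp add: A.l_inv)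
  qed
  have F_ker: "F y l = l" if "y \<in> kernel E ?V F" "l \<in> L" for y l
    using that by (auto simp: kernel_def AutoGroup_def BijGroup_def)
  show ?thesis
    by (rule exI[of _ "kernel E ?V F"], rule exI[of _ F])
      (use ker F_comp F_t F_ker F(2) AutGrp_L(2,4) FA in simp)
qed

end


section \<open>A normal subgroup of the base group compatible with the association\<close>

text \<open>
  The lifting condition says that \<open>\<KK>\<close> is contained in \<open>\<HH>\<close>, that is, \<open>\<UU> = \<HH>\<close>.
\<close>

locale twisted_hnn = invariant_hnn \<C> B H K \<phi>
  for \<C> :: "'u monoid \<Rightarrow> bool" and B :: "('b, 'm) monoid_scheme" (structure) and H K \<phi> +
  assumes conj_lift: "\<And>b. b \<in> carrier B \<Longrightarrow>
    \<exists>b'\<in>carrier B. \<forall>h\<in>H. \<phi> (b' \<otimes> h \<otimes> inv b') = b \<otimes> \<phi> h \<otimes> inv b"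

text \<open>
  These are the conditions under which \<open>\<phi>\<close> induces an HNN-extension of \<open>B / N\<close> in which the
  intersection of the associated subgroups is the image of \<open>L\<close>.
\<close>

locale compatible_normal = twisted_hnn \<C> B H K \<phi>
  for \<C> :: "'u monoid \<Rightarrow> bool" and B :: "('b, 'm) monoid_scheme" (structure) and H K \<phi> +
  fixes N :: "'b set"
  assumes N_class: "N \<in> class_normals \<C> B"
    and N_associated: "\<phi> ` (N \<inter> H) = N \<inter> K"
    and N_split: "\<And>h k. h \<in> H \<Longrightarrow> k \<in> K \<Longrightarrow> N #> h = N #> k \<Longrightarrow> \<exists>l\<in>L. N #> h = N #> l"
begin

abbreviation KN where "KN \<equiv> K <#> N"
abbreviation HN where "HN \<equiv> H <#> N"
abbreviation LN where "LN \<equiv> L <#> N"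
abbreviation HKN where "HKN \<equiv> H <#> KN"

lemma N_normal: "N \<lhd> B"
  using N_class by (simp add: class_normals_def)

lemmas KN_normal = normal_set_mult(1)[OF B.is_group K_normal N_normal]
  and HN_normal = normal_set_mult(1)[OF B.is_group H_normal N_normal]
  and LN_normal = normal_set_mult(1)[OF B.is_group L_normal N_normal]
lemmas HKN_normal = normal_set_mult(1)[OF B.is_group H_normal KN_normal]

lemmas K_KN = normal_set_mult(2)[OF B.is_group K_normal N_normal]
  and N_KN = normal_set_mult(3)[OF B.is_group K_normal N_normal]
  and H_HN = normal_set_mult(2)[OF B.is_group H_normal N_normal]
  and N_HN = normal_set_mult(3)[OF B.is_group H_normal N_normal]
  and L_LN = normal_set_mult(2)[OF B.is_group L_normal N_normal]
  and N_LN = normal_set_mult(3)[OF B.is_group L_normal N_normal]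
  and H_HKN = normal_set_mult(2)[OF B.is_group H_normal KN_normal]
  and KN_HKN = normal_set_mult(3)[OF B.is_group H_normal KN_normal]

lemma LN_KN: "LN \<subseteq> KN"
  by (auto simp: set_mult_def)

lemma N_B [simp]: "n \<in> N \<Longrightarrow> n \<in> carrier B"
  using N_normal normal_imp_subgroup subgroup.mem_carrier by metis

lemma H_Int_KN: "h \<in> H \<Longrightarrow> h \<in> KN \<Longrightarrow> h \<in> LN"
proof -
  assume h: "h \<in> H" "h \<in> KN"
  then obtain k n where k: "k \<in> K" "n \<in> N" "h = k \<otimes> n"
    by (auto simp: set_mult_def)
  then have "N #> h = N #> k"
    using right_factor_coset[OF _ _ N_normal] by simp
  then obtain l where l: "l \<in> L" "N #> h = N #> l"
    using N_split h(1) k(1) by blast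
  then have "LN #> h = LN #> l"
    using coset_cong_mono[OF B.is_group N_normal LN_normal N_LN] h l by simp
  also have "\<dots> = LN"
    using coset_self_iff[OF LN_normal] l L_LN by auto
  finally show "h \<in> LN"
    using coset_self_iff[OF LN_normal] h by simp
qed

lemma K_Int_HN: "k \<in> K \<Longrightarrow> k \<in> HN \<Longrightarrow> \<exists>l\<in>L. N #> k = N #> l"
proof -
  assume k: "k \<in> K" "k \<in> HN"
  then obtain h n where h: "h \<in> H" "n \<in> N" "k = h \<otimes> n"
    by (auto simp: set_mult_def)
  then have "N #> k = N #> h"
    using right_factor_coset[OF _ _ N_normal] by simp
  then show ?thesis
    using N_split h(1) k(1) by metis
qed

text \<open>
  The kernel of the action of \<open>B\<close> by conjugation on the image of \<open>H\<close> in \<open>B / LN\<close>. The quotient by it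
  is the group of automorphisms that \<open>\<UU>\<close> becomes modulo \<open>LN\<close>, and it is in the class as an image of
  \<open>B / N\<close>.
\<close>

definition conj_kernel :: "'b set" where
  "conj_kernel = {b \<in> carrier B. \<forall>h\<in>H. LN #> (b \<otimes> h \<otimes> inv b) = LN #> h}"

lemma H_conj': "b \<in> carrier B \<Longrightarrow> h \<in> H \<Longrightarrow> inv b \<otimes> h \<otimes> b \<in> H"
  using normal.inv_op_closed1[OF H_normal] .

lemma LN_conj:
  "x \<in> carrier B \<Longrightarrow> h \<in> H \<Longrightarrow> h' \<in> H \<Longrightarrow> LN #> h = LN #> h' \<Longrightarrow>
    LN #> (x \<otimes> h \<otimes> inv x) = LN #> (x \<otimes> h' \<otimes> inv x)"
  by (rule coset_conj_cong[OF B.is_group LN_normal]) simp_all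

lemma conj_kernel_subgroup: "subgroup conj_kernel B"
proof (rule B.subgroupI)
  show "conj_kernel \<noteq> {}"
    by (auto simp: conj_kernel_def intro!: exI[of _ \<one>])
next
  fix b c assume bc: "b \<in> conj_kernel" "c \<in> conj_kernel"
  show "b \<otimes> c \<in> conj_kernel"
    unfolding conj_kernel_def
  proof (intro CollectI conjI ballI)
    fix h assume h: "h \<in> H"
    have "LN #> (b \<otimes> c \<otimes> h \<otimes> inv (b \<otimes> c)) = LN #> (b \<otimes> (c \<otimes> h \<otimes> inv c) \<otimes> inv b)"
      using bc h by (simp add: conj_kernel_def B.word_simps)
    also have "\<dots> = LN #> (c \<otimes> h \<otimes> inv c)"
      using bc h H_conj by (simp add: conj_kernel_def)
    finally show "LN #> (b \<otimes> c \<otimes> h \<otimes> inv (b \<otimes> c)) = LN #> h"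
      using bc h by (simp add: conj_kernel_def)
  qed (use bc in \<open>simp add: conj_kernel_def\<close>)
next
  fix b assume b: "b \<in> conj_kernel"
  show "inv b \<in> conj_kernel"
    unfolding conj_kernel_def
  proof (intro CollectI conjI ballI)
    fix h assume h: "h \<in> H"
    have "inv b \<otimes> h \<otimes> b \<in> H"
      using b h H_conj' by (simp add: conj_kernel_def)
    then have "LN #> (b \<otimes> (inv b \<otimes> h \<otimes> b) \<otimes> inv b) = LN #> (inv b \<otimes> h \<otimes> b)"
      using b by (simp add: conj_kernel_def)
    then show "LN #> (inv b \<otimes> h \<otimes> inv (inv b)) = LN #> h"
      using b h by (simp add: conj_kernel_def B.word_simps)
  qed (use b in \<open>simp add: conj_kernel_def\<close>)
qed (auto simp: conj_kernel_def)

lemma conj_kernel_normal: "conj_kernel \<lhd> B"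
proof (rule B.normal_invI[OF conj_kernel_subgroup])
  fix g c assume gc: "g \<in> carrier B" "c \<in> conj_kernel"
  then have c: "c \<in> carrier B" by (simp add: conj_kernel_def)
  show "g \<otimes> c \<otimes> inv g \<in> conj_kernel"
    unfolding conj_kernel_def
  proof (intro CollectI conjI ballI)
    fix h assume h: "h \<in> H"
    let ?h = "inv g \<otimes> h \<otimes> g"
    have H: "?h \<in> H" "c \<otimes> ?h \<otimes> inv c \<in> H"
      using H_conj'[OF gc(1) h] H_conj[OF c] by blast+
    have "LN #> (g \<otimes> (c \<otimes> ?h \<otimes> inv c) \<otimes> inv g) = LN #> (g \<otimes> ?h \<otimes> inv g)"
      using gc H by (intro LN_conj) (simp_all add: conj_kernel_def)
    then show "LN #> (g \<otimes> c \<otimes> inv g \<otimes> h \<otimes> inv (g \<otimes> c \<otimes> inv g)) = LN #> h"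
      using gc c h by (simp add: B.word_simps)
  qed (use gc c in simp)
qed

lemma N_conj_kernel: "N \<subseteq> conj_kernel"
proof
  fix b assume b: "b \<in> N"
  show "b \<in> conj_kernel"
    unfolding conj_kernel_def
  proof (intro CollectI conjI ballI coset_eqI[OF LN_normal])
    fix h assume h: "h \<in> H"
    have "b \<otimes> (h \<otimes> inv b \<otimes> inv h) \<in> N"
      using b h normal.inv_op_closed2[OF N_normal, of h "inv b"]
        subgroup.m_closed[OF normal_imp_subgroup[OF N_normal]]
        subgroup.m_inv_closed[OF normal_imp_subgroup[OF N_normal]] by simp
    then show "b \<otimes> h \<otimes> inv b \<otimes> inv h \<in> LN"
      using N_LN b h by (auto simp: B.word_simps)
  qed (use b in simp_all)
qed

lemma conj_kernel_coset_eqI: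
  assumes "b \<in> carrier B" "c \<in> carrier B"
    and "\<And>h. h \<in> H \<Longrightarrow> LN #> (b \<otimes> h \<otimes> inv b) = LN #> (c \<otimes> h \<otimes> inv c)"
  shows "conj_kernel #> b = conj_kernel #> c"
proof (rule coset_eqI[OF conj_kernel_normal assms(1,2)])
  show "b \<otimes> inv c \<in> conj_kernel"
    unfolding conj_kernel_def
  proof (intro CollectI conjI ballI)
    fix h assume h: "h \<in> H"
    then have "LN #> (b \<otimes> (inv c \<otimes> h \<otimes> c) \<otimes> inv b) = LN #> (c \<otimes> (inv c \<otimes> h \<otimes> c) \<otimes> inv c)"
      using assms H_conj' by blast
    then show "LN #> (b \<otimes> inv c \<otimes> h \<otimes> inv (b \<otimes> inv c)) = LN #> h"
      using assms(1,2) h by (simp add: B.word_simps)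
  qed (use assms in simp)
qed

lemma conj_kernel_coset_conj:
  assumes "b \<in> carrier B" "c \<in> carrier B" "conj_kernel #> b = conj_kernel #> c" "h \<in> H" "h' \<in> H" "LN #> h = LN #> h'"
  shows "LN #> (inv b \<otimes> h \<otimes> b) = LN #> (inv c \<otimes> h' \<otimes> c)"
proof -
  define d where "d = inv (b \<otimes> inv c)"
  have d: "d \<in> conj_kernel"
    unfolding d_def using coset_eqD[OF conj_kernel_normal assms(1-3)] subgroup.m_inv_closed[OF conj_kernel_subgroup] by blast
  then have dB: "d \<in> carrier B" by (simp add: conj_kernel_def)
  have "LN #> (d \<otimes> h \<otimes> inv d) = LN #> h'"
    using d assms by (simp add: conj_kernel_def)
  then have "LN #> (inv c \<otimes> (d \<otimes> h \<otimes> inv d) \<otimes> inv (inv c)) = LN #> (inv c \<otimes> h' \<otimes> inv (inv c))"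
    using assms H_conj[OF dB] by (intro LN_conj) simp_all
  moreover have "inv c \<otimes> (d \<otimes> h \<otimes> inv d) \<otimes> inv (inv c) = inv b \<otimes> h \<otimes> b"
    using assms by (simp add: d_def B.word_simps)
  ultimately show ?thesis
    using assms by simp
qed

lemma K_conj_kernel: "K \<subseteq> conj_kernel"
proof
  fix k assume k: "k \<in> K"
  show "k \<in> conj_kernel"
    unfolding conj_kernel_def
  proof (intro CollectI conjI ballI coset_eqI[OF LN_normal])
    fix h assume h: "h \<in> H"
    have "k \<otimes> (h \<otimes> inv k \<otimes> inv h) \<in> K"
      using k h K_conj[of h "inv k"] K_closed by simp
    moreover have "k \<otimes> h \<otimes> inv k \<otimes> inv h \<in> H"
      using k h H_conj[of k h] H_closed by simp
    ultimately have "k \<otimes> h \<otimes> inv k \<otimes> inv h \<in> L"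
      using k h by (simp add: B.m_assoc)
    then show "k \<otimes> h \<otimes> inv k \<otimes> inv h \<in> LN"
      using L_LN by blast
  qed (use k in simp_all)
qed

definition lifted :: "'b \<Rightarrow> 'b" where
  "lifted b = (SOME b'. b' \<in> carrier B \<and> (\<forall>h\<in>H. \<phi> (b' \<otimes> h \<otimes> inv b') = b \<otimes> \<phi> h \<otimes> inv b))"

lemma lifted:
  assumes "b \<in> carrier B"
  shows "lifted b \<in> carrier B" "h \<in> H \<Longrightarrow> \<phi> (lifted b \<otimes> h \<otimes> inv lifted b) = b \<otimes> \<phi> h \<otimes> inv b"
proof -
  have "lifted b \<in> carrier B \<and> (\<forall>h\<in>H. \<phi> (lifted b \<otimes> h \<otimes> inv lifted b) = b \<otimes> \<phi> h \<otimes> inv b)"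
    unfolding lifted_def by (rule someI_ex) (use conj_lift[OF assms] in blast)
  then show "lifted b \<in> carrier B" "h \<in> H \<Longrightarrow> \<phi> (lifted b \<otimes> h \<otimes> inv lifted b) = b \<otimes> \<phi> h \<otimes> inv b"
    by blast+
qed

lemma lifted_coset_eqI:
  assumes "b \<in> carrier B" "c \<in> carrier B" "\<And>h. h \<in> H \<Longrightarrow> \<phi> (c \<otimes> h \<otimes> inv c) = b \<otimes> \<phi> h \<otimes> inv b"
  shows "conj_kernel #> lifted b = conj_kernel #> c"
proof (rule conj_kernel_coset_eqI[OF lifted(1)[OF assms(1)] assms(2)])
  fix h assume h: "h \<in> H"
  have "lifted b \<otimes> h \<otimes> inv lifted b = c \<otimes> h \<otimes> inv c"
  proof (rule inj_onD[OF \<phi>_inj])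
    show "\<phi> (lifted b \<otimes> h \<otimes> inv lifted b) = \<phi> (c \<otimes> h \<otimes> inv c)"
      unfolding lifted(2)[OF assms(1) h] assms(3)[OF h] ..
  qed (rule H_conj[OF lifted(1)[OF assms(1)] h], rule H_conj[OF assms(2) h])
  then show "LN #> (lifted b \<otimes> h \<otimes> inv lifted b) = LN #> (c \<otimes> h \<otimes> inv c)" by simp
qed

lemma lifted_mult: "b \<in> carrier B \<Longrightarrow> c \<in> carrier B \<Longrightarrow> conj_kernel #> lifted (b \<otimes> c) = conj_kernel #> (lifted b \<otimes> lifted c)"
proof (rule lifted_coset_eqI)
  fix h assume bc: "b \<in> carrier B" "c \<in> carrier B" and h: "h \<in> H"
  have "\<phi> (lifted b \<otimes> lifted c \<otimes> h \<otimes> inv (lifted b \<otimes> lifted c)) = \<phi> (lifted b \<otimes> (lifted c \<otimes> h \<otimes> inv lifted c) \<otimes> inv lifted b)"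
    using bc h lifted(1) by (simp add: B.word_simps)
  also have "\<dots> = b \<otimes> (c \<otimes> \<phi> h \<otimes> inv c) \<otimes> inv b"
    using bc h lifted H_conj by simp
  finally show "\<phi> (lifted b \<otimes> lifted c \<otimes> h \<otimes> inv (lifted b \<otimes> lifted c)) = b \<otimes> c \<otimes> \<phi> h \<otimes> inv (b \<otimes> c)"
    using bc h by (simp add: B.word_simps)
qed (simp_all add: lifted)

lemma lifted_\<phi>: "h \<in> H \<Longrightarrow> conj_kernel #> lifted (\<phi> h) = conj_kernel #> h"
  using H_closed
  by (intro lifted_coset_eqI) simp_all

text \<open>
  For \<open>h\<close> and \<open>x\<close> in \<open>H\<close> the commutator of \<open>h\<close> with \<open>\<phi> x\<close> lies in \<open>L\<close>, and \<open>\<phi>\<close> preserves \<open>L\<close>. So the action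
  of \<open>H\<close> on \<open>K\<close>, transported to \<open>H\<close>, is trivial modulo \<open>L\<close>.
\<close>

lemma lifted_H: "h \<in> H \<Longrightarrow> conj_kernel #> lifted h = conj_kernel #> \<one>"
proof (rule conj_kernel_coset_eqI)
  fix x assume h: "h \<in> H" and x: "x \<in> H"
  let ?d = "lifted h \<otimes> x \<otimes> inv lifted h \<otimes> inv x"
  have d: "?d \<in> H"
    using h x H_conj lifted(1) H_closed by simp
  have "\<phi> ?d = h \<otimes> \<phi> x \<otimes> inv h \<otimes> inv \<phi> x"
    using h x H_conj[of "lifted h" x] lifted[of h] subgroup.m_inv_closed[OF H_subgroup] by simp
  then have "\<phi> ?d = h \<otimes> (\<phi> x \<otimes> inv h \<otimes> inv \<phi> x)"
    using h x by (simp add: B.m_assoc)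
  moreover have "h \<otimes> (\<phi> x \<otimes> inv h \<otimes> inv \<phi> x) \<in> H"
    using h x H_conj[of "\<phi> x" "inv h"] H_closed by simp
  ultimately have "\<phi> ?d \<in> L"
    using \<phi>_mem[OF d] by (simp only: Int_iff)
  then obtain l where "l \<in> L" "\<phi> ?d = \<phi> l"
    using \<phi>_L by blast
  then have "?d \<in> LN"
    using d inj_onD[OF \<phi>_inj] L_LN by blast
  then show "LN #> (lifted h \<otimes> x \<otimes> inv lifted h) = LN #> (\<one> \<otimes> x \<otimes> inv \<one>)"
    using h x lifted(1) by (intro coset_eqI[OF LN_normal]) simp_all
qed (simp_all add: lifted)

lemma coset_conj_kernel_one: "x \<in> conj_kernel \<Longrightarrow> conj_kernel #> x = conj_kernel #> \<one>"
  using coset_self_iff[OF conj_kernel_normal, of x] coset_self_iff[OF conj_kernel_normal, of \<one>] subgroup.one_closed[OF conj_kernel_subgroup]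
    subgroup.mem_carrier[OF conj_kernel_subgroup] by simp

text \<open>
  By the splitting condition the trace of \<open>HN\<close> on \<open>K\<close> lies in \<open>LN\<close>, and \<open>\<phi>\<close> preserves \<open>L\<close> and matches
  the traces of \<open>N\<close>.
\<close>

lemma \<phi>_coset_inj:
  assumes "e \<in> H" "e' \<in> H" "HN #> \<phi> e = HN #> \<phi> e'"
  shows "LN #> e = LN #> e'"
proof (rule coset_eqI[OF LN_normal])
  have d: "e \<otimes> inv e' \<in> H"
    using assms H_closed by simp
  have "\<phi> (e \<otimes> inv e') = \<phi> e \<otimes> inv \<phi> e'"
    using assms subgroup.m_inv_closed[OF H_subgroup] by simp
  then have "\<phi> (e \<otimes> inv e') \<in> HN"
    using coset_eqD[OF HN_normal _ _ assms(3)] assms(1,2) by simp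
  then obtain l where l: "l \<in> L" "N #> \<phi> (e \<otimes> inv e') = N #> l"
    using K_Int_HN \<phi>_mem[OF d] by blast
  then obtain l' where l': "l' \<in> L" "l = \<phi> l'"
    using \<phi>_L by blast
  let ?n = "e \<otimes> inv e' \<otimes> inv l'"
  have n: "?n \<in> H"
    using d l' H_closed by simp
  have "\<phi> ?n = \<phi> (e \<otimes> inv e') \<otimes> inv l"
    using d l' subgroup.m_inv_closed[OF H_subgroup] by (simp del: \<phi>_mult add: \<phi>_mult[OF d])
  then have "\<phi> ?n \<in> N \<inter> K"
    using coset_eqD[OF N_normal _ _ l(2)] \<phi>_mem[OF d] \<phi>_mem[OF n] l(1) by simp
  then obtain n' where "n' \<in> N" "n' \<in> H" "\<phi> n' = \<phi> ?n"
    using N_associated by (metis IntD1 IntD2 imageE)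
  then have nN: "?n \<in> N"
    using n inj_onD[OF \<phi>_inj] by blast
  have "?n \<otimes> l' \<in> LN"
    using nN l' N_LN L_LN subgroup.m_closed[OF normal_imp_subgroup[OF LN_normal]] by blast
  then show "e \<otimes> inv e' \<in> LN"
    using assms(1,2) l' by (simp add: B.word_simps)
qed (use assms in simp_all)

lemma KN_coset_inj:
  assumes "e \<in> H" "e' \<in> H" "KN #> e = KN #> e'"
  shows "LN #> e = LN #> e'"
proof (rule coset_eqI[OF LN_normal])
  have "e \<otimes> inv e' \<in> KN"
    using coset_eqD[OF KN_normal _ _ assms(3)] assms(1,2) by simp
  then show "e \<otimes> inv e' \<in> LN"
    using H_Int_KN assms(1,2) H_closed by simp
qed (use assms in simp_all)

lemma superset_class: "A \<lhd> B \<Longrightarrow> N \<subseteq> A \<Longrightarrow> in_class \<C> (B Mod A)"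
  using class_normal_superset[OF B.is_group N_class] by (auto simp: class_normals_def)

text \<open>
  Let \<open>s\<close> be a non-trivial element of a member \<open>X\<close> of the class, and let \<open>deg\<close> be the homomorphism
  from \<open>E\<close> to \<open>X\<close> that is trivial on \<open>B\<close> and sends \<open>t\<close> to \<open>s\<close>. An element of \<open>HKN\<close> has an image in
  \<open>HKN / KN\<close>, its \<open>H\<close>-part, and an image in \<open>HKN / HN\<close>, its \<open>K\<close>-part, which \<open>\<phi>\<^sup>-\<^sup>1\<close> carries to the
  former quotient. The family \<open>\<theta>\<close> shows the \<open>H\<close>-part over the points of degree \<open>s\<close>, the \<open>K\<close>-part over
  those of degree \<open>1\<close>, and nothing elsewhere. It is compatible with \<open>\<phi>\<close>, because \<open>t\<close> carries degree
  \<open>1\<close> to degree \<open>s\<close>, while modulo \<open>L\<close> elements of \<open>H\<close> have a trivial \<open>K\<close>-part and elements of \<open>K\<close> a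
  trivial \<open>H\<close>-part.

  In order to be compatible with conjugation by \<open>B\<close>, the values must be twisted. Therefore a
  crossed function \<open>u\<close> first records an automorphism at each point: \<open>b\<close> contributes its own action on \<open>H\<close> in
  degree \<open>s\<close>, and in degree \<open>1\<close> its action on \<open>K\<close>, carried over to \<open>H\<close> by \<open>\<phi>\<close>. If both parts of
  \<open>b\<close> vanish, then \<open>b\<close> lies in \<open>HN \<inter> KN = LN\<close>.
\<close>

lemma base_mod_L:
  shows "\<exists>T\<in>class_normals \<C> E. \<forall>b\<in>carrier B. \<iota> b \<in> T \<longrightarrow> (\<exists>l\<in>L. N #> b = N #> l)"
proof -
  obtain X s where X: "\<C> X" "group X" and s: "s \<in> carrier X" "s \<noteq> \<one>\<^bsub>X\<^esub>"
    by (rule nontrivial_member)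
  interpret X: group X by fact
  have one_hom: "(\<lambda>_. \<one>\<^bsub>X\<^esub>) \<in> hom B X"
    by (rule homI) simp_all
  obtain deg where deg: "deg \<in> hom E X" "\<And>b. b \<in> carrier B \<Longrightarrow> deg (\<iota> b) = \<one>\<^bsub>X\<^esub>" "deg t = s"
    using hnn_lift[OF B.is_group X(2) one_hom s(1), of H \<phi>] \<phi>_image subgroup.subset[OF H_subgroup]
      subgroup.subset[OF K_subgroup] s(1) by auto
  interpret deg: group_hom E X deg
    using deg(1) by unfold_locales
  have deg_\<iota> [simp]: "deg (\<iota> b \<cdot> x) = deg x" if "b \<in> carrier B" "x \<in> carrier E" for b x
    using that deg(2) by simp
  have deg_t [simp]: "deg (t \<cdot> x) = s \<otimes>\<^bsub>X\<^esub> deg x" if "x \<in> carrier E" for x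
    using that deg(3) by simp
  have deg_t_ne: "s \<otimes>\<^bsub>X\<^esub> deg x = s \<longleftrightarrow> deg x = \<one>\<^bsub>X\<^esub>" if "x \<in> carrier E" for x
    using that s X.l_cancel_one by simp
  note deg.hom_mult [simp del]
  define Td where "Td = kernel E X deg"
  have Td: "Td \<in> class_normals \<C> E"
    unfolding Td_def using kernel_class_normal[OF E.is_group X(2) in_class_self[OF X(1)] deg(1)] .
  have deg_Td: "deg (x \<cdot> y) = deg x" if "x \<in> carrier E" "y \<in> Td" for x y
    using that by (simp add: Td_def kernel_def deg.hom_mult)
  \<comment> \<open>The element of \<open>B\<close> whose action on \<open>H\<close> is contributed by \<open>b\<close> at \<open>x\<close>.\<close>
  define q where "q b x = (if deg x = s then b else if deg x = \<one>\<^bsub>X\<^esub> then lifted b else \<one>)" for b x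
  have q_B [simp]: "q b x \<in> carrier B" if "b \<in> carrier B" for b x
    using that lifted(1) by (simp add: q_def)
  have "\<exists>T u. T \<in> class_normals \<C> E \<and> T \<subseteq> Td \<and> u \<one>\<^bsub>E\<^esub> = \<one>\<^bsub>B Mod conj_kernel\<^esub> \<and> (\<forall>x\<in>carrier E. u x \<in> carrier (B Mod conj_kernel) \<and>
      (\<forall>b\<in>carrier B. u (\<iota> b \<cdot> x) = (conj_kernel #> q b x) \<otimes>\<^bsub>B Mod conj_kernel\<^esub> u x) \<and> u (t \<cdot> x) = (conj_kernel #> \<one>) \<otimes>\<^bsub>B Mod conj_kernel\<^esub> u x \<and>
      (\<forall>y\<in>T. u (x \<cdot> y) = u x))"
  proof (rule crossed_function[OF Td])
    show "group (B Mod conj_kernel)" "in_class \<C> (B Mod conj_kernel)"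
      using normal.factorgroup_is_group[OF conj_kernel_normal] superset_class[OF conj_kernel_normal N_conj_kernel] .
    show "conj_kernel #> q (b \<otimes> c) x = (conj_kernel #> q b (\<iota> c \<cdot> x)) \<otimes>\<^bsub>B Mod conj_kernel\<^esub> (conj_kernel #> q c x)"
      if "b \<in> carrier B" "c \<in> carrier B" "x \<in> carrier E" for b c x
      using that coset_sum[OF conj_kernel_normal] lifted_mult lifted(1) by (simp add: q_def)
    show "(conj_kernel #> q h (t \<cdot> x)) \<otimes>\<^bsub>B Mod conj_kernel\<^esub> (conj_kernel #> \<one>) = (conj_kernel #> \<one>) \<otimes>\<^bsub>B Mod conj_kernel\<^esub> (conj_kernel #> q (\<phi> h) x)"
      if h: "h \<in> H" and x: "x \<in> carrier E" for h x
    proof -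
      have "conj_kernel #> \<phi> h = conj_kernel #> \<one>"
        using coset_conj_kernel_one K_conj_kernel \<phi>_mem[OF h] by blast
      then have "conj_kernel #> q h (t \<cdot> x) = conj_kernel #> q (\<phi> h) x"
        using h x s deg_t_ne[OF x] lifted_\<phi>[OF h] lifted_H[OF h]
        by (cases "deg x = \<one>\<^bsub>X\<^esub>"; cases "deg x = s") (simp_all add: q_def)
      then show ?thesis
        using h x coset_sum[OF conj_kernel_normal] by simp
    qed
    show "conj_kernel #> q b (x \<cdot> y) = conj_kernel #> q b x" if "b \<in> carrier B" "x \<in> carrier E" "y \<in> Td" for b x y
      using that by (simp add: q_def deg_Td)
  qed (simp_all add: carrier_FactGroup)
  then obtain T1 u where T1: "T1 \<in> class_normals \<C> E" "T1 \<subseteq> Td" and u1: "u \<one>\<^bsub>E\<^esub> = conj_kernel"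
    and u: "\<forall>x\<in>carrier E. u x \<in> carrier (B Mod conj_kernel) \<and>
      (\<forall>b\<in>carrier B. u (\<iota> b \<cdot> x) = (conj_kernel #> q b x) <#> u x) \<and> u (t \<cdot> x) = (conj_kernel #> \<one>) <#> u x \<and>
      (\<forall>y\<in>T1. u (x \<cdot> y) = u x)"
    by auto
  \<comment> \<open>A representative in \<open>B\<close> of the automorphism recorded at \<open>x\<close>.\<close>
  define c where "c x = (SOME g. g \<in> carrier B \<and> conj_kernel #> g = u x)" for x
  have c: "c x \<in> carrier B \<and> conj_kernel #> c x = u x" if x: "x \<in> carrier E" for x
  proof -
    have "u x \<in> (\<lambda>g. conj_kernel #> g) ` carrier B"
      using u x unfolding carrier_FactGroup by blast
    then have "\<exists>g. g \<in> carrier B \<and> conj_kernel #> g = u x"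
      by (metis imageE)
    then show ?thesis
      unfolding c_def by (rule someI_ex)
  qed
  have c_B [simp]: "c x \<in> carrier B" if "x \<in> carrier E" for x
    using c[OF that] by blast
  have c_\<iota>: "conj_kernel #> c (\<iota> b \<cdot> x) = conj_kernel #> (q b x \<otimes> c x)" if "b \<in> carrier B" "x \<in> carrier E" for b x
    using that c[of "\<iota> b \<cdot> x"] c[of x] u coset_sum[OF conj_kernel_normal, of "q b x" "c x"] by simp
  have c_t: "conj_kernel #> c (t \<cdot> x) = conj_kernel #> c x" if "x \<in> carrier E" for x
    using that c[of "t \<cdot> x"] c[of x] u coset_sum[OF conj_kernel_normal, of \<one> "c x"] by simp
  have c_T1: "c (x \<cdot> y) = c x" if "x \<in> carrier E" "y \<in> T1" for x y
    using that u by (simp add: c_def)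
  have conj_kernel_one: "conj_kernel #> \<one> = conj_kernel"
    using coset_self_iff[OF conj_kernel_normal, of \<one>] subgroup.one_closed[OF conj_kernel_subgroup] by simp
  have HKN_trivial: "HKN #> b = HKN" if "b \<in> HKN" for b
    using that coset_self_iff[OF HKN_normal] subgroup.mem_carrier[OF normal_imp_subgroup[OF HKN_normal]] by blast
  have gJ: "group (B Mod HKN)"
    using normal.factorgroup_is_group[OF HKN_normal] .
  have N_HKN: "N \<subseteq> HKN" and K_HKN: "K \<subseteq> HKN"
    using N_KN K_KN KN_HKN by blast+
  obtain F where F: "F \<in> hom E (B Mod HKN)" "\<And>b. b \<in> carrier B \<Longrightarrow> F (\<iota> b) = HKN #> b"
  proof (rule hnn_lift[OF B.is_group gJ hom_Mod[OF HKN_normal]])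
    show "\<one>\<^bsub>B Mod HKN\<^esub> \<in> carrier (B Mod HKN)"
      using gJ by (meson group.is_monoid monoid.one_closed)
    fix h assume h: "h \<in> H"
    have "HKN #> h = HKN" "HKN #> \<phi> h = HKN"
      using HKN_trivial H_HKN K_HKN h \<phi>_mem[OF h] by blast+
    then show "(HKN #> h) \<otimes>\<^bsub>B Mod HKN\<^esub> \<one>\<^bsub>B Mod HKN\<^esub> = \<one>\<^bsub>B Mod HKN\<^esub> \<otimes>\<^bsub>B Mod HKN\<^esub> (HKN #> \<phi> h)"
      by simp
  qed (use \<phi>_image subgroup.subset[OF H_subgroup] subgroup.subset[OF K_subgroup] in auto)
  define T0 where "T0 = T1 \<inter> kernel E (B Mod HKN) F"
  have T0: "T0 \<in> class_normals \<C> E"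
    unfolding T0_def
    by (rule class_normal_Int[OF E.is_group E_small T1(1)
        kernel_class_normal[OF E.is_group gJ superset_class[OF HKN_normal N_HKN] F(1)]])
  have T0_HKN: "b \<in> HKN" if "b \<in> carrier B" "\<iota> b \<in> T0" for b
    using that F(2) coset_self_iff[OF HKN_normal] by (simp add: T0_def kernel_def)
  have ex_h: "\<exists>h\<in>H. KN #> b = KN #> h" if b: "b \<in> HKN" for b
  proof -
    obtain h x where h: "h \<in> H" "x \<in> KN" "b = h \<otimes> x"
      using b unfolding set_mult_iff[where A = H and x = b] by blast
    then show ?thesis
      using right_factor_coset[OF _ h(2) KN_normal, of h] by auto
  qed
  have ex_k: "\<exists>h\<in>H. HN #> b = HN #> \<phi> h" if b: "b \<in> HKN" for b
  proof -
    obtain h k n where h: "h \<in> H" "k \<in> K" "n \<in> N" "b = h \<otimes> (k \<otimes> n)"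
      using b by (auto simp: set_mult_def)
    have "b \<otimes> inv k = h \<otimes> (k \<otimes> n \<otimes> inv k)"
      using h by (simp add: B.word_simps)
    moreover have "k \<otimes> n \<otimes> inv k \<in> N"
      using normal.inv_op_closed2[OF N_normal] h by simp
    ultimately have "b \<otimes> inv k \<in> HN"
      using h(1) unfolding set_mult_iff by blast
    then have "HN #> b = HN #> k"
      using h by (intro coset_eqI[OF HN_normal]) simp_all
    then show ?thesis
      using h(2) by (intro bexI[of _ "\<psi> k"]) simp_all
  qed
  \<comment> \<open>The \<open>H\<close>-part of \<open>b\<close> and the inverse image under \<open>\<phi>\<close> of its \<open>K\<close>-part.\<close>
  define hs where "hs b = (SOME h. h \<in> H \<and> KN #> b = KN #> h)" for b
  define h1 where "h1 b = (SOME h. h \<in> H \<and> HN #> b = HN #> \<phi> h)" for b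
  have hs: "hs b \<in> H \<and> KN #> b = KN #> hs b" if "b \<in> HKN" for b
    unfolding hs_def by (rule someI_ex) (use ex_h[OF that] in blast)
  have h1: "h1 b \<in> H \<and> HN #> b = HN #> \<phi> (h1 b)" if "b \<in> HKN" for b
    unfolding h1_def by (rule someI_ex) (use ex_k[OF that] in blast)
  have HKN_B [simp]: "b \<in> carrier B" if "b \<in> HKN" for b
    using that subgroup.mem_carrier[OF normal_imp_subgroup[OF HKN_normal]] by blast
  have hs_eqI: "LN #> hs b = LN #> e" if "b \<in> HKN" "e \<in> H" "KN #> b = KN #> e" for b e
    using that hs[OF that(1)] by (intro KN_coset_inj) auto
  have h1_eqI: "LN #> h1 b = LN #> e" if "b \<in> HKN" "e \<in> H" "HN #> b = HN #> \<phi> e" for b e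
    using that h1[OF that(1)] by (intro \<phi>_coset_inj) auto
  define e where "e x b = (if deg x = s then hs b else if deg x = \<one>\<^bsub>X\<^esub> then h1 b else \<one>)" for x b
  have e_H [simp]: "e x b \<in> H" if "b \<in> HKN" for x b
    using that hs h1 subgroup.one_closed[OF H_subgroup] by (simp add: e_def)
  define \<theta> where "\<theta> x b = KN #> (inv c x \<otimes> e x b \<otimes> c x)" for x b
  have \<theta>_eqI: "KN #> (inv g \<otimes> h \<otimes> g) = KN #> (inv g' \<otimes> h' \<otimes> g')"
    if "g \<in> carrier B" "g' \<in> carrier B" "conj_kernel #> g = conj_kernel #> g'" "h \<in> H" "h' \<in> H" "LN #> h = LN #> h'" for g g' h h'
    using coset_cong_mono[OF B.is_group LN_normal KN_normal LN_KN _ _ conj_kernel_coset_conj[OF that]] that by simp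
  have e_mult: "LN #> e x (a \<otimes> b) = LN #> (e x a \<otimes> e x b)" if ab: "a \<in> HKN" "b \<in> HKN" for x a b
  proof -
    have abJ: "a \<otimes> b \<in> HKN"
      using ab subgroup.m_closed[OF normal_imp_subgroup[OF HKN_normal]] by blast
    have "LN #> hs (a \<otimes> b) = LN #> (hs a \<otimes> hs b)"
      using hs[OF ab(1)] hs[OF ab(2)] ab subgroup.m_closed[OF H_subgroup]
      by (intro hs_eqI[OF abJ] coset_mult_cong[OF B.is_group KN_normal]) simp_all
    moreover have "LN #> h1 (a \<otimes> b) = LN #> (h1 a \<otimes> h1 b)"
      using h1[OF ab(1)] h1[OF ab(2)] ab subgroup.m_closed[OF H_subgroup]
      by (intro h1_eqI[OF abJ]) (simp_all add: coset_mult_cong[OF B.is_group HN_normal])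
    ultimately show ?thesis
      by (simp add: e_def)
  qed
  have e_base: "LN #> e (\<iota> b \<cdot> x) (b \<otimes> a \<otimes> inv b) = LN #> (q b x \<otimes> e x a \<otimes> inv q b x)"
    if b: "b \<in> carrier B" and x: "x \<in> carrier E" and a: "a \<in> HKN" for b x a
  proof -
    have aJ: "b \<otimes> a \<otimes> inv b \<in> HKN"
      using normal.inv_op_closed2[OF HKN_normal b a] .
    have "LN #> hs (b \<otimes> a \<otimes> inv b) = LN #> (b \<otimes> hs a \<otimes> inv b)"
      using hs[OF a] a b H_conj by (intro hs_eqI[OF aJ] coset_conj_cong[OF B.is_group KN_normal]) simp_all
    moreover have "LN #> h1 (b \<otimes> a \<otimes> inv b) = LN #> (lifted b \<otimes> h1 a \<otimes> inv lifted b)"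
    proof (rule h1_eqI[OF aJ])
      show "lifted b \<otimes> h1 a \<otimes> inv lifted b \<in> H"
        using h1[OF a] lifted(1)[OF b] H_conj by blast
      have "HN #> (b \<otimes> a \<otimes> inv b) = HN #> (b \<otimes> \<phi> (h1 a) \<otimes> inv b)"
        using h1[OF a] a b by (intro coset_conj_cong[OF B.is_group HN_normal]) simp_all
      then show "HN #> (b \<otimes> a \<otimes> inv b) = HN #> \<phi> (lifted b \<otimes> h1 a \<otimes> inv lifted b)"
        using lifted(2)[OF b] h1[OF a] by simp
    qed
    ultimately show ?thesis
      using b x by (simp add: e_def q_def)
  qed
  have e_stable: "LN #> e (t \<cdot> x) h = LN #> e x (\<phi> h)" if h: "h \<in> H" and x: "x \<in> carrier E" for h x
  proof -
    have hJ: "h \<in> HKN" "\<phi> h \<in> HKN"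
      using h H_HKN K_HKN \<phi>_mem[OF h] by blast+
    have one_H: "\<one> \<in> H"
      using subgroup.one_closed[OF H_subgroup] .
    have 1: "LN #> hs h = LN #> h" "LN #> h1 (\<phi> h) = LN #> h"
      using h hJ by (simp_all add: hs_eqI h1_eqI)
    have "KN #> \<phi> h = KN #> \<one>"
      using K_KN \<phi>_mem[OF h] by (intro coset_eqI[OF KN_normal]) auto
    then have 2: "LN #> hs (\<phi> h) = LN #> \<one>"
      using hJ one_H by (intro hs_eqI)
    have "HN #> h = HN #> \<phi> \<one>"
      using H_HN h by (intro coset_eqI[OF HN_normal]) auto
    then have 3: "LN #> h1 h = LN #> \<one>"
      using hJ one_H by (intro h1_eqI)
    show ?thesis
      using 1 2 3 x s deg_t_ne[OF x] by (auto simp: e_def)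
  qed
  obtain T2 where T2: "T2 \<in> class_normals \<C> E" "T2 \<subseteq> T0"
    and T2_\<theta>: "\<And>x b. x \<in> carrier E \<Longrightarrow> b \<in> carrier B \<Longrightarrow> \<iota> b \<in> T2 \<Longrightarrow> \<theta> x b = KN"
  proof (rule induced_function[OF T0, of "B Mod KN" \<theta>])
    show "group (B Mod KN)" "in_class \<C> (B Mod KN)"
      using normal.factorgroup_is_group[OF KN_normal] superset_class[OF KN_normal N_KN] .
    show "\<theta> x b \<in> carrier (B Mod KN)" if "x \<in> carrier E" "b \<in> carrier B" "\<iota> b \<in> T0" for x b
      unfolding \<theta>_def carrier_FactGroup using that(1) T0_HKN[OF that(2,3)] by (intro imageI) simp
    show "\<theta> x (a \<otimes> b) = \<theta> x a \<otimes>\<^bsub>B Mod KN\<^esub> \<theta> x b"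
      if "x \<in> carrier E" "a \<in> carrier B" "b \<in> carrier B" "\<iota> a \<in> T0" "\<iota> b \<in> T0" for x a b
    proof -
      have ab: "a \<in> HKN" "b \<in> HKN" using that T0_HKN by blast+
      then have abJ: "a \<otimes> b \<in> HKN"
        using subgroup.m_closed[OF normal_imp_subgroup[OF HKN_normal]] by blast
      have "\<theta> x (a \<otimes> b) = KN #> (inv c x \<otimes> (e x a \<otimes> e x b) \<otimes> c x)"
        unfolding \<theta>_def using e_mult[OF ab] abJ ab that(1) subgroup.m_closed[OF H_subgroup]
        by (intro \<theta>_eqI) simp_all
      also have "inv c x \<otimes> (e x a \<otimes> e x b) \<otimes> c x = inv c x \<otimes> e x a \<otimes> c x \<otimes> (inv c x \<otimes> e x b \<otimes> c x)"
        using ab that(1) by (simp add: B.word_simps)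
      finally show ?thesis
        using ab that(1) by (simp add: \<theta>_def coset_sum[OF KN_normal])
    qed
    show "\<theta> (x \<cdot> y) b = \<theta> x b" if "x \<in> carrier E" "y \<in> T0" "b \<in> carrier B" "\<iota> b \<in> T0" for x y b
      using that deg_Td[of x y] T1(2) c_T1[of x y] by (auto simp: T0_def \<theta>_def e_def)
    show "\<theta> (\<iota> b \<cdot> x) (b \<otimes> a \<otimes> inv b) = \<theta> x a"
      if x: "x \<in> carrier E" and b: "b \<in> carrier B" and "a \<in> carrier B" "\<iota> a \<in> T0" for x b a
    proof -
      have a: "a \<in> HKN" using that T0_HKN by blast
      have aJ: "b \<otimes> a \<otimes> inv b \<in> HKN"
        using normal.inv_op_closed2[OF HKN_normal b a] .
      have "\<theta> (\<iota> b \<cdot> x) (b \<otimes> a \<otimes> inv b) =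
          KN #> (inv (q b x \<otimes> c x) \<otimes> (q b x \<otimes> e x a \<otimes> inv q b x) \<otimes> (q b x \<otimes> c x))"
        unfolding \<theta>_def using e_base[OF b x a] c_\<iota>[OF b x] a aJ b x H_conj by (intro \<theta>_eqI) simp_all
      also have "inv (q b x \<otimes> c x) \<otimes> (q b x \<otimes> e x a \<otimes> inv q b x) \<otimes> (q b x \<otimes> c x) = inv c x \<otimes> e x a \<otimes> c x"
        using a b x by (simp add: B.word_simps)
      finally show ?thesis
        by (simp add: \<theta>_def)
    qed
    show "\<theta> (t \<cdot> x) h = \<theta> x (\<phi> h)" if x: "x \<in> carrier E" and h: "h \<in> H" for x h
    proof -
      have "h \<in> HKN" "\<phi> h \<in> HKN"
        using h H_HKN K_HKN \<phi>_mem[OF h] by blast+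
      then show ?thesis
        unfolding \<theta>_def using e_stable[OF h x] c_t[OF x] x by (intro \<theta>_eqI) simp_all
    qed
  qed (use that in simp)
  show ?thesis
  proof (intro bexI[OF _ T2(1)] ballI impI)
    fix b assume b: "b \<in> carrier B" "\<iota> b \<in> T2"
    then have bJ: "b \<in> HKN"
      using T0_HKN T2(2) by blast
    have s_t: "deg t = s" and "deg \<one>\<^bsub>E\<^esub> = \<one>\<^bsub>X\<^esub>"
      using deg by simp_all
    have c1: "conj_kernel #> c \<one>\<^bsub>E\<^esub> = conj_kernel #> \<one>"
      using c[of "\<one>\<^bsub>E\<^esub>"] u1 conj_kernel_one by simp
    have ct: "conj_kernel #> c t = conj_kernel #> \<one>"
      using c_t[of "\<one>\<^bsub>E\<^esub>"] c1 by simp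
    have e_KN: "e x b \<in> LN" if "x \<in> carrier E" "conj_kernel #> c x = conj_kernel #> \<one>" for x
    proof -
      have "KN #> (inv c x \<otimes> e x b \<otimes> c x) = KN #> (inv \<one> \<otimes> e x b \<otimes> \<one>)"
        using that bJ by (intro \<theta>_eqI) simp_all
      then have "KN #> e x b = KN"
        using T2_\<theta>[OF that(1) b] bJ by (simp add: \<theta>_def)
      then show ?thesis
        using coset_self_iff[OF KN_normal] bJ H_Int_KN by simp
    qed
    have "hs b \<in> LN"
      using e_KN[OF _ ct] s_t by (simp add: e_def)
    then have "KN #> b = KN"
      using hs[OF bJ] LN_KN coset_self_iff[OF KN_normal] by auto
    then have "b \<in> KN"
      using coset_self_iff[OF KN_normal b(1)] by simp
    then obtain k n where k: "k \<in> K" "n \<in> N" "b = k \<otimes> n"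
      by (auto simp: set_mult_def)
    have h1M: "h1 b \<in> LN"
      using e_KN[OF _ c1] \<open>deg \<one>\<^bsub>E\<^esub> = \<one>\<^bsub>X\<^esub>\<close> s by (simp add: e_def)
    then obtain l n' where l: "l \<in> L" "n' \<in> N" "h1 b = l \<otimes> n'"
      by (auto simp: set_mult_def)
    have "inv l \<otimes> h1 b \<in> H"
      using h1[OF bJ] l(1) H_closed by blast
    moreover have "inv l \<otimes> h1 b = n'"
      using l by (simp add: B.word_simps)
    ultimately have n': "n' \<in> H"
      by simp
    have "\<phi> (h1 b) = \<phi> l \<otimes> \<phi> n'"
      using l n' by simp
    moreover have "\<phi> l \<in> HN"
      using l(1) \<phi>_L H_HN by blast
    moreover have "\<phi> n' \<in> HN"
      using N_associated l(2) n' N_HN by blast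
    ultimately have "\<phi> (h1 b) \<in> HN"
      using subgroup.m_closed[OF normal_imp_subgroup[OF HN_normal]] by simp
    then have "HN #> b = HN"
      using h1[OF bJ] coset_self_iff[OF HN_normal] by auto
    then have "b \<in> HN"
      using coset_self_iff[OF HN_normal b(1)] by simp
    then obtain h n'' where h: "h \<in> H" "n'' \<in> N" "b = h \<otimes> n''"
      by (auto simp: set_mult_def)
    have "N #> b = N #> h"
      unfolding h(3) using right_factor_coset[OF _ h(2) N_normal] h(1) by simp
    moreover have "N #> b = N #> k"
      unfolding k(3) using right_factor_coset[OF _ k(2) N_normal] k(1) by simp
    ultimately show "\<exists>l\<in>L. N #> b = N #> l"
      using N_split[OF h(1) k(1)] by simp
  qed
qed

text \<open>
  Modulo the previous quotient the elements of \<open>B\<close> lie in \<open>LN\<close>, and the family \<open>\<theta>\<close> shows their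
  \<open>L\<close>-part modulo \<open>N\<close>, twisted by the action of \<open>E\<close> on \<open>L\<close>. This makes sense because the action
  preserves \<open>N \<inter> L\<close>, and the compatibility conditions hold because \<open>b\<close> and \<open>t\<close> act on \<open>L\<close> in the
  same way as they act on the arguments of the family.
\<close>

lemma base_mod_N:
  shows "\<exists>T\<in>class_normals \<C> E. \<forall>b\<in>carrier B. \<iota> b \<in> T \<longrightarrow> b \<in> N"
proof -
  obtain T2 where T2: "T2 \<in> class_normals \<C> E" "\<forall>b\<in>carrier B. \<iota> b \<in> T2 \<longrightarrow> (\<exists>l\<in>L. N #> b = N #> l)"
    using base_mod_L by blast
  obtain TV \<alpha> where TV: "TV \<in> class_normals \<C> E" and \<alpha>: "\<forall>l\<in>L.
      (\<forall>x\<in>carrier E. \<alpha> x l \<in> L \<and> (\<forall>y\<in>carrier E. \<alpha> (x \<cdot> y) l = \<alpha> x (\<alpha> y l)) \<and>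
        (\<forall>l'\<in>L. \<alpha> x (l \<otimes> l') = \<alpha> x l \<otimes> \<alpha> x l')) \<and>
      (\<forall>b\<in>carrier B. \<alpha> (\<iota> b) l = b \<otimes> l \<otimes> inv b) \<and> \<alpha> t (\<phi> l) = l \<and> (\<forall>y\<in>TV. \<alpha> y l = l)"
    using action_on_L by (elim exE conjE)
  have \<alpha>_L: "\<alpha> x l \<in> L"
    and \<alpha>_mult: "y \<in> carrier E \<Longrightarrow> \<alpha> (x \<cdot> y) l = \<alpha> x (\<alpha> y l)"
    and \<alpha>_hom: "l' \<in> L \<Longrightarrow> \<alpha> x (l \<otimes> l') = \<alpha> x l \<otimes> \<alpha> x l'"
    if "x \<in> carrier E" "l \<in> L" for x y l l'
    using \<alpha> that by blast+
  have \<alpha>_\<iota>: "b \<in> carrier B \<Longrightarrow> \<alpha> (\<iota> b) l = b \<otimes> l \<otimes> inv b"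
    and \<alpha>_t: "\<alpha> t (\<phi> l) = l" and \<alpha>_TV: "y \<in> TV \<Longrightarrow> \<alpha> y l = l" if "l \<in> L" for b l y
    using \<alpha> that by blast+
  have TVE: "y \<in> carrier E" if "y \<in> TV" for y
    using that TV normal_imp_subgroup subgroup.mem_carrier by (fastforce simp: class_normals_def)
  have \<alpha>_one: "\<alpha> \<one>\<^bsub>E\<^esub> l = l" if "l \<in> L" for l
    using \<alpha>_\<iota>[of l \<one>] that by simp
  have L_B: "l \<in> carrier B" if "l \<in> L" for l
    using that by simp
  have L_ops: "l \<otimes> l' \<in> L" "inv l \<in> L" if "l \<in> L" "l' \<in> L" for l l'
    using that subgroup.m_closed[OF L_subgroup] subgroup.m_inv_closed[OF L_subgroup] by blast+
  have \<alpha>_N: "\<forall>l\<in>L. l \<in> N \<longrightarrow> \<alpha> x l \<in> N" if "x \<in> carrier E" for x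
    using that
  proof (induction rule: E_induct)
    case one
    then show ?case using \<alpha>_one by simp
  next
    case (base b x)
    then show ?case
      using \<alpha>_mult[of "\<iota> b" _ x] \<alpha>_\<iota>[OF _ base(1)] \<alpha>_L[OF base(2)] normal.inv_op_closed2[OF N_normal base(1)] by simp
  next
    case (stable x)
    show ?case
    proof (intro ballI impI)
      fix l assume l: "l \<in> L" "l \<in> N"
      have xl: "\<alpha> x l \<in> L" "\<alpha> x l \<in> N"
        using \<alpha>_L[OF stable(1) l(1)] stable(2) l by blast+
      obtain l' where l': "l' \<in> L" "\<alpha> x l = \<phi> l'"
        using \<phi>_L xl(1) by blast
      obtain n where n: "n \<in> N" "n \<in> H" "\<alpha> x l = \<phi> n"
        using N_associated xl by blast
      have "\<phi> l' = \<phi> n"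
        using l'(2) n(3) by simp
      then have "l' = n"
        using inj_onD[OF \<phi>_inj] l'(1) n(2) by blast
      then show "\<alpha> (t \<cdot> x) l \<in> N"
        using \<alpha>_mult[OF t_closed l(1) stable(1)] \<alpha>_t[OF l'(1)] l'(2) n(1) by simp
    qed
  next
    case (stable_inv x)
    show ?case
    proof (intro ballI impI)
      fix l assume l: "l \<in> L" "l \<in> N"
      let ?l = "\<alpha> x l"
      have xl: "?l \<in> L" "?l \<in> N"
        using \<alpha>_L[OF stable_inv(1) l(1)] stable_inv(2) l by blast+
      have \<phi>l: "\<phi> ?l \<in> L" "\<phi> ?l \<in> N"
        using xl \<phi>_L N_associated by blast+
      have "\<alpha> (inv\<^bsub>E\<^esub> t \<cdot> x) l = \<alpha> (inv\<^bsub>E\<^esub> t) (\<alpha> t (\<phi> ?l))"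
        using \<alpha>_mult[of "inv\<^bsub>E\<^esub> t" l x] stable_inv(1) l(1) \<alpha>_t[OF xl(1)] by simp
      also have "\<dots> = \<phi> ?l"
        using \<alpha>_mult[of "inv\<^bsub>E\<^esub> t" "\<phi> ?l" t] \<phi>l(1) \<alpha>_one by simp
      finally show "\<alpha> (inv\<^bsub>E\<^esub> t \<cdot> x) l \<in> N"
        using \<phi>l(2) by simp
    qed
  qed
  have \<alpha>_cong: "N #> \<alpha> x l = N #> \<alpha> x l'"
    if x: "x \<in> carrier E" and l: "l \<in> L" "l' \<in> L" "N #> l = N #> l'" for x l l'
  proof -
    have d: "l \<otimes> inv l' \<in> L" "l \<otimes> inv l' \<in> N"
      using l coset_eqD[OF N_normal _ _ l(3)] L_ops by auto
    have "\<alpha> x l = \<alpha> x (l \<otimes> inv l' \<otimes> l')"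
      using l by (simp add: B.word_simps)
    also have "\<dots> = \<alpha> x (l \<otimes> inv l') \<otimes> \<alpha> x l'"
      using \<alpha>_hom[OF x d(1) l(2)] .
    finally have "\<alpha> x l \<otimes> inv \<alpha> x l' = \<alpha> x (l \<otimes> inv l')"
      using L_B[OF \<alpha>_L[OF x d(1)]] L_B[OF \<alpha>_L[OF x l(2)]] by (simp add: B.word_simps)
    then show ?thesis
      using \<alpha>_N[OF x] d L_B[OF \<alpha>_L[OF x l(1)]] L_B[OF \<alpha>_L[OF x l(2)]] by (intro coset_eqI[OF N_normal]) simp_all
  qed
  define \<Lambda> where "\<Lambda> b = (SOME l. l \<in> L \<and> N #> b = N #> l)" for b
  define T0 where "T0 = T2 \<inter> TV"
  have T0: "T0 \<in> class_normals \<C> E"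
    unfolding T0_def by (rule class_normal_Int[OF E.is_group E_small T2(1) TV])
  have \<Lambda>: "\<Lambda> b \<in> L \<and> N #> b = N #> \<Lambda> b" if "b \<in> carrier B" "\<iota> b \<in> T0" for b
    unfolding \<Lambda>_def by (rule someI_ex) (use T2(2) that in \<open>auto simp: T0_def\<close>)
  have T0_sub: "subgroup T0 E"
    using T0 normal_imp_subgroup by (auto simp: class_normals_def)
  define \<theta> where "\<theta> x b = N #> \<alpha> (inv\<^bsub>E\<^esub> x) (\<Lambda> b)" for x b
  have \<theta>_eqI: "\<theta> x b = N #> \<alpha> (inv\<^bsub>E\<^esub> x) l"
    if "x \<in> carrier E" "b \<in> carrier B" "\<iota> b \<in> T0" "l \<in> L" "N #> b = N #> l" for x b l
    unfolding \<theta>_def using that \<Lambda>[OF that(2,3)] by (intro \<alpha>_cong) auto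
  obtain T where T: "T \<in> class_normals \<C> E" "T \<subseteq> T0"
    and T_\<theta>: "\<And>x b. x \<in> carrier E \<Longrightarrow> b \<in> carrier B \<Longrightarrow> \<iota> b \<in> T \<Longrightarrow> \<theta> x b = N"
  proof (rule induced_function[OF T0, of "B Mod N" \<theta>])
    show "group (B Mod N)" "in_class \<C> (B Mod N)"
      using normal.factorgroup_is_group[OF N_normal] superset_class[OF N_normal] by simp_all
    show "\<theta> x b \<in> carrier (B Mod N)" if "x \<in> carrier E" "b \<in> carrier B" "\<iota> b \<in> T0" for x b
      using that \<Lambda>[OF that(2,3)] L_B[OF \<alpha>_L[of "inv\<^bsub>E\<^esub> x" "\<Lambda> b"]] by (simp add: \<theta>_def carrier_FactGroup)
    show "\<theta> x (a \<otimes> b) = \<theta> x a \<otimes>\<^bsub>B Mod N\<^esub> \<theta> x b"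
      if "x \<in> carrier E" "a \<in> carrier B" "b \<in> carrier B" "\<iota> a \<in> T0" "\<iota> b \<in> T0" for x a b
    proof -
      have la: "\<Lambda> a \<in> L" "N #> a = N #> \<Lambda> a" and lb: "\<Lambda> b \<in> L" "N #> b = N #> \<Lambda> b"
        using \<Lambda> that by blast+
      have "\<iota> (a \<otimes> b) \<in> T0"
        using that subgroup.m_closed[OF T0_sub] by simp
      then have "\<theta> x (a \<otimes> b) = N #> \<alpha> (inv\<^bsub>E\<^esub> x) (\<Lambda> a \<otimes> \<Lambda> b)"
        using that la lb L_ops by (intro \<theta>_eqI coset_mult_cong[OF B.is_group N_normal]) (simp_all add: L_B)
      also have "\<dots> = N #> (\<alpha> (inv\<^bsub>E\<^esub> x) (\<Lambda> a) \<otimes> \<alpha> (inv\<^bsub>E\<^esub> x) (\<Lambda> b))"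
        using \<alpha>_hom la lb that by simp
      finally show ?thesis
        using coset_sum[OF N_normal] L_B[OF \<alpha>_L] la lb that by (simp add: \<theta>_def)
    qed
    show "\<theta> (x \<cdot> y) b = \<theta> x b" if x: "x \<in> carrier E" and y: "y \<in> T0" and b: "b \<in> carrier B" "\<iota> b \<in> T0" for x y b
    proof -
      have yE: "y \<in> carrier E" and "inv\<^bsub>E\<^esub> y \<in> TV"
        using y subgroup.m_inv_closed[OF T0_sub y] TVE by (auto simp: T0_def)
      then have "\<alpha> (inv\<^bsub>E\<^esub> (x \<cdot> y)) l = \<alpha> (inv\<^bsub>E\<^esub> x) l" if "l \<in> L" for l
        using x that \<alpha>_mult[of "inv\<^bsub>E\<^esub> y" l "inv\<^bsub>E\<^esub> x"] \<alpha>_TV \<alpha>_L by (simp add: E.inv_mult_group)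
      then show ?thesis
        using \<Lambda>[OF b] by (simp add: \<theta>_def)
    qed
    show "\<theta> (\<iota> b \<cdot> x) (b \<otimes> a \<otimes> inv b) = \<theta> x a"
      if x: "x \<in> carrier E" and b: "b \<in> carrier B" and a: "a \<in> carrier B" "\<iota> a \<in> T0" for x b a
    proof -
      have la: "\<Lambda> a \<in> L" "N #> a = N #> \<Lambda> a"
        using \<Lambda> a by blast+
      have "\<iota> b \<cdot> \<iota> a \<cdot> inv\<^bsub>E\<^esub> \<iota> b \<in> T0"
        using T0 normal.inv_op_closed2 a b by (fastforce simp: class_normals_def)
      moreover have bl: "b \<otimes> \<Lambda> a \<otimes> inv b \<in> L"
        using normal.inv_op_closed2[OF L_normal b la(1)] .
      ultimately have "\<theta> (\<iota> b \<cdot> x) (b \<otimes> a \<otimes> inv b) = N #> \<alpha> (inv\<^bsub>E\<^esub> (\<iota> b \<cdot> x)) (b \<otimes> \<Lambda> a \<otimes> inv b)"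
        using x a b la by (intro \<theta>_eqI coset_conj_cong[OF B.is_group N_normal]) simp_all
      also have "\<alpha> (inv\<^bsub>E\<^esub> (\<iota> b \<cdot> x)) (b \<otimes> \<Lambda> a \<otimes> inv b) = \<alpha> (inv\<^bsub>E\<^esub> x \<cdot> \<iota> (inv b)) (b \<otimes> \<Lambda> a \<otimes> inv b)"
        using x b by (simp add: E.inv_mult_group)
      also have "\<dots> = \<alpha> (inv\<^bsub>E\<^esub> x) (\<Lambda> a)"
        using \<alpha>_mult[of "inv\<^bsub>E\<^esub> x" _ "\<iota> (inv b)"] \<alpha>_\<iota>[of _ "inv b"] x b bl la L_B by (simp add: B.word_simps)
      finally show ?thesis
        by (simp add: \<theta>_def)
    qed
    show "\<theta> (t \<cdot> x) h = \<theta> x (\<phi> h)" if x: "x \<in> carrier E" and h: "h \<in> H" "\<iota> h \<in> T0" for x h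
    proof -
      have l: "\<Lambda> h \<in> L" "N #> h = N #> \<Lambda> h"
        using \<Lambda>[OF H_carrier] h by blast+
      have "h \<otimes> inv \<Lambda> h \<in> N" "h \<otimes> inv \<Lambda> h \<in> H"
        using l h coset_eqD[OF N_normal _ _ l(2)] H_closed by simp_all
      then have "\<phi> (h \<otimes> inv \<Lambda> h) \<in> N"
        using N_associated by blast
      then have "N #> \<phi> h = N #> \<phi> (\<Lambda> h)"
        using h(1) l(1) subgroup.m_inv_closed[OF H_subgroup] by (intro coset_eqI[OF N_normal]) simp_all
      moreover have "\<phi> (\<Lambda> h) \<in> L"
        using l(1) \<phi>_L by blast
      moreover have "\<iota> (\<phi> h) \<in> T0"
      proof -
        have "\<iota> (\<phi> h) = inv\<^bsub>E\<^esub> t \<cdot> \<iota> h \<cdot> t"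
          using t_relation[OF h(1)] h(1) by (simp add: E.m_assoc E.inv_mult_cancel)
        then show ?thesis
          using T0 h normal.inv_op_closed1[of T0 E t "\<iota> h"] by (auto simp: class_normals_def)
      qed
      ultimately have "\<theta> x (\<phi> h) = N #> \<alpha> (inv\<^bsub>E\<^esub> x) (\<phi> (\<Lambda> h))"
        using x h by (intro \<theta>_eqI) simp_all
      also have "\<alpha> (inv\<^bsub>E\<^esub> x) (\<phi> (\<Lambda> h)) = \<alpha> (inv\<^bsub>E\<^esub> (t \<cdot> x) \<cdot> t) (\<phi> (\<Lambda> h))"
        using x by (simp add: E.word_simps)
      also have "\<dots> = \<alpha> (inv\<^bsub>E\<^esub> (t \<cdot> x)) (\<Lambda> h)"
        using \<alpha>_mult[of "inv\<^bsub>E\<^esub> (t \<cdot> x)" "\<phi> (\<Lambda> h)" t] \<alpha>_t[OF l(1)] x \<open>\<phi> (\<Lambda> h) \<in> L\<close> by simp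
      finally show ?thesis
        by (simp add: \<theta>_def)
    qed
  qed (use that in simp)
  show ?thesis
  proof (intro bexI[OF _ T(1)] ballI impI)
    fix b assume b: "b \<in> carrier B" "\<iota> b \<in> T"
    have l: "\<Lambda> b \<in> L" "N #> b = N #> \<Lambda> b"
      using \<Lambda>[OF b(1)] b(2) T(2) by blast+
    have "N #> b = N"
      using T_\<theta>[of "\<one>\<^bsub>E\<^esub>" b] b \<alpha>_one[OF l(1)] l(2) by (simp add: \<theta>_def)
    then show "b \<in> N"
      using coset_self_iff[OF N_normal b(1)] by simp
  qed
qed

end


section \<open>Separating reduced words\<close>

context normal_hnn
begin

text \<open>
  The word \<open>t\<^sup>\<epsilon> c \<dots>\<close> whose exponents are \<open>1\<close> for \<open>True\<close> and \<open>-1\<close> for \<open>False\<close>.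
\<close>

primrec path :: "(bool \<times> 'b) list \<Rightarrow> 'b hnn_letter list set" where
  "path [] = \<one>\<^bsub>E\<^esub>"
| "path (a # ps) = (if fst a then t else inv\<^bsub>E\<^esub> t) \<cdot> (\<iota> (snd a) \<cdot> path ps)"

text \<open>
  The sets take the place of \<open>H\<close> in subwords \<open>t\<^sup>-\<^sup>1 c t\<close> and of \<open>K\<close> in subwords \<open>t c t\<^sup>-\<^sup>1\<close>. They are
  parameters, because in a quotient of \<open>E\<close> both become larger.
\<close>

primrec reduced :: "'b set \<Rightarrow> 'b set \<Rightarrow> (bool \<times> 'b) list \<Rightarrow> bool" where
  "reduced H' K' [] = True"
| "reduced H' K' (a # ps) = (reduced H' K' ps \<and>
    (ps \<noteq> [] \<longrightarrow> fst a \<noteq> fst (hd ps) \<longrightarrow> snd a \<notin> (if fst a then K' else H')))"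

lemma path_closed [simp]: "snd ` set ps \<subseteq> carrier B \<Longrightarrow> path ps \<in> carrier E"
  by (induction ps) auto

lemma reduced_normal_form:
  assumes "x \<in> carrier E"
  shows "\<exists>b ps. b \<in> carrier B \<and> snd ` set ps \<subseteq> carrier B \<and> reduced H K ps \<and> x = \<iota> b \<cdot> path ps"
  using assms
proof (induction rule: E_induct)
  case one
  show ?case
    by (intro exI[of _ \<one>] exI[of _ "[]"]) simp
next
  case (base c x)
  then obtain b ps where b: "b \<in> carrier B" "snd ` set ps \<subseteq> carrier B" "reduced H K ps" "x = \<iota> b \<cdot> path ps"
    by blast
  have "\<iota> c \<cdot> x = \<iota> (c \<otimes> b) \<cdot> path ps"
    using base(1) b by (simp add: E.m_assoc)
  then show ?case
    using base(1) b by (intro exI[of _ "c \<otimes> b"] exI[of _ ps]) simp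
next
  case (stable x)
  then obtain b ps where b: "b \<in> carrier B" "snd ` set ps \<subseteq> carrier B" "reduced H K ps" "x = \<iota> b \<cdot> path ps"
    by blast
  show ?case
  proof (cases "reduced H K ((True, b) # ps)")
    case True
    then show ?thesis
      using b by (intro exI[of _ \<one>] exI[of _ "(True, b) # ps"]) simp
  next
    case False
    then obtain c qs where ps: "ps = (False, c) # qs" and "b \<in> K"
      using b(3) by (cases ps) (auto split: if_splits)
    then obtain h where h: "h \<in> H" "b = \<phi> h"
      using \<phi>_image by blast
    have c: "c \<in> carrier B" and qs: "snd ` set qs \<subseteq> carrier B"
      using b(2) ps by auto
    have "t \<cdot> x = \<iota> (h \<otimes> c) \<cdot> path qs"
      using h c qs t_\<iota>_\<phi>[OF h(1), of "inv\<^bsub>E\<^esub> t \<cdot> (\<iota> c \<cdot> path qs)"]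
      by (simp add: b(4) ps E.word_simps)
    then show ?thesis
      using h c qs b(3) ps by (intro exI[of _ "h \<otimes> c"] exI[of _ qs]) simp
  qed
next
  case (stable_inv x)
  then obtain b ps where b: "b \<in> carrier B" "snd ` set ps \<subseteq> carrier B" "reduced H K ps" "x = \<iota> b \<cdot> path ps"
    by blast
  show ?case
  proof (cases "reduced H K ((False, b) # ps)")
    case True
    then show ?thesis
      using b by (intro exI[of _ \<one>] exI[of _ "(False, b) # ps"]) simp
  next
    case False
    then obtain c qs where ps: "ps = (True, c) # qs" and h: "b \<in> H"
      using b(3) by (cases ps) (auto split: if_splits)
    have c: "c \<in> carrier B" and qs: "snd ` set qs \<subseteq> carrier B"
      using b(2) ps by auto
    have "inv\<^bsub>E\<^esub> t \<cdot> x = \<iota> (\<phi> b \<otimes> c) \<cdot> path qs"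
      using h c qs t_\<iota>_\<phi>[OF h, of "\<iota> c \<cdot> path qs", symmetric]
      by (simp add: b(4) ps E.word_simps)
    then show ?thesis
      using h c qs b(3) ps by (intro exI[of _ "\<phi> b \<otimes> c"] exI[of _ qs]) simp
  qed
qed

text \<open>
  The double cosets of \<open>\<iota> B\<close> and \<open>T\<close> are the vertices of a graph, the quotient by \<open>T\<close> of the Bass-Serre tree.
  Its edges are the double cosets of \<open>\<iota> K\<close> and \<open>T\<close>; the edge of \<open>x\<close> joins the vertex of \<open>x\<close> to
  that of \<open>t \<cdot> x\<close>. The suffixes of a word trace a path in this graph.
\<close>

definition same_vertex where
  "same_vertex T x y \<longleftrightarrow> (\<exists>b\<in>carrier B. \<exists>z\<in>T. x = \<iota> b \<cdot> y \<cdot> z)"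

lemma same_vertex_\<iota>:
  assumes "T \<lhd> E" "b \<in> carrier B" "x \<in> carrier E" shows "same_vertex T (\<iota> b \<cdot> x) x"
  using assms subgroup.one_closed[OF normal_imp_subgroup[OF assms(1)]] unfolding same_vertex_def
  by (intro bexI[of _ b] bexI[of _ "\<one>\<^bsub>E\<^esub>"]) simp_all

lemma same_vertex_sym:
  assumes T: "T \<lhd> E" and "same_vertex T x y" "y \<in> carrier E" shows "same_vertex T y x"
proof -
  obtain b z where bz: "b \<in> carrier B" "z \<in> T" "x = \<iota> b \<cdot> y \<cdot> z"
    using assms(2) by (auto simp: same_vertex_def)
  have "z \<in> carrier E" using bz subgroup.mem_carrier[OF normal_imp_subgroup[OF T]] by blast
  then have "y = \<iota> (inv b) \<cdot> x \<cdot> inv\<^bsub>E\<^esub> z"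
    using bz assms(3) by (simp add: E.word_simps)
  then show ?thesis
    using bz subgroup.m_inv_closed[OF normal_imp_subgroup[OF T]] unfolding same_vertex_def
    by (intro bexI[of _ "inv b"] bexI[of _ "inv\<^bsub>E\<^esub> z"]) simp_all
qed

lemma same_vertex_trans:
  assumes T: "T \<lhd> E" and "same_vertex T x y" "same_vertex T y z" "z \<in> carrier E" shows "same_vertex T x z"
proof -
  obtain b u where b: "b \<in> carrier B" "u \<in> T" "x = \<iota> b \<cdot> y \<cdot> u"
    using assms(2) by (auto simp: same_vertex_def)
  obtain c v where c: "c \<in> carrier B" "v \<in> T" "y = \<iota> c \<cdot> z \<cdot> v"
    using assms(3) by (auto simp: same_vertex_def)
  have uv: "u \<in> carrier E" "v \<in> carrier E"
    using b c subgroup.mem_carrier[OF normal_imp_subgroup[OF T]] by blast+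
  have "x = \<iota> (b \<otimes> c) \<cdot> z \<cdot> (v \<cdot> u)"
    using b c uv assms(4) by (simp add: E.m_assoc)
  then show ?thesis
    using b c subgroup.m_closed[OF normal_imp_subgroup[OF T]] unfolding same_vertex_def
    by (intro bexI[of _ "b \<otimes> c"] bexI[of _ "v \<cdot> u"]) simp_all
qed

lemma same_vertex_mono: "same_vertex T x y \<Longrightarrow> T \<subseteq> T' \<Longrightarrow> same_vertex T' x y"
  by (auto simp: same_vertex_def)

definition separated where
  "separated T ps \<longleftrightarrow> (\<forall>j\<le>length ps. \<forall>i<j. \<not> same_vertex T (path (drop i ps)) (path (drop j ps)))"

lemma separated_Cons:
  "separated T (a # ps) \<longleftrightarrow> separated T ps \<and> (\<forall>j\<le>length ps. \<not> same_vertex T (path (a # ps)) (path (drop j ps)))"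
proof -
  have "(\<forall>j\<le>Suc n. \<forall>i<j. R i j) \<longleftrightarrow> (\<forall>j\<le>n. \<forall>i<j. R (Suc i) (Suc j)) \<and> (\<forall>j\<le>n. R 0 (Suc j))"
    for R :: "nat \<Rightarrow> nat \<Rightarrow> bool" and n
  proof
    assume "(\<forall>j\<le>n. \<forall>i<j. R (Suc i) (Suc j)) \<and> (\<forall>j\<le>n. R 0 (Suc j))"
    moreover have "\<exists>j'. j = Suc j'" if "i < j" for i j :: nat
      using that by (cases j) simp_all
    ultimately show "\<forall>j\<le>Suc n. \<forall>i<j. R i j"
      by (metis Suc_le_mono Suc_less_eq not0_implies_Suc)
  qed simp
  then show ?thesis
    by (simp add: separated_def)
qed

lemma separated_mono: "separated T' ps \<Longrightarrow> T \<subseteq> T' \<Longrightarrow> separated T ps"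
  using same_vertex_mono by (fastforce simp: separated_def)

lemma separated_not_base:
  assumes "T \<lhd> E" "separated T ps" "ps \<noteq> []" "snd ` set ps \<subseteq> carrier B" "b \<in> carrier B"
  shows "\<iota> b \<cdot> path ps \<notin> T"
proof
  assume "\<iota> b \<cdot> path ps \<in> T"
  moreover have "path ps = \<iota> (inv b) \<cdot> \<one>\<^bsub>E\<^esub> \<cdot> (\<iota> b \<cdot> path ps)"
    using assms by (simp add: E.word_simps)
  ultimately have "same_vertex T (path ps) \<one>\<^bsub>E\<^esub>"
    using assms(5) unfolding same_vertex_def by (meson B.inv_closed)
  moreover have "\<not> same_vertex T (path (drop 0 ps)) (path (drop (length ps) ps))"
    using assms(2,3) unfolding separated_def by blast
  ultimately show False by simp
qed

end

context class_hnn
begin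

text \<open>
  A reduced word traces a path without backtracking, and the vertices of the path are made distinct one by one. Suppose
  that they are distinct for \<open>qs\<close> and that the new edge leads back to the vertex of the
  suffix \<open>drop j qs\<close>. The path from there to the new end is then a simple circuit, so it contains the
  new edge only once. Give this edge a non-trivial label in a member \<open>X\<close> of the class and all
  other edges the label \<open>1\<close>. The product of labels along paths is a crossed function, which takes different
  values at the two ends of the circuit. Hence the circuit opens up in the next quotient.
\<close>

lemma separating_class_normal:
  assumes "T0 \<in> class_normals \<C> E" "snd ` set ps \<subseteq> carrier B"
    and "reduced {b. \<exists>h\<in>H. \<iota> (b \<otimes> inv h) \<in> T0} {b. \<exists>k\<in>K. \<iota> (b \<otimes> inv k) \<in> T0} ps"
  shows "\<exists>T\<in>class_normals \<C> E. T \<subseteq> T0 \<and> separated T ps"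
  using assms(2,3)
proof (induction ps)
  case Nil
  then show ?case
    using assms(1) by (auto simp: separated_def)
next
  case (Cons a qs)
  obtain e c where a: "a = (e, c)" by (cases a)
  have c [simp]: "c \<in> carrier B" and qs: "snd ` set qs \<subseteq> carrier B"
    using Cons.prems(1) a by auto
  obtain T1 where T1: "T1 \<in> class_normals \<C> E" "T1 \<subseteq> T0" "separated T1 qs"
    using Cons.IH[OF qs] Cons.prems(2) by auto
  have T1n: "T1 \<lhd> E" using T1(1) by (simp add: class_normals_def)
  interpret T1: normal T1 E by (rule T1n)
  have T1E [simp]: "y \<in> carrier E" if "y \<in> T1" for y using that T1.mem_carrier by blast
  show ?case
  proof (cases "\<exists>j\<le>length qs. same_vertex T1 (path (a # qs)) (path (drop j qs))")
    case False
    then have "separated T1 (a # qs)"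
      using T1(3) by (auto simp: separated_Cons)
    then show ?thesis
      using T1 by blast
  next
    case True
    then obtain j where j: "j \<le> length qs" and meet: "same_vertex T1 (path (a # qs)) (path (drop j qs))"
      by blast
    have drop_B: "snd ` set (drop i qs) \<subseteq> carrier B" for i
      using qs set_drop_subset by fastforce
    have pE [simp]: "path (drop i qs) \<in> carrier E" "path qs \<in> carrier E" for i
      using drop_B[of i] qs by simp_all
    have aE [simp]: "path (a # qs) \<in> carrier E"
      using qs a by simp
    have distinct: "i = i'" if "same_vertex T1 (path (drop i qs)) (path (drop i' qs))" "i \<le> length qs" "i' \<le> length qs" for i i'
      using that T1(3) same_vertex_sym[OF T1n that(1)] unfolding separated_def by (metis linorder_neqE_nat pE(1))
    obtain X \<gamma> where X: "\<C> X" "group X" and \<gamma>: "\<gamma> \<in> carrier X" "\<gamma> \<noteq> \<one>\<^bsub>X\<^esub>"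
      by (rule nontrivial_member)
    interpret X: group X by fact
    \<comment> \<open>A representative of the edge traversed by the letter \<open>(e, c)\<close> on the way from \<open>x\<close>.\<close>
    define edge where "edge e c x = (if e then \<iota> c \<cdot> x else inv\<^bsub>E\<^esub> t \<cdot> (\<iota> c \<cdot> x))" for e c x
    define w where "w = edge e c (path qs)"
    have wE [simp]: "w \<in> carrier E"
      by (simp add: w_def edge_def)
    define W where "W = {\<iota> k \<cdot> w \<cdot> y | k y. k \<in> K \<and> y \<in> T1}"
    define f where "f x = (if x \<in> W then \<gamma> else \<one>\<^bsub>X\<^esub>)" for x
    have W_sub: "\<iota> k \<cdot> x \<cdot> y \<in> W" if x: "x \<in> W" and k: "k \<in> K" and y: "y \<in> T1" for k x y
    proof -
      obtain k' y' where "k' \<in> K" "y' \<in> T1" "x = \<iota> k' \<cdot> w \<cdot> y'"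
        using x by (auto simp: W_def)
      moreover from this have "\<iota> k \<cdot> x \<cdot> y = \<iota> (k \<otimes> k') \<cdot> w \<cdot> (y' \<cdot> y)"
        using k y by (simp add: E.m_assoc)
      ultimately show ?thesis
        using k y subgroup.m_closed[OF K_subgroup] unfolding W_def by blast
    qed
    have W_iff: "\<iota> k \<cdot> x \<cdot> y \<in> W \<longleftrightarrow> x \<in> W" if x: "x \<in> carrier E" and k: "k \<in> K" and y: "y \<in> T1" for k x y
    proof
      assume "\<iota> k \<cdot> x \<cdot> y \<in> W"
      then have "\<iota> (inv k) \<cdot> (\<iota> k \<cdot> x \<cdot> y) \<cdot> inv\<^bsub>E\<^esub> y \<in> W"
        using W_sub k y subgroup.m_inv_closed[OF K_subgroup] by blast
      then show "x \<in> W"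
        using x k y by (simp add: E.word_simps)
    qed (use W_sub that in blast)
    have f_T1: "f (x \<cdot> y) = f x" if "x \<in> carrier E" "y \<in> T1" for x y
      using W_iff[OF that(1) subgroup.one_closed[OF K_subgroup] that(2)] that by (simp add: f_def)
    have f_K: "f (\<iota> k \<cdot> x) = f x" if "x \<in> carrier E" "k \<in> K" for x k
      using W_iff[OF that T1.one_closed] that by (simp add: f_def)
    have "\<exists>T \<Phi>. T \<in> class_normals \<C> E \<and> T \<subseteq> T1 \<and> \<Phi> \<one>\<^bsub>E\<^esub> = \<one>\<^bsub>X\<^esub> \<and> (\<forall>x\<in>carrier E. \<Phi> x \<in> carrier X \<and>
        (\<forall>b\<in>carrier B. \<Phi> (\<iota> b \<cdot> x) = \<one>\<^bsub>X\<^esub> \<otimes>\<^bsub>X\<^esub> \<Phi> x) \<and> \<Phi> (t \<cdot> x) = f x \<otimes>\<^bsub>X\<^esub> \<Phi> x \<and>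
        (\<forall>y\<in>T. \<Phi> (x \<cdot> y) = \<Phi> x))"
      by (rule crossed_function[OF T1(1) X(2) in_class_self[OF X(1)]])
        (use \<gamma>(1) f_T1 f_K in \<open>simp_all add: f_def\<close>)
    then obtain T \<Phi> where T: "T \<in> class_normals \<C> E" "T \<subseteq> T1" and \<Phi>: "\<forall>x\<in>carrier E. \<Phi> x \<in> carrier X \<and>
        (\<forall>b\<in>carrier B. \<Phi> (\<iota> b \<cdot> x) = \<one>\<^bsub>X\<^esub> \<otimes>\<^bsub>X\<^esub> \<Phi> x) \<and> \<Phi> (t \<cdot> x) = f x \<otimes>\<^bsub>X\<^esub> \<Phi> x \<and>
        (\<forall>y\<in>T. \<Phi> (x \<cdot> y) = \<Phi> x)"
      by blast
    have \<Phi>X [simp]: "\<Phi> x \<in> carrier X" and \<Phi>_\<iota>: "b \<in> carrier B \<Longrightarrow> \<Phi> (\<iota> b \<cdot> x) = \<Phi> x"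
      and \<Phi>_t: "\<Phi> (t \<cdot> x) = f x \<otimes>\<^bsub>X\<^esub> \<Phi> x" and \<Phi>_T: "y \<in> T \<Longrightarrow> \<Phi> (x \<cdot> y) = \<Phi> x"
      if "x \<in> carrier E" for x b y
      using \<Phi> that by auto
    have w_source: "same_vertex T1 (if e then path qs else path (a # qs)) w"
      and w_target: "same_vertex T1 (if e then path (a # qs) else path qs) (t \<cdot> w)"
    proof -
      have eq: "w = (if e then \<iota> c \<cdot> path qs else path (a # qs))"
        "t \<cdot> w = (if e then path (a # qs) else \<iota> c \<cdot> path qs)"
        using a by (auto simp: w_def edge_def E.inv_mult_cancel)
      have refl: "same_vertex T1 x x" if "x \<in> carrier E" for x
        using same_vertex_\<iota>[OF T1n B.one_closed that] that by simp
      have "same_vertex T1 (path qs) (\<iota> c \<cdot> path qs)"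
        by (rule same_vertex_sym[OF T1n same_vertex_\<iota>[OF T1n]]) simp_all
      then show "same_vertex T1 (if e then path qs else path (a # qs)) w"
        unfolding eq(1) using refl[OF aE] by simp
      show "same_vertex T1 (if e then path (a # qs) else path qs) (t \<cdot> w)"
        unfolding eq(2) using refl[OF aE] \<open>same_vertex T1 (path qs) (\<iota> c \<cdot> path qs)\<close> by simp
    qed
    \<comment> \<open>The edges of \<open>qs\<close> between the two ends have label \<open>1\<close>.\<close>
    have level: "\<Phi> (path (drop i qs)) = \<Phi> (path (drop (Suc i) qs))" if i: "i < j" for i
    proof -
      obtain e' c' where nth: "drop i qs = (e', c') # drop (Suc i) qs"
        using i j by (metis Cons_nth_drop_Suc order_less_le_trans surj_pair)
      then have c': "c' \<in> carrier B"
        using drop_B[of i] by simp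
      let ?x = "path (drop (Suc i) qs)"
      define v where "v = edge e' c' ?x"
      have vE [simp]: "v \<in> carrier E"
        using c' by (simp add: v_def edge_def)
      have v_eq: "v = (if e' then \<iota> c' \<cdot> ?x else path (drop i qs))"
        "t \<cdot> v = (if e' then path (drop i qs) else \<iota> c' \<cdot> ?x)"
        using c' nth by (auto simp: v_def edge_def E.inv_mult_cancel)
      have "v \<notin> W"
      proof
        assume "v \<in> W"
        then obtain k y where k: "k \<in> K" "y \<in> T1" "v = \<iota> k \<cdot> w \<cdot> y"
          by (auto simp: W_def)
        obtain h where h: "h \<in> H" "k = \<phi> h"
          using k(1) \<phi>_image by blast
        have tv: "t \<cdot> v = \<iota> h \<cdot> (t \<cdot> w) \<cdot> y"
          using h k t_\<iota>_\<phi>[OF h(1), of "w \<cdot> y"] by (simp add: E.m_assoc)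
        have vw: "same_vertex T1 v w" "same_vertex T1 (t \<cdot> v) (t \<cdot> w)"
          using k h tv H_carrier K_carrier unfolding same_vertex_def by blast+
        have x_\<iota>: "same_vertex T1 ?x (\<iota> c' \<cdot> ?x)"
          by (rule same_vertex_sym[OF T1n same_vertex_\<iota>[OF T1n c']]) simp_all
        have meet_at: "same_vertex T1 x z" if "same_vertex T1 x y" "same_vertex T1 z y" "y \<in> carrier E" "z \<in> carrier E" for x y z
          using same_vertex_trans[OF T1n that(1) same_vertex_sym[OF T1n that(2,3)] that(4)] .
        have twE: "t \<cdot> w \<in> carrier E" by simp
        note x_v = same_vertex_trans[OF T1n x_\<iota>]
        show False
        proof (cases "e = e'")
          case True
          \<comment> \<open>Traversing the new edge in its direction would repeat its source.\<close>
          have "same_vertex T1 ?x (path qs)"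
          proof (cases e)
            case True
            then have "same_vertex T1 ?x w" "same_vertex T1 (path qs) w"
              using \<open>e = e'\<close> x_v[of w] vw(1) v_eq w_source by simp_all
            then show ?thesis
              by (rule meet_at) simp_all
          next
            case False
            then have "same_vertex T1 ?x (t \<cdot> w)" "same_vertex T1 (path qs) (t \<cdot> w)"
              using \<open>e = e'\<close> x_v[of "t \<cdot> w"] vw(2) v_eq w_target by simp_all
            then show ?thesis
              by (rule meet_at) simp_all
          qed
          then show False
            using distinct[of "Suc i" 0] i j by simp
        next
          case False
          \<comment> \<open>Traversing it in the opposite direction is only possible in the step just before, as backtracking.\<close>
          have "same_vertex T1 ?x (path (a # qs)) \<and> same_vertex T1 (path (drop i qs)) (path qs)"
          proof (cases e)
            case True
            then have "same_vertex T1 ?x (t \<cdot> w)" "same_vertex T1 (path (a # qs)) (t \<cdot> w)"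
              "same_vertex T1 (path (drop i qs)) w" "same_vertex T1 (path qs) w"
              using False x_v[of "t \<cdot> w"] vw v_eq w_source w_target by (simp_all del: path.simps)
            then show ?thesis
              using meet_at[OF _ _ twE aE] meet_at[OF _ _ wE pE(2)] by blast
          next
            case e: False
            then have "same_vertex T1 ?x w" "same_vertex T1 (path (a # qs)) w"
              "same_vertex T1 (path (drop i qs)) (t \<cdot> w)" "same_vertex T1 (path qs) (t \<cdot> w)"
              using False x_v[of w] vw v_eq w_source w_target by (simp_all del: path.simps)
            then show ?thesis
              using meet_at[OF _ _ wE aE] meet_at[OF _ _ twE pE(2)] by blast
          qed
          then have "same_vertex T1 ?x (path (drop j qs))" "same_vertex T1 (path (drop i qs)) (path (drop 0 qs))"
            using same_vertex_trans[OF T1n _ meet] by simp_all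
          then have "Suc i = j" "i = 0"
            using distinct[of "Suc i" j] distinct[of i 0] i j by simp_all
          then have nth0: "qs = (e', c') # drop (Suc 0) qs"
            using nth by simp
          then have "qs \<noteq> []" "fst (hd qs) = e'"
            by (metis list.distinct(1), metis fst_conv list.sel(1))
          then have not_in: "c \<notin> (if e then {b. \<exists>k\<in>K. \<iota> (b \<otimes> inv k) \<in> T0} else {b. \<exists>h\<in>H. \<iota> (b \<otimes> inv h) \<in> T0})"
            using Cons.prems(2) a False by simp
          have "path qs = (if e then v else t \<cdot> v)"
            using v_eq \<open>i = 0\<close> False by (cases e; cases e') simp_all
          moreover have "\<iota> c \<cdot> path qs = (if e then w else t \<cdot> w)"
            by (simp add: w_def edge_def E.inv_mult_cancel)
          moreover define g where "g = (if e then k else h)"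
          ultimately have pq: "path qs = \<iota> g \<cdot> (\<iota> c \<cdot> path qs) \<cdot> y"
            using k(3) tv by (cases e) simp_all
          have g: "g \<in> carrier B" using h k by (simp add: g_def)
          have yE: "y \<in> carrier E" using k by simp
          have "\<iota> (c \<otimes> inv (inv g)) = \<iota> (inv g) \<cdot> (\<iota> g \<cdot> (\<iota> c \<cdot> path qs) \<cdot> y) \<cdot> inv\<^bsub>E\<^esub> y \<cdot> inv\<^bsub>E\<^esub> path qs \<cdot> \<iota> g"
            using g yE by (simp add: E.word_simps)
          also have "\<dots> = (inv\<^bsub>E\<^esub> \<iota> g \<cdot> path qs) \<cdot> inv\<^bsub>E\<^esub> y \<cdot> inv\<^bsub>E\<^esub> (inv\<^bsub>E\<^esub> \<iota> g \<cdot> path qs)"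
            unfolding pq[symmetric] using g yE by (simp add: E.word_simps)
          finally have "\<iota> (c \<otimes> inv (inv g)) \<in> T0"
            using T1.inv_op_closed2[of "inv\<^bsub>E\<^esub> \<iota> g \<cdot> path qs" "inv\<^bsub>E\<^esub> y"] g k(2) T1(2) by auto
          moreover have "inv g \<in> (if e then K else H)"
            using h k subgroup.m_inv_closed[OF K_subgroup] subgroup.m_inv_closed[OF H_subgroup]
            by (simp add: g_def)
          ultimately show False
            using not_in by (auto split: if_splits)
        qed
      qed
      then have fv: "f v = \<one>\<^bsub>X\<^esub>" by (simp add: f_def)
      then have "\<Phi> (t \<cdot> v) = \<Phi> v"
        using \<Phi>_t[OF vE] by simp
      then show ?thesis
        using v_eq \<Phi>_\<iota>[OF pE(1) c'] by (cases e') simp_all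
    qed
    have all: "\<Phi> (path (drop i qs)) = \<Phi> (path (drop j qs))" if "i \<le> j" for i
      using that by (induction rule: inc_induct) (simp_all add: level)
    have "w \<in> W"
      unfolding W_def using subgroup.one_closed[OF K_subgroup] T1.one_closed
      by (intro CollectI exI[of _ \<one>] exI[of _ "\<one>\<^bsub>E\<^esub>"]) simp
    then have tw: "\<Phi> (t \<cdot> w) = \<gamma> \<otimes>\<^bsub>X\<^esub> \<Phi> w"
      using \<Phi>_t[OF wE] by (simp add: f_def)
    have "\<Phi> (path (a # qs)) \<noteq> \<Phi> (path qs)"
    proof (cases e)
      case True
      then have "t \<cdot> w = path (a # qs)" "\<Phi> w = \<Phi> (path qs)"
        using a by (simp_all add: w_def edge_def \<Phi>_\<iota>)
      then show ?thesis
        using tw \<gamma> by (simp del: path.simps)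
    next
      case False
      then have "w = path (a # qs)" "\<Phi> (t \<cdot> w) = \<Phi> (path qs)"
        using a by (simp_all add: w_def edge_def \<Phi>_\<iota> E.inv_mult_cancel)
      then show ?thesis
        using tw \<gamma> aE by (metis X.r_cancel_one' \<Phi>X)
    qed
    then have different: "\<Phi> (path (a # qs)) \<noteq> \<Phi> (path (drop j qs))"
      using all[of 0] by simp
    have "\<not> same_vertex T (path (a # qs)) (path (drop i qs))" if i: "i \<le> length qs" for i
    proof
      assume sv: "same_vertex T (path (a # qs)) (path (drop i qs))"
      then have "same_vertex T1 (path (drop i qs)) (path (a # qs))"
        using same_vertex_mono[OF _ T(2)] same_vertex_sym[OF T1n] pE by blast
      then have "same_vertex T1 (path (drop i qs)) (path (drop j qs))"
        using same_vertex_trans[OF T1n _ meet] by simp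
      then have "i = j"
        using distinct i j by blast
      with sv obtain b z where bz: "b \<in> carrier B" "z \<in> T" "path (a # qs) = \<iota> b \<cdot> path (drop j qs) \<cdot> z"
        by (auto simp: same_vertex_def)
      have "\<Phi> (path (a # qs)) = \<Phi> (path (drop j qs))"
        unfolding bz(3) using bz(1,2) by (simp add: \<Phi>_T \<Phi>_\<iota>)
      then show False
        using different by simp
    qed
    then have "separated T (a # qs)"
      using separated_mono[OF T1(3) T(2)] by (simp add: separated_Cons del: path.simps)
    then show ?thesis
      using T T1(2) by blast
  qed
qed

end


section \<open>Semidirect products\<close>

definition semidirect :: "('a, 'm) monoid_scheme \<Rightarrow> ('a \<Rightarrow> 'a, 'n) monoid_scheme \<Rightarrow> ('a \<times> ('a \<Rightarrow> 'a)) monoid" where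
  "semidirect G A =
     \<lparr>carrier = carrier G \<times> carrier A,
      mult = (\<lambda>(x, f) (y, g). (x \<otimes>\<^bsub>G\<^esub> f y, f \<otimes>\<^bsub>A\<^esub> g)),
      one = (\<one>\<^bsub>G\<^esub>, \<one>\<^bsub>A\<^esub>)\<rparr>"

lemma group_semidirect:
  assumes "group G" "group A"
    and closed: "\<And>f x. f \<in> carrier A \<Longrightarrow> x \<in> carrier G \<Longrightarrow> f x \<in> carrier G"
    and hom: "\<And>f x y. f \<in> carrier A \<Longrightarrow> x \<in> carrier G \<Longrightarrow> y \<in> carrier G \<Longrightarrow> f (x \<otimes>\<^bsub>G\<^esub> y) = f x \<otimes>\<^bsub>G\<^esub> f y"
    and comp: "\<And>f g x. f \<in> carrier A \<Longrightarrow> g \<in> carrier A \<Longrightarrow> x \<in> carrier G \<Longrightarrow> (f \<otimes>\<^bsub>A\<^esub> g) x = f (g x)"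
    and one: "\<And>x. x \<in> carrier G \<Longrightarrow> \<one>\<^bsub>A\<^esub> x = x"
  shows "group (semidirect G A)"
proof -
  interpret G: group G by fact
  interpret A: group A by fact
  show ?thesis
  proof (rule groupI)
    fix x assume "x \<in> carrier (semidirect G A)"
    then obtain a f where x: "x = (a, f)" "a \<in> carrier G" "f \<in> carrier A"
      by (auto simp: semidirect_def)
    let ?g = "inv\<^bsub>A\<^esub> f"
    have "?g (inv\<^bsub>G\<^esub> a) \<otimes>\<^bsub>G\<^esub> ?g a = ?g \<one>\<^bsub>G\<^esub>"
      using x hom[of ?g "inv\<^bsub>G\<^esub> a" a] by simp
    moreover have "?g \<one>\<^bsub>G\<^esub> = \<one>\<^bsub>G\<^esub>"
      using hom[of ?g "\<one>\<^bsub>G\<^esub>" "\<one>\<^bsub>G\<^esub>"] closed[of ?g "\<one>\<^bsub>G\<^esub>"] x by (simp add: G.l_cancel_one')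
    ultimately have "(?g (inv\<^bsub>G\<^esub> a), ?g) \<otimes>\<^bsub>semidirect G A\<^esub> x = \<one>\<^bsub>semidirect G A\<^esub>"
      using x by (simp add: semidirect_def)
    moreover have "(?g (inv\<^bsub>G\<^esub> a), ?g) \<in> carrier (semidirect G A)"
      using x closed by (simp add: semidirect_def)
    ultimately show "\<exists>y\<in>carrier (semidirect G A). y \<otimes>\<^bsub>semidirect G A\<^esub> x = \<one>\<^bsub>semidirect G A\<^esub>"
      by blast
  qed (auto simp: semidirect_def closed hom comp one G.m_assoc A.m_assoc)
qed


section \<open>Compatible normal subgroups\<close>

context twisted_hnn
begin

lemma \<phi>_image_normal:
  assumes R: "R \<lhd> B" "R \<subseteq> H"
  shows "\<phi> ` R \<lhd> B"
proof (rule B.normal_invI)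
  interpret R: normal R B by (rule R(1))
  have RH [simp]: "r \<in> H" if "r \<in> R" for r using that R(2) by blast
  show "subgroup (\<phi> ` R) B"
  proof (rule B.subgroupI)
    show "\<phi> ` R \<subseteq> carrier B"
      by auto
    show "\<phi> ` R \<noteq> {}"
      using R.one_closed by blast
    show "inv a \<in> \<phi> ` R" if "a \<in> \<phi> ` R" for a
      using that by (auto simp flip: \<phi>_inv)
    show "a \<otimes> b \<in> \<phi> ` R" if "a \<in> \<phi> ` R" "b \<in> \<phi> ` R" for a b
      using that by (auto simp flip: \<phi>_mult)
  qed
  fix b s assume b: "b \<in> carrier B" and "s \<in> \<phi> ` R"
  then obtain r where r: "r \<in> R" "s = \<phi> r" by blast
  obtain b' where "b' \<in> carrier B" "\<forall>h\<in>H. \<phi> (b' \<otimes> h \<otimes> inv b') = b \<otimes> \<phi> h \<otimes> inv b"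
    using conj_lift[OF b] by blast
  then have "b \<otimes> s \<otimes> inv b = \<phi> (b' \<otimes> r \<otimes> inv b')" "b' \<otimes> r \<otimes> inv b' \<in> R"
    using r R.inv_op_closed2 by auto
  then show "b \<otimes> s \<otimes> inv b \<in> \<phi> ` R"
    by blast
qed

abbreviation HK where "HK \<equiv> H <#> K"

lemma HK_normal: "HK \<lhd> B"
  using normal_set_mult(1)[OF B.is_group H_normal K_normal] .

lemma HK_subgroup: "subgroup HK B"
  using HK_normal normal_imp_subgroup by blast

lemma HK_group: "group (B\<lparr>carrier := HK\<rparr>)"
  using subgroup.subgroup_is_group[OF HK_subgroup B.is_group] .

lemma H_group: "group (B\<lparr>carrier := H\<rparr>)"
  using subgroup.subgroup_is_group[OF H_subgroup B.is_group] .

lemma HK_small: "carrier (B\<lparr>carrier := HK\<rparr>) \<lesssim> (UNIV :: 'u set)"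
  and H_small: "carrier (B\<lparr>carrier := H\<rparr>) \<lesssim> (UNIV :: 'u set)"
  using lepoll_trans[OF subset_imp_lepoll B_lepoll] subgroup.subset[OF HK_subgroup] subgroup.subset[OF H_subgroup]
  by simp_all

lemma HK_I: "h \<in> H \<Longrightarrow> k \<in> K \<Longrightarrow> h \<otimes> k \<in> HK"
  unfolding set_mult_iff by blast

text \<open>
  The quotient of \<open>HK\<close> by \<open>Z\<close> is an image of \<open>H / R\<close> under the map induced by \<open>f\<close>.
\<close>

lemma class_normal_in_HK:
  assumes f: "f \<in> hom (B\<lparr>carrier := H\<rparr>) (B\<lparr>carrier := HK\<rparr>)"
    and Z: "Z \<lhd> B" "Z \<subseteq> HK"
    and R: "R \<in> class_normals \<C> (B\<lparr>carrier := H\<rparr>)" "\<And>r. r \<in> R \<Longrightarrow> f r \<in> Z"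
    and surj: "\<And>a. a \<in> HK \<Longrightarrow> \<exists>h\<in>H. Z #> a = Z #> f h"
  shows "Z \<in> class_normals \<C> (B\<lparr>carrier := HK\<rparr>)"
proof -
  let ?HK = "B\<lparr>carrier := HK\<rparr>" and ?H = "B\<lparr>carrier := H\<rparr>"
  have ZA: "Z \<lhd> ?HK"
    using B.normal_restrict_supergroup[OF HK_subgroup Z] .
  let ?g = "(\<lambda>a. Z #>\<^bsub>?HK\<^esub> a) \<circ> f"
  have g: "?g \<in> hom ?H (?HK Mod Z)"
    using f hom_Mod[OF ZA] by (rule Group.hom_compose)
  have fA: "f h \<in> HK" if "h \<in> H" for h
    using f that by (auto simp: hom_def)
  have "?g ` carrier ?H = carrier (?HK Mod Z)"
    unfolding carrier_FactGroup using surj fA by (auto simp: image_iff)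
  moreover have "R \<subseteq> kernel ?H (?HK Mod Z) ?g"
  proof
    fix r assume r: "r \<in> R"
    then have "r \<in> H"
      using R(1) subgroup.mem_carrier[OF normal_imp_subgroup, of R ?H r] by (simp add: class_normals_def)
    then show "r \<in> kernel ?H (?HK Mod Z) ?g"
      using coset_self_iff[OF Z(1)] R(2)[OF r] subgroup.mem_carrier[OF normal_imp_subgroup[OF Z(1)]]
      by (simp add: kernel_def)
  qed
  ultimately have "in_class \<C> (?HK Mod Z)"
    using in_class_if_class_normal_kernel[OF H_group normal.factorgroup_is_group[OF ZA] g _ R(1)] by blast
  then show ?thesis
    using ZA by (simp add: class_normals_def)
qed

text \<open>
  The quotients of \<open>HK\<close> by \<open>RK\<close> and by \<open>H \<phi>(R)\<close> are images of \<open>H / R\<close>. The intersection of these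
  subgroups is \<open>R \<phi>(R) L\<close>, and its quotient by \<open>R \<phi>(R)\<close> is isomorphic to \<open>L / (L \<inter> R)\<close>, which embeds in \<open>H / R\<close>. So
  Gruenberg's condition leads from the intersection to \<open>R \<phi>(R)\<close>.
\<close>

lemma associated_product_class_normal:
  assumes R: "R \<lhd> B" "R \<subseteq> H" "R \<in> class_normals \<C> (B\<lparr>carrier := H\<rparr>)"
    and RL: "R \<inter> L = \<phi> ` R \<inter> L"
  shows "R <#> \<phi> ` R \<in> class_normals \<C> (B\<lparr>carrier := HK\<rparr>)"
proof -
  let ?HK = "B\<lparr>carrier := HK\<rparr>" and ?H = "B\<lparr>carrier := H\<rparr>"
  define S where "S = \<phi> ` R"
  have S: "S \<lhd> B" "S \<subseteq> K"
    unfolding S_def using \<phi>_image_normal[OF R(1,2)] R(2) \<phi>_mem by blast+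
  interpret R: normal R B by (rule R(1))
  interpret S: normal S B by (rule S(1))
  note RS = normal_set_mult[OF B.is_group R(1) S(1)]
  have RH: "r \<in> H" if "r \<in> R" for r using that R(2) by blast
  have SK: "s \<in> K" if "s \<in> S" for s using that S(2) by blast
  have RS_A: "R <#> S \<subseteq> HK" "R <#> K \<subseteq> HK" "H <#> S \<subseteq> HK"
    using R(2) S(2) by (auto simp: set_mult_def)
  note RK = normal_set_mult[OF B.is_group R(1) K_normal]
  note HS = normal_set_mult[OF B.is_group H_normal S(1)]
  have id_hom: "(\<lambda>h. h) \<in> hom ?H ?HK"
    using normal_set_mult(2)[OF B.is_group H_normal K_normal] by (auto simp: hom_def)
  have \<phi>_hom: "\<phi> \<in> hom ?H ?HK"
    using normal_set_mult(3)[OF B.is_group H_normal K_normal] \<phi>_mem by (auto simp: hom_def)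
  have "R <#> K \<in> class_normals \<C> ?HK"
  proof (rule class_normal_in_HK[OF id_hom RK(1) RS_A(2) R(3)])
    show "r \<in> R <#> K" if "r \<in> R" for r using that RK(2) by blast
    fix a assume "a \<in> HK"
    then obtain h k where "h \<in> H" "k \<in> K" "a = h \<otimes> k" by (auto simp: set_mult_def)
    then show "\<exists>h\<in>H. (R <#> K) #> a = (R <#> K) #> h"
      using right_factor_coset[OF _ _ RK(1), of h k] RK(3) by auto
  qed
  moreover have "H <#> S \<in> class_normals \<C> ?HK"
  proof (rule class_normal_in_HK[OF \<phi>_hom HS(1) RS_A(3) R(3)])
    show "\<phi> r \<in> H <#> S" if "r \<in> R" for r using that HS(3) by (auto simp: S_def)
    fix a assume "a \<in> HK"
    then obtain h k where hk: "h \<in> H" "k \<in> K" "a = h \<otimes> k" by (auto simp: set_mult_def)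
    then have "(H <#> S) #> a = (H <#> S) #> k"
      using HS(2) by (intro coset_eqI[OF HS(1)]) (auto simp: B.m_assoc)
    moreover obtain h' where "h' \<in> H" "k = \<phi> h'"
      using hk(2) \<phi>_image by blast
    ultimately show "\<exists>h\<in>H. (H <#> S) #> a = (H <#> S) #> \<phi> h"
      by blast
  qed
  ultimately have Y: "(R <#> K) \<inter> (H <#> S) \<in> class_normals \<C> ?HK" (is "?Y \<in> _")
    using class_normal_Int[OF HK_group HK_small] by blast
  have YB: "y \<in> carrier B" if "y \<in> ?Y" for y
    using that subgroup.mem_carrier[OF normal_imp_subgroup[OF RK(1)]] by blast
  have ex: "\<exists>l\<in>L. (R <#> S) #> y = (R <#> S) #> l" if y: "y \<in> ?Y" for y
  proof -
    obtain r k h s where y_eq: "r \<in> R" "k \<in> K" "y = r \<otimes> k" "h \<in> H" "s \<in> S" "y = h \<otimes> s"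
      using y by (auto simp: set_mult_def)
    define l where "l = k \<otimes> inv s"
    have B: "r \<in> carrier B" "k \<in> carrier B" "h \<in> carrier B" "s \<in> carrier B"
      using y_eq by auto
    have "l = inv r \<otimes> h"
    proof -
      have "inv r \<otimes> (r \<otimes> k) \<otimes> inv s = inv r \<otimes> (h \<otimes> s) \<otimes> inv s"
        using y_eq by simp
      then show ?thesis
        using B by (simp add: l_def B.word_simps)
    qed
    then have "l \<in> H"
      using y_eq RH H_closed by simp
    moreover have "l \<in> K"
      using y_eq SK K_closed by (simp add: l_def)
    moreover have "(R <#> S) #> y = (R <#> S) #> (r \<otimes> l)"
      using right_factor_coset[OF _ _ RS(1), of "r \<otimes> l" s] RS(3) y_eq(3,5) B by (auto simp: l_def B.word_simps)
    moreover have "(R <#> S) #> (r \<otimes> l) = (R <#> S) #> l"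
      using RS(2) y_eq(1) B by (intro coset_eqI[OF RS(1)]) (auto simp: l_def B.word_simps)
    ultimately show ?thesis by auto
  qed
  define \<Lambda> where "\<Lambda> y = (SOME l. l \<in> L \<and> (R <#> S) #> y = (R <#> S) #> l)" for y
  have \<Lambda>: "\<Lambda> y \<in> L \<and> (R <#> S) #> y = (R <#> S) #> \<Lambda> y" if "y \<in> ?Y" for y
    unfolding \<Lambda>_def by (rule someI_ex) (use ex[OF that] in blast)
  have RS_L: "x \<in> R" if x: "x \<in> R <#> S" "x \<in> L" for x
  proof -
    obtain r s where rs: "r \<in> R" "s \<in> S" "x = r \<otimes> s" using x(1) by (auto simp: set_mult_def)
    have "s = inv r \<otimes> x"
      using rs by (simp add: B.word_simps)
    then have "s \<in> H"
      using rs(1) x(2) RH H_closed by simp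
    then have "s \<in> R"
      using rs(2) SK RL by (auto simp: S_def)
    then show ?thesis
      using rs by simp
  qed
  have RnH: "R \<lhd> ?H"
    using B.normal_restrict_supergroup[OF H_subgroup R(1,2)] .
  have R_cong: "R #> l = R #> l'" if "l \<in> L" "l' \<in> L" "(R <#> S) #> l = (R <#> S) #> l'" for l l'
  proof (rule coset_eqI[OF R(1)])
    have "l \<otimes> inv l' \<in> L"
      using that subgroup.m_closed[OF L_subgroup] subgroup.m_inv_closed[OF L_subgroup] by blast
    then show "l \<otimes> inv l' \<in> R"
      using that coset_eqD[OF RS(1) _ _ that(3)] RS_L by simp
  qed (use that in simp_all)
  define \<chi> where "\<chi> y = R #>\<^bsub>?H\<^esub> \<Lambda> y" for y
  have Y_sub: "subgroup ?Y ?HK"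
    using Y normal_imp_subgroup by (auto simp: class_normals_def)
  have "\<chi> \<in> hom (?HK\<lparr>carrier := ?Y\<rparr>) (?H Mod R)"
  proof (rule homI)
    show "\<chi> y \<in> carrier (?H Mod R)" if "y \<in> carrier (?HK\<lparr>carrier := ?Y\<rparr>)" for y
      using that \<Lambda> by (auto simp: \<chi>_def carrier_FactGroup)
    fix x y assume "x \<in> carrier (?HK\<lparr>carrier := ?Y\<rparr>)" "y \<in> carrier (?HK\<lparr>carrier := ?Y\<rparr>)"
    then have xy: "x \<in> ?Y" "y \<in> ?Y" by simp_all
    have xyY: "x \<otimes> y \<in> ?Y"
      using subgroup.m_closed[OF Y_sub xy] by simp
    have lB: "\<Lambda> x \<in> carrier B" "\<Lambda> y \<in> carrier B"
      using \<Lambda> xy by auto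
    have "(R <#> S) #> \<Lambda> (x \<otimes> y) = (R <#> S) #> (x \<otimes> y)"
      using \<Lambda>[OF xyY] by simp
    also have "\<dots> = (R <#> S) #> (\<Lambda> x \<otimes> \<Lambda> y)"
      using \<Lambda>[OF xy(1)] \<Lambda>[OF xy(2)] YB xy lB by (intro coset_mult_cong[OF B.is_group RS(1)]) simp_all
    finally have "R #> \<Lambda> (x \<otimes> y) = R #> (\<Lambda> x \<otimes> \<Lambda> y)"
      using \<Lambda> xy xyY subgroup.m_closed[OF L_subgroup] by (intro R_cong) blast+
    then show "\<chi> (x \<otimes>\<^bsub>?HK\<lparr>carrier := ?Y\<rparr>\<^esub> y) = \<chi> x \<otimes>\<^bsub>?H Mod R\<^esub> \<chi> y"
      using coset_sum[OF R(1) lB] by (simp add: \<chi>_def)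
  qed
  then obtain T where T: "T \<in> class_normals \<C> ?HK" "T \<subseteq> ?Y" "\<And>x. x \<in> T \<Longrightarrow> \<chi> x = \<one>\<^bsub>?H Mod R\<^esub>"
    using Gruenberg[OF HK_group HK_small Y normal.factorgroup_is_group[OF RnH], of \<chi>] R(3)
    by (auto simp: class_normals_def)
  have "T \<subseteq> R <#> S"
  proof
    fix y assume y: "y \<in> T"
    then have yY: "y \<in> ?Y" using T(2) by blast
    have "R #> \<Lambda> y = R"
      using T(3)[OF y] by (simp add: \<chi>_def)
    then have "\<Lambda> y \<in> R"
      using \<Lambda>[OF yY] coset_self_iff[OF R(1)] by simp
    then have "\<Lambda> y \<in> R <#> S"
      using RS(2) by blast
    then have "(R <#> S) #> y = R <#> S"
      using \<Lambda>[OF yY] coset_self_iff[OF RS(1)] by auto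
    then show "y \<in> R <#> S"
      using coset_self_iff[OF RS(1) YB[OF yY]] by simp
  qed
  then have "R <#> S \<in> class_normals \<C> ?HK"
    using class_normal_superset[OF HK_group T(1)] B.normal_restrict_supergroup[OF HK_subgroup RS(1) RS_A(1)] by blast
  then show ?thesis
    unfolding S_def .
qed

definition compatible where
  "compatible N \<longleftrightarrow> N \<in> class_normals \<C> B \<and> \<phi> ` (N \<inter> H) = N \<inter> K \<and>
     (\<forall>h\<in>H. \<forall>k\<in>K. N #> h = N #> k \<longrightarrow> (\<exists>l\<in>L. N #> h = N #> l))"

text \<open>
  Quasi-regularity gives a subgroup \<open>N'\<close> whose trace on \<open>HK\<close> lies in \<open>R \<phi>(R)\<close>. The trace of the product
  of \<open>N' \<inter> N0\<close> and \<open>R \<phi>(R)\<close> is exactly \<open>R \<phi>(R)\<close>, and since \<open>R\<close> and \<open>\<phi>(R)\<close> meet \<open>L\<close> in the same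
  subgroup, its traces on \<open>H\<close> and \<open>K\<close> are \<open>R\<close> and \<open>\<phi>(R)\<close>.
\<close>

lemma compatible_extension:
  assumes qr: "quasi_regular \<C> B HK"
    and R: "R \<lhd> B" "R \<subseteq> H" "R \<in> class_normals \<C> (B\<lparr>carrier := H\<rparr>)"
    and RL: "R \<inter> L = \<phi> ` R \<inter> L"
    and N0: "N0 \<in> class_normals \<C> B" "R \<subseteq> N0" "\<phi> ` R \<subseteq> N0"
  shows "\<exists>N. compatible N \<and> N \<subseteq> N0 \<and> N \<inter> L \<subseteq> R"
proof -
  define S where "S = \<phi> ` R"
  have S: "S \<lhd> B" "S \<subseteq> K"
    unfolding S_def using \<phi>_image_normal[OF R(1,2)] R(2) \<phi>_mem by blast+
  note RS = normal_set_mult[OF B.is_group R(1) S(1)]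
  let ?RS = "R <#> S"
  have RS_A: "?RS \<subseteq> HK"
    using R(2) S(2) by (auto simp: set_mult_def)
  obtain N' where N': "N' \<in> class_normals \<C> B" "N' \<inter> HK \<subseteq> ?RS"
    using qr associated_product_class_normal[OF R RL] unfolding quasi_regular_def S_def by blast
  have N'0: "N' \<inter> N0 \<in> class_normals \<C> B"
    using class_normal_Int[OF B.is_group B_lepoll N'(1) N0(1)] .
  then have N'0n: "N' \<inter> N0 \<lhd> B" and N0n: "N0 \<lhd> B"
    using N0(1) by (auto simp: class_normals_def)
  define N where "N = (N' \<inter> N0) <#> ?RS"
  note Nn = normal_set_mult[OF B.is_group N'0n RS(1), folded N_def]
  have N_class: "N \<in> class_normals \<C> B"
    using class_normal_superset[OF B.is_group N'0 Nn(1,2)] .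
  have sub: "\<And>x y. x \<in> N0 \<Longrightarrow> y \<in> N0 \<Longrightarrow> x \<otimes> y \<in> N0"
    using subgroup.m_closed[OF normal_imp_subgroup[OF N0n]] .
  have "N \<subseteq> N0"
  proof
    fix x assume "x \<in> N"
    then obtain n r s where "n \<in> N0" "r \<in> R" "s \<in> S" "x = n \<otimes> (r \<otimes> s)"
      by (auto simp: N_def set_mult_def)
    moreover from this have "r \<otimes> s \<in> N0"
      using N0(2,3) unfolding S_def by (intro sub) blast+
    ultimately show "x \<in> N0"
      using sub by blast
  qed
  have N_A: "x \<in> ?RS" if x: "x \<in> N" "x \<in> HK" for x
  proof -
    obtain n y where ny: "n \<in> N' \<inter> N0" "y \<in> ?RS" "x = n \<otimes> y"
      using x(1) unfolding N_def set_mult_iff[where A = "N' \<inter> N0"] by (elim bexE)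
    have B: "n \<in> carrier B" "y \<in> carrier B"
      using ny subgroup.mem_carrier[OF normal_imp_subgroup[OF N'0n]]
        subgroup.mem_carrier[OF normal_imp_subgroup[OF RS(1)]] by blast+
    have "x \<otimes> inv y \<in> HK"
      using x(2) ny(2) RS_A subgroup.m_closed[OF HK_subgroup] subgroup.m_inv_closed[OF HK_subgroup] by blast
    then have "n \<in> HK"
      using B by (simp add: ny(3) B.word_simps)
    then have "n \<in> ?RS"
      using ny(1) N'(2) by blast
    then show ?thesis
      using ny subgroup.m_closed[OF normal_imp_subgroup[OF RS(1)]] by blast
  qed
  have N_RS: "\<exists>r\<in>R. \<exists>s\<in>S. x = r \<otimes> s" if "x \<in> N" "x \<in> HK" for x
    using N_A[OF that] unfolding set_mult_iff .
  have H_A: "H \<subseteq> HK" and K_A: "K \<subseteq> HK"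
    using normal_set_mult(2,3)[OF B.is_group H_normal K_normal] .
  have RB: "r \<in> carrier B" "r \<in> H" if "r \<in> R" for r using that R(2) by auto
  have SB: "s \<in> carrier B" "s \<in> K" if "s \<in> S" for s using that S(2) by auto
  have R_ops: "r \<otimes> r' \<in> R" "inv r \<in> R" if "r \<in> R" "r' \<in> R" for r r'
    using that subgroup.m_closed[OF normal_imp_subgroup[OF R(1)]] subgroup.m_inv_closed[OF normal_imp_subgroup[OF R(1)]] by blast+
  have S_ops: "r \<otimes> r' \<in> S" "inv r \<in> S" if "r \<in> S" "r' \<in> S" for r r'
    using that subgroup.m_closed[OF normal_imp_subgroup[OF S(1)]] subgroup.m_inv_closed[OF normal_imp_subgroup[OF S(1)]] by blast+
  have N_H: "N \<inter> H = R"
  proof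
    show "N \<inter> H \<subseteq> R"
    proof
      fix x assume x: "x \<in> N \<inter> H"
      then obtain r s where rs: "r \<in> R" "s \<in> S" "x = r \<otimes> s"
        using N_RS H_A by blast
      have "inv r \<otimes> x \<in> H"
        using x rs RB H_closed by blast
      then have "s \<in> H"
        using rs RB SB by (simp add: B.word_simps)
      then have "s \<in> R"
        using rs(2) SB RL by (auto simp: S_def)
      then show "x \<in> R"
        using rs R_ops by blast
    qed
    show "R \<subseteq> N \<inter> H"
      using Nn(3) RS(2) R(2) by blast
  qed
  have N_K: "N \<inter> K = S"
  proof
    show "N \<inter> K \<subseteq> S"
    proof
      fix x assume x: "x \<in> N \<inter> K"
      then obtain r s where rs: "r \<in> R" "s \<in> S" "x = r \<otimes> s"
        using N_RS K_A by blast
      have "x \<otimes> inv s \<in> K"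
        using x rs SB K_closed by blast
      then have "r \<in> K"
        using rs RB SB by (simp add: B.word_simps)
      then have "r \<in> S"
        using rs(1) RB RL by (auto simp: S_def)
      then show "x \<in> S"
        using rs S_ops by blast
    qed
    show "S \<subseteq> N \<inter> K"
      using Nn(3) RS(3) S(2) by blast
  qed
  have split: "\<exists>l\<in>L. N #> h = N #> l" if h: "h \<in> H" and k: "k \<in> K" and hk: "N #> h = N #> k" for h k
  proof -
    have "h \<otimes> inv k \<in> N"
      using coset_eqD[OF Nn(1) _ _ hk] h k by simp
    moreover have "h \<otimes> inv k \<in> HK"
      using h k HK_I subgroup.m_inv_closed[OF K_subgroup] by blast
    ultimately obtain r s where rs: "r \<in> R" "s \<in> S" "h \<otimes> inv k = r \<otimes> s"
      using N_RS by blast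
    define l where "l = inv r \<otimes> h"
    have B: "r \<in> carrier B" "s \<in> carrier B" "h \<in> carrier B" "k \<in> carrier B"
      using rs h k RB SB by auto
    have "inv r \<otimes> (h \<otimes> inv k) \<otimes> k = inv r \<otimes> (r \<otimes> s) \<otimes> k"
      using rs by simp
    then have "l = s \<otimes> k"
      using B by (simp add: l_def B.word_simps)
    then have "l \<in> K"
      using rs k SB subgroup.m_closed[OF K_subgroup] by simp
    moreover have "l \<in> H"
      unfolding l_def using rs h RB H_closed by blast
    moreover have "h \<otimes> inv l \<in> N"
      using rs(1) N_H B by (auto simp: l_def B.word_simps)
    then have "N #> h = N #> l"
      using \<open>l \<in> H\<close> h by (intro coset_eqI[OF Nn(1)]) simp_all
    ultimately show ?thesis by blast
  qed
  have "compatible N"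
    unfolding compatible_def using N_class N_H N_K split by (simp add: S_def)
  moreover have "N \<inter> L \<subseteq> R"
    using N_H by blast
  ultimately show ?thesis
    using \<open>N \<subseteq> N0\<close> by blast
qed

lemma L_group: "group (B\<lparr>carrier := L\<rparr>)"
  using subgroup.subgroup_is_group[OF L_subgroup B.is_group] .

text \<open>
  Let \<open>X\<close> be the semidirect product of \<open>L\<close> and \<open>\<VV>\<close>. Since \<open>\<VV>\<close> is in the class, Gruenberg's
  condition for \<open>N \<inter> L \<le> L \<le> X\<close> gives a normal subgroup of \<open>X\<close>; its part in \<open>L\<close> is invariant under \<open>\<VV>\<close>,
  which contains the conjugations and \<open>\<phi>\<close>.
\<close>

lemma invariant_class_normal_of_L:
  assumes N: "N \<in> class_normals \<C> B"
  shows "\<exists>D. D \<lhd> B \<and> D \<subseteq> N \<inter> L \<and> \<phi> ` D = D \<and> D \<in> class_normals \<C> (B\<lparr>carrier := L\<rparr>)"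
proof -
  let ?L = "B\<lparr>carrier := L\<rparr>"
  let ?V = "(AutGrp B L)\<lparr>carrier := frakV B L \<phi>\<rparr>"
  interpret Aut: group "AutGrp B L" by (rule AutGrp_L(1))
  interpret V: subgroup "frakV B L \<phi>" "AutGrp B L" by (rule frakV_subgroup)
  interpret gV: group ?V by (rule V.subgroup_is_group[OF Aut.is_group])
  have VA: "v \<in> carrier (AutGrp B L)" if "v \<in> frakV B L \<phi>" for v
    using that V.subset by blast
  have one_V: "\<one>\<^bsub>AutGrp B L\<^esub> l = l" if "l \<in> L" for l
    using that by (simp add: AutoGroup_def BijGroup_def)
  define X where "X = semidirect ?L ?V"
  have X: "group X"
    unfolding X_def
    by (rule group_semidirect[OF L_group gV.is_group]) (use VA AutGrp_L(2-4) one_V in simp_all)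
  interpret X: group X by (rule X)
  have X_carrier: "carrier X = L \<times> frakV B L \<phi>"
    and X_mult: "(x, f) \<otimes>\<^bsub>X\<^esub> (y, g) = (x \<otimes> f y, f \<otimes>\<^bsub>AutGrp B L\<^esub> g)" for x f y g
    by (simp_all add: X_def semidirect_def)
  let ?one = "\<one>\<^bsub>AutGrp B L\<^esub>"
  have X_small: "carrier X \<lesssim> (UNIV :: 'u set)"
    unfolding X_carrier
  proof (rule lepoll_prod_infinite[OF infinite_universe])
    show "L \<lesssim> (UNIV :: 'u set)"
      using lepoll_trans[OF subset_imp_lepoll B_lepoll] subgroup.subset[OF L_subgroup] by blast
    show "frakV B L \<phi> \<lesssim> (UNIV :: 'u set)"
      using in_class_lepoll[OF V_class] by simp
  qed
  have snd_hom: "snd \<in> hom X ?V"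
    by (rule homI) (auto simp: X_carrier X_mult)
  define Y where "Y = kernel X ?V snd"
  have Y: "Y \<in> class_normals \<C> X"
    unfolding Y_def using kernel_class_normal[OF X gV.is_group V_class snd_hom] .
  have Y_eq: "Y = L \<times> {?one}"
    by (auto simp: Y_def kernel_def X_carrier)
  have Nn: "N \<lhd> B" "in_class \<C> (B Mod N)"
    using N by (auto simp: class_normals_def)
  have "(\<lambda>x. N #> fst x) \<in> hom (X\<lparr>carrier := Y\<rparr>) (B Mod N)"
    by (rule homI) (auto simp: Y_eq carrier_FactGroup X_mult one_V coset_sum[OF Nn(1)])
  then obtain T where T: "T \<in> class_normals \<C> X" "T \<subseteq> Y" "\<And>x. x \<in> T \<Longrightarrow> N #> fst x = \<one>\<^bsub>B Mod N\<^esub>"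
    using Gruenberg[OF X X_small Y normal.factorgroup_is_group[OF Nn(1)] Nn(2)] by blast
  have Tn: "T \<lhd> X" using T(1) by (simp add: class_normals_def)
  define D where "D = {l \<in> L. (l, ?one) \<in> T}"
  have L_hom: "(\<lambda>l. (l, ?one)) \<in> hom ?L X"
    by (rule homI) (auto simp: X_carrier X_mult one_V)
  have D: "D \<in> class_normals \<C> ?L"
    using class_normal_vimage[OF L_group X L_hom T(1)] by (simp add: D_def)
  have D_sub: "subgroup D ?L"
    using D normal_imp_subgroup by (auto simp: class_normals_def)
  have D_invariant: "v l \<in> D" if v: "v \<in> frakV B L \<phi>" and l: "l \<in> D" for v l
  proof -
    have lL: "l \<in> L" "(l, ?one) \<in> T" using l by (auto simp: D_def)
    have vl: "v l \<in> L" using AutGrp_L(2)[OF VA[OF v] lL(1)] .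
    have one_L: "\<one> \<in> L" using subgroup.one_closed[OF L_subgroup] .
    have mem: "(\<one>, v) \<in> carrier X" "(l, ?one) \<in> carrier X" "(v l, ?one) \<in> carrier X"
      using v vl lL one_L V.one_closed by (auto simp: X_carrier)
    have "v \<one> = \<one>"
      using AutGrp_L(4)[OF VA[OF v] one_L one_L] AutGrp_L(2)[OF VA[OF v] one_L] by simp
    have "(\<one>, v) \<otimes>\<^bsub>X\<^esub> (l, ?one) = (v l, ?one) \<otimes>\<^bsub>X\<^esub> (\<one>, v)"
      using vl VA[OF v] one_L by (simp add: X_mult one_V)
    then have "(v l, ?one) = (\<one>, v) \<otimes>\<^bsub>X\<^esub> (l, ?one) \<otimes>\<^bsub>X\<^esub> inv\<^bsub>X\<^esub> (\<one>, v)"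
      using mem X.inv_solve_right[of "(v l, ?one)" "(\<one>, v) \<otimes>\<^bsub>X\<^esub> (l, ?one)" "(\<one>, v)"] by simp
    then have "(v l, ?one) \<in> T"
      using normal.inv_op_closed2[OF Tn mem(1) lL(2)] by simp
    then show ?thesis
      using vl by (simp add: D_def)
  qed
  have D_L: "D \<subseteq> L" by (auto simp: D_def)
  have "D \<lhd> B"
  proof (rule B.normal_invI)
    show "subgroup D B"
      using B.incl_subgroup[OF L_subgroup D_sub] .
    fix b l assume b: "b \<in> carrier B" and l: "l \<in> D"
    then show "b \<otimes> l \<otimes> inv b \<in> D"
      using D_invariant[OF conj_in_frakV[OF b] l] subsetD[OF D_L l] by simp
  qed
  moreover have "D \<subseteq> N"
  proof
    fix l assume l: "l \<in> D"
    then have "N #> l = N"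
      using T(3)[of "(l, ?one)"] by (simp add: D_def)
    then show "l \<in> N"
      using coset_self_iff[OF Nn(1)] l D_L by auto
  qed
  moreover have "\<phi> ` D = D"
  proof
    show "\<phi> ` D \<subseteq> D"
    proof (rule image_subsetI)
      fix l assume l: "l \<in> D"
      then show "\<phi> l \<in> D"
        using D_invariant[OF \<phi>_in_frakV l] subsetD[OF D_L l] by simp
    qed
    show "D \<subseteq> \<phi> ` D"
    proof
      fix l assume l: "l \<in> D"
      let ?s = "inv\<^bsub>AutGrp B L\<^esub> restrict \<phi> L"
      have s: "?s \<in> frakV B L \<phi>"
        using V.m_inv_closed[OF \<phi>_in_frakV] .
      have sl: "?s l \<in> D"
        using D_invariant[OF s l] .
      have slL: "?s l \<in> L" "l \<in> L"
        using sl l D_L by blast+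
      have "(restrict \<phi> L \<otimes>\<^bsub>AutGrp B L\<^esub> ?s) l = restrict \<phi> L (?s l)"
        using AutGrp_L(3)[OF VA[OF \<phi>_in_frakV] VA[OF s]] l D_L by blast
      then have "\<phi> (?s l) = l"
        using slL one_V[OF slL(2)] Aut.r_inv[OF VA[OF \<phi>_in_frakV]] by simp
      then show "l \<in> \<phi> ` D"
        using sl by (metis imageI)
    qed
  qed
  ultimately show ?thesis
    using D D_L by blast
qed

text \<open>
  Alternative \<open>(\<alpha>)\<close>: the trace on \<open>H\<close> and on \<open>K\<close> can be an invariant subgroup \<open>D\<close> of \<open>L\<close>, since
  \<open>H / D\<close> is an extension of \<open>L / D\<close> by \<open>H / L\<close>.
\<close>

lemma compatible_if_H_mod_L:
  assumes qr: "quasi_regular \<C> B HK" and HL: "in_class \<C> (B\<lparr>carrier := H\<rparr> Mod L)"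
    and N0: "N0 \<in> class_normals \<C> B" "L \<subseteq> N0" and N3: "N3 \<in> class_normals \<C> B"
  shows "\<exists>N. compatible N \<and> N \<subseteq> N0 \<and> N \<inter> L \<subseteq> N3"
proof -
  let ?H = "B\<lparr>carrier := H\<rparr>"
  obtain D where D: "D \<lhd> B" "D \<subseteq> N3 \<inter> L" "\<phi> ` D = D" "D \<in> class_normals \<C> (B\<lparr>carrier := L\<rparr>)"
    using invariant_class_normal_of_L[OF N3] by blast
  have L: "L \<in> class_normals \<C> ?H"
    using HL B.normal_restrict_supergroup[OF H_subgroup L_normal] by (simp add: class_normals_def)
  have DL: "D \<lhd> B\<lparr>carrier := L\<rparr>" "in_class \<C> (B\<lparr>carrier := L\<rparr> Mod D)"
    using D(4) by (auto simp: class_normals_def)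
  have "(\<lambda>l. D #>\<^bsub>B\<lparr>carrier := L\<rparr>\<^esub> l) \<in> hom (?H\<lparr>carrier := L\<rparr>) (B\<lparr>carrier := L\<rparr> Mod D)"
    using hom_Mod[OF DL(1)] by simp
  then obtain T where T: "T \<in> class_normals \<C> ?H" "T \<subseteq> L" "\<And>x. x \<in> T \<Longrightarrow> D #> x = D"
    using Gruenberg[OF H_group H_small L normal.factorgroup_is_group[OF DL(1)] DL(2)] by auto
  have "T \<subseteq> D"
    using T(2,3) coset_self_iff[OF D(1)] H_carrier by blast
  then have "D \<in> class_normals \<C> ?H"
    using class_normal_superset[OF H_group T(1)] B.normal_restrict_supergroup[OF H_subgroup D(1)] D(2) by blast
  then have "\<exists>N. compatible N \<and> N \<subseteq> N0 \<and> N \<inter> L \<subseteq> D"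
    using D N0 by (intro compatible_extension[OF qr]) auto
  then show ?thesis
    using D(2) by blast
qed

text \<open>
  Alternative \<open>(\<beta>)\<close>: the trace \<open>R\<close> on \<open>H\<close> can be chosen to meet \<open>L\<close> trivially, and then so
  does \<open>\<phi>(R)\<close>. The difficulty is to have \<open>\<phi>(R)\<close> inside \<open>N1\<close>. As \<open>\<phi>(L) = L\<close> lies in \<open>N1\<close>, the map
  \<open>h k \<mapsto> \<phi>(h) N1\<close> is well defined on \<open>HK\<close>, and quasi-regularity applies to its kernel.
\<close>

lemma compatible_if_injective_on_L:
  assumes qr: "quasi_regular \<C> B HK" and N\<beta>: "N\<beta> \<in> class_normals \<C> B" "N\<beta> \<inter> L \<subseteq> {\<one>}"
    and N1: "N1 \<in> class_normals \<C> B" "H \<subseteq> N1" and N2: "N2 \<in> class_normals \<C> B" "K \<subseteq> N2"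
  shows "\<exists>N. compatible N \<and> N \<subseteq> N1 \<inter> N2 \<and> N \<inter> L \<subseteq> {\<one>}"
proof -
  let ?HK = "B\<lparr>carrier := HK\<rparr>"
  have N1n: "N1 \<lhd> B" "in_class \<C> (B Mod N1)"
    using N1(1) by (auto simp: class_normals_def)
  define hh where "hh a = (SOME h. h \<in> H \<and> (\<exists>k\<in>K. a = h \<otimes> k))" for a
  have hh: "hh a \<in> H \<and> (\<exists>k\<in>K. a = hh a \<otimes> k)" if "a \<in> HK" for a
    unfolding hh_def by (rule someI_ex) (use that in \<open>auto simp: set_mult_def\<close>)
  have hh_eqI: "N1 #> \<phi> (hh a) = N1 #> \<phi> h" if h: "h \<in> H" "k \<in> K" "a = h \<otimes> k" for a h k
  proof -
    have "a \<in> HK" using h HK_I by blast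
    then obtain k' where k': "hh a \<in> H" "k' \<in> K" "a = hh a \<otimes> k'"
      using hh by blast
    have "inv h \<otimes> (hh a \<otimes> k') \<otimes> inv k' = inv h \<otimes> (h \<otimes> k) \<otimes> inv k'"
      using k' h by simp
    then have "inv h \<otimes> hh a = k \<otimes> inv k'"
      using k'(1,2) h(1,2) by (simp add: B.word_simps)
    moreover have "inv h \<otimes> hh a \<in> H" "k \<otimes> inv k' \<in> K"
      using k' h H_closed
        K_closed by blast+
    ultimately have "\<phi> (inv h \<otimes> hh a) \<in> N1"
      using \<phi>_L N1(2) by auto
    then have "N1 #> (\<phi> h \<otimes> \<phi> (inv h \<otimes> hh a)) = N1 #> \<phi> h"
      using h by (intro right_factor_coset[OF _ _ N1n(1)]) simp_all
    then show ?thesis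
      using h(1) k'(1) subgroup.m_inv_closed[OF H_subgroup] by (simp add: B.word_simps)
  qed
  let ?g = "\<lambda>a. N1 #> \<phi> (hh a)"
  have g: "?g \<in> hom ?HK (B Mod N1)"
  proof (rule homI)
    show "?g a \<in> carrier (B Mod N1)" if "a \<in> carrier ?HK" for a
      using that hh by (auto simp: carrier_FactGroup)
    fix a b assume "a \<in> carrier ?HK" "b \<in> carrier ?HK"
    then obtain k k' where ab: "hh a \<in> H" "k \<in> K" "a = hh a \<otimes> k" "hh b \<in> H" "k' \<in> K" "b = hh b \<otimes> k'"
      using hh[of a] hh[of b] by auto
    have "a \<otimes> b = (hh a \<otimes> k) \<otimes> (hh b \<otimes> k')"
      using ab by simp
    also have "\<dots> = (hh a \<otimes> hh b) \<otimes> (inv hh b \<otimes> k \<otimes> hh b \<otimes> k')"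
      using ab(1,2,4,5) by (simp add: B.word_simps)
    finally have "N1 #> \<phi> (hh (a \<otimes> b)) = N1 #> \<phi> (hh a \<otimes> hh b)"
      using ab normal.inv_op_closed1[OF K_normal] subgroup.m_closed[OF H_subgroup] subgroup.m_closed[OF K_subgroup]
      by (intro hh_eqI) simp_all
    then show "?g (a \<otimes>\<^bsub>?HK\<^esub> b) = ?g a \<otimes>\<^bsub>B Mod N1\<^esub> ?g b"
      using ab coset_sum[OF N1n(1)] by simp
  qed
  have "kernel ?HK (B Mod N1) ?g \<in> class_normals \<C> ?HK"
    using kernel_class_normal[OF HK_group normal.factorgroup_is_group[OF N1n(1)] N1n(2) g] .
  then obtain N5 where N5: "N5 \<in> class_normals \<C> B" "N5 \<inter> HK \<subseteq> kernel ?HK (B Mod N1) ?g"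
    using qr unfolding quasi_regular_def by blast
  have N5_H: "\<phi> h \<in> N1" if h: "h \<in> H" "h \<in> N5" for h
  proof -
    have "h \<in> HK"
      using h(1) normal_set_mult(2)[OF B.is_group H_normal K_normal] by blast
    then have "N1 #> \<phi> (hh h) = N1"
      using h(2) N5(2) by (auto simp: kernel_def)
    moreover have "N1 #> \<phi> (hh h) = N1 #> \<phi> h"
      using h(1) subgroup.one_closed[OF K_subgroup] by (intro hh_eqI[where k = \<one>]) simp_all
    ultimately show ?thesis
      using coset_self_iff[OF N1n(1)] h(1) by simp
  qed
  define N' where "N' = N5 \<inter> (N2 \<inter> N\<beta>)"
  have N': "N' \<in> class_normals \<C> B"
    unfolding N'_def using class_normal_Int[OF B.is_group B_lepoll] N5(1) N2(1) N\<beta>(1) by blast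
  define R where "R = N' \<inter> H"
  have R: "R \<lhd> B" "R \<subseteq> H"
    using N' H_normal B.normal_subgroup_intersect by (auto simp: R_def class_normals_def)
  have R_class: "R \<in> class_normals \<C> (B\<lparr>carrier := H\<rparr>)"
    unfolding R_def using class_normal_restrict[OF B.is_group H_subgroup N'] .
  have one_R: "\<one> \<in> R"
    using subgroup.one_closed[OF normal_imp_subgroup[OF R(1)]] .
  have R_L: "R \<inter> L = {\<one>}"
    using one_R N\<beta>(2) subgroup.one_closed[OF L_subgroup] by (auto simp: R_def N'_def)
  have S_L: "\<phi> ` R \<inter> L = {\<one>}"
  proof
    show "\<phi> ` R \<inter> L \<subseteq> {\<one>}"
    proof
      fix s assume "s \<in> \<phi> ` R \<inter> L"
      then obtain r l where rl: "r \<in> R" "l \<in> L" "s = \<phi> r" "s = \<phi> l"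
        using \<phi>_L by blast
      have "\<phi> r = \<phi> l"
        using rl(3,4) by simp
      then have "r = l"
        using inj_onD[OF \<phi>_inj] R(2) rl(1,2) by blast
      then have "r = \<one>"
        using R_L rl(1,2) by blast
      then show "s \<in> {\<one>}"
        using rl(3) by simp
    qed
    have "\<phi> \<one> \<in> \<phi> ` R"
      using one_R by (rule imageI)
    then show "{\<one>} \<subseteq> \<phi> ` R \<inter> L"
      using subgroup.one_closed[OF L_subgroup] by simp
  qed
  have N12: "N1 \<inter> N2 \<in> class_normals \<C> B"
    using class_normal_Int[OF B.is_group B_lepoll N1(1) N2(1)] .
  have "\<exists>N. compatible N \<and> N \<subseteq> N1 \<inter> N2 \<and> N \<inter> L \<subseteq> R"
  proof (rule compatible_extension[OF qr R R_class _ N12])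
    show "R \<inter> L = \<phi> ` R \<inter> L" using R_L S_L by simp
    show "R \<subseteq> N1 \<inter> N2" using N1(2) by (auto simp: R_def N'_def)
    show "\<phi> ` R \<subseteq> N1 \<inter> N2" using N5_H N2(2) \<phi>_mem by (auto simp: R_def N'_def)
  qed
  then show ?thesis
    using R_L by blast
qed

lemma compatible_exists:
  assumes qr: "quasi_regular \<C> B HK"
    and cases: "in_class \<C> (B\<lparr>carrier := H\<rparr> Mod L) \<or>
      (\<exists>G f. \<C> G \<and> f \<in> hom B G \<and> f ` carrier B = carrier G \<and> inj_on f L)"
    and N1: "N1 \<in> class_normals \<C> B" "H \<subseteq> N1" and N2: "N2 \<in> class_normals \<C> B" "K \<subseteq> N2"
    and N3: "N3 \<in> class_normals \<C> B"
  shows "\<exists>N. compatible N \<and> N \<subseteq> N1 \<inter> N2 \<and> N \<inter> L \<subseteq> N3"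
  using cases
proof
  assume "in_class \<C> (B\<lparr>carrier := H\<rparr> Mod L)"
  moreover have "N1 \<inter> N2 \<in> class_normals \<C> B" "L \<subseteq> N1 \<inter> N2"
    using class_normal_Int[OF B.is_group B_lepoll N1(1) N2(1)] N1(2) N2(2) by blast+
  ultimately show ?thesis
    using compatible_if_H_mod_L[OF qr] N3 by blast
next
  assume "\<exists>G f. \<C> G \<and> f \<in> hom B G \<and> f ` carrier B = carrier G \<and> inj_on f L"
  then obtain G f where G: "\<C> G" "f \<in> hom B G" "inj_on f L" by blast
  have gG: "group G" using class_group[OF G(1)] .
  have "kernel B G f \<in> class_normals \<C> B"
    using kernel_class_normal[OF B.is_group gG in_class_self[OF G(1)] G(2)] .
  moreover have "kernel B G f \<inter> L \<subseteq> {\<one>}"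
  proof
    fix l assume "l \<in> kernel B G f \<inter> L"
    then have "f l = f \<one>" "l \<in> L"
      using hom_one[OF G(2) B.is_group gG] by (auto simp: kernel_def)
    then show "l \<in> {\<one>}"
      using inj_onD[OF G(3)] subgroup.one_closed[OF L_subgroup] by blast
  qed
  ultimately obtain N where "compatible N" "N \<subseteq> N1 \<inter> N2" "N \<inter> L \<subseteq> {\<one>}"
    using compatible_if_injective_on_L[OF qr _ _ N1 N2] by blast
  moreover have "\<one> \<in> N3"
    using N3 normal_imp_subgroup subgroup.one_closed by (fastforce simp: class_normals_def)
  ultimately show ?thesis by blast
qed

end


section \<open>The criterion when conjugation on K lifts to conjugation on H\<close>

context normal_hnn
begin

lemma reduced_mono:
  assumes "reduced H' K' ps" "\<And>c. c \<in> snd ` set ps \<Longrightarrow> c \<in> H'' \<Longrightarrow> c \<in> H'"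
    "\<And>c. c \<in> snd ` set ps \<Longrightarrow> c \<in> K'' \<Longrightarrow> c \<in> K'"
  shows "reduced H'' K'' ps"
  using assms by (induction ps) auto

end

context twisted_hnn
begin

lemma compatible_normal: "compatible N \<Longrightarrow> compatible_normal \<C> B H K \<phi> N"
  by unfold_locales (auto simp: compatible_def)

text \<open>
  The subgroup \<open>N1\<close> keeps the letters of the word outside \<open>H\<close>, the subgroup \<open>N2\<close> keeps them outside \<open>K\<close>,
  and \<open>N3\<close> is used for elements of \<open>L\<close>.
\<close>

lemma residually_hnn:
  assumes qr: "quasi_regular \<C> B HK"
    and cases: "in_class \<C> (B\<lparr>carrier := H\<rparr> Mod L) \<or>
      (\<exists>G f. \<C> G \<and> f \<in> hom B G \<and> f ` carrier B = carrier G \<and> inj_on f L)"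
    and res: "residually \<C> B" "residually \<C> (B Mod H)" "residually \<C> (B Mod K)"
  shows "residually \<C> E"
  unfolding residually_iff[OF E.is_group]
proof (intro ballI impI)
  fix x assume x: "x \<in> carrier E" "x \<noteq> \<one>\<^bsub>E\<^esub>"
  obtain b ps where b: "b \<in> carrier B" and ps: "snd ` set ps \<subseteq> carrier B" "reduced H K ps"
    and x_eq: "x = \<iota> b \<cdot> path ps"
    using reduced_normal_form[OF x(1)] by blast
  let ?S = "insert b (snd ` set ps)"
  have "\<exists>N1 \<in> class_normals \<C> B. H \<subseteq> N1 \<and> N1 \<inter> (?S - H) = {}"
    using res(2)[unfolded residually_Mod_iff[OF B.is_group H_normal]] b ps(1) subgroup.subset[OF H_subgroup]
    by (intro class_normal_avoiding_finite[OF B.is_group B_lepoll]) auto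
  then obtain N1 where N1: "N1 \<in> class_normals \<C> B" "H \<subseteq> N1" "N1 \<inter> (?S - H) = {}"
    by blast
  have "\<exists>N2 \<in> class_normals \<C> B. K \<subseteq> N2 \<and> N2 \<inter> (?S - K) = {}"
    using res(3)[unfolded residually_Mod_iff[OF B.is_group K_normal]] b ps(1) subgroup.subset[OF K_subgroup]
    by (intro class_normal_avoiding_finite[OF B.is_group B_lepoll]) auto
  then obtain N2 where N2: "N2 \<in> class_normals \<C> B" "K \<subseteq> N2" "N2 \<inter> (?S - K) = {}"
    by blast
  have "\<exists>N3 \<in> class_normals \<C> B. b \<noteq> \<one> \<longrightarrow> b \<notin> N3"
    using res(1)[unfolded residually_iff[OF B.is_group]] b carrier_class_normal[OF B.is_group] by blast
  then obtain N3 where N3: "N3 \<in> class_normals \<C> B" "b \<noteq> \<one> \<Longrightarrow> b \<notin> N3"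
    by blast
  obtain N where N: "compatible N" "N \<subseteq> N1 \<inter> N2" "N \<inter> L \<subseteq> N3"
    using compatible_exists[OF qr cases N1(1,2) N2(1,2) N3(1)] by blast
  interpret N: compatible_normal \<C> B H K \<phi> N
    by (rule compatible_normal[OF N(1)])
  obtain T0 where T0: "T0 \<in> class_normals \<C> E" "\<forall>b\<in>carrier B. \<iota> b \<in> T0 \<longrightarrow> b \<in> N"
    using N.base_mod_N by blast
  show "\<exists>T\<in>class_normals \<C> E. x \<notin> T"
  proof (cases "ps = []")
    case True
    then have "x = \<iota> b"
      using b by (simp add: x_eq)
    then have "b \<noteq> \<one>"
      using x(2) by auto
    have "b \<notin> N"
    proof
      assume "b \<in> N"
      then have "b \<in> L"
        using N(2) N1(3) N2(3) by blast
      then show False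
        using \<open>b \<in> N\<close> \<open>b \<noteq> \<one>\<close> N(3) N3(2) by blast
    qed
    then show ?thesis
      using T0 b \<open>x = \<iota> b\<close> by blast
  next
    case False
    have avoid: "c \<in> Z" if c: "c \<in> snd ` set ps" "h \<in> Z" "\<iota> (c \<otimes> inv h) \<in> T0"
      and Z: "Z \<subseteq> N'" "N' \<in> class_normals \<C> B" "N \<subseteq> N'" "N' \<inter> (?S - Z) = {}" for c h Z N'
    proof -
      have N': "N' \<lhd> B"
        using Z(2) by (simp add: class_normals_def)
      have B: "c \<in> carrier B" "h \<in> carrier B" "h \<in> N'"
        using c ps(1) Z(1) subgroup.mem_carrier[OF normal_imp_subgroup[OF N']] by blast+
      have "c \<otimes> inv h \<in> N'"
        using T0(2) c(3) B Z(3) by blast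
      then have "c \<otimes> inv h \<otimes> h \<in> N'"
        using B(3) subgroup.m_closed[OF normal_imp_subgroup[OF N']] by blast
      then have "c \<in> N'"
        using B by (simp add: B.m_assoc)
      then show "c \<in> Z"
        using c(1) Z(4) by blast
    qed
    have "reduced {b. \<exists>h\<in>H. \<iota> (b \<otimes> inv h) \<in> T0} {b. \<exists>k\<in>K. \<iota> (b \<otimes> inv k) \<in> T0} ps"
      using ps(2)
    proof (rule reduced_mono)
      show "c \<in> H" if "c \<in> snd ` set ps" "c \<in> {b. \<exists>h\<in>H. \<iota> (b \<otimes> inv h) \<in> T0}" for c
        using that avoid[of c _ H N1] N1 N(2) by blast
      show "c \<in> K" if "c \<in> snd ` set ps" "c \<in> {b. \<exists>h\<in>K. \<iota> (b \<otimes> inv h) \<in> T0}" for c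
        using that avoid[of c _ K N2] N2 N(2) by blast
    qed
    then obtain T where T: "T \<in> class_normals \<C> E" "separated T ps"
      using separating_class_normal[OF T0(1) ps(1)] by blast
    then have "x \<notin> T"
      using separated_not_base[OF _ T(2) False ps(1) b] by (simp add: class_normals_def x_eq)
    then show ?thesis
      using T(1) by blast
  qed
qed

text \<open>
  For the class of all groups the trivial subgroup of \<open>B\<close> is compatible. The resulting quotient of
  \<open>E\<close> is faithful on \<open>B\<close>, so words that are reduced remain reduced in it and can be separated.
\<close>

lemma Britton:
  shows "b \<in> carrier B \<Longrightarrow> \<iota> b = \<one>\<^bsub>E\<^esub> \<Longrightarrow> b = \<one>"
    and "b \<in> carrier B \<Longrightarrow> snd ` set ps \<subseteq> carrier B \<Longrightarrow> reduced H K ps \<Longrightarrow> ps \<noteq> [] \<Longrightarrow>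
      \<iota> b \<cdot> path ps \<noteq> \<one>\<^bsub>E\<^esub>"
proof -
  obtain X :: "'u monoid" and s where X: "group X" "s \<in> carrier X" "s \<noteq> \<one>\<^bsub>X\<^esub>"
    using nontrivial_member by blast
  interpret all: quotient_closed_root_class "Group.group :: 'u monoid \<Rightarrow> bool"
    using all_groups_root_class[OF infinite_universe X(1)] X(2,3) by blast
  interpret all: twisted_hnn "Group.group :: 'u monoid \<Rightarrow> bool" B H K \<phi>
  proof unfold_locales
    show "in_class (Group.group :: 'u monoid \<Rightarrow> bool) ((AutGrp B L)\<lparr>carrier := frakV B L \<phi>\<rparr>)"
      using V_class in_class_group in_class_lepoll by (intro in_class_all_groups) blast+
  qed (use B_lepoll \<phi>_L conj_lift in auto)
  have one_n: "{\<one>} \<lhd> B"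
    by (rule B.one_is_normal)
  have one_coset: "{\<one>} #> x = {x}" if "x \<in> carrier B" for x
    using that by (simp add: r_coset_def)
  have "in_class (Group.group :: 'u monoid \<Rightarrow> bool) (B Mod {\<one>})"
  proof (rule in_class_all_groups)
    show "group (B Mod {\<one>})"
      using normal.factorgroup_is_group[OF one_n] .
    show "carrier (B Mod {\<one>}) \<lesssim> (UNIV :: 'u set)"
      unfolding carrier_FactGroup by (rule lepoll_trans[OF image_lepoll B_lepoll])
  qed
  then have "all.compatible {\<one>}"
    unfolding all.compatible_def class_normals_def
    using one_n one_coset subgroup.one_closed[OF H_subgroup] subgroup.one_closed[OF K_subgroup]
    by auto
  then interpret one: compatible_normal "Group.group :: 'u monoid \<Rightarrow> bool" B H K \<phi> "{\<one>}"
    by (rule all.compatible_normal)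
  obtain T0 where T0: "T0 \<in> class_normals (Group.group :: 'u monoid \<Rightarrow> bool) E" "\<forall>b\<in>carrier B. \<iota> b \<in> T0 \<longrightarrow> b \<in> {\<one>}"
    using one.base_mod_N by blast
  have one_T0: "\<one>\<^bsub>E\<^esub> \<in> T" if "T \<in> class_normals (Group.group :: 'u monoid \<Rightarrow> bool) E" for T
    using that subgroup.one_closed[OF normal_imp_subgroup] unfolding class_normals_def by blast
  show "b = \<one>" if "b \<in> carrier B" "\<iota> b = \<one>\<^bsub>E\<^esub>"
  proof -
    have "\<iota> b \<in> T0"
      unfolding that(2) by (rule one_T0[OF T0(1)])
    then show ?thesis
      using T0(2) that(1) by blast
  qed
  show "\<iota> b \<cdot> path ps \<noteq> \<one>\<^bsub>E\<^esub>"
    if b: "b \<in> carrier B" and ps: "snd ` set ps \<subseteq> carrier B" "reduced H K ps" "ps \<noteq> []"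
  proof -
    have eq: "c = h" if "c \<in> carrier B" "h \<in> carrier B" "\<iota> (c \<otimes> inv h) \<in> T0" for c h
    proof -
      have "c \<otimes> inv h = \<one>"
        using T0(2) that by blast
      then show ?thesis
        using that B.inv_equality[of c "inv h"] by simp
    qed
    have "reduced {b. \<exists>h\<in>H. \<iota> (b \<otimes> inv h) \<in> T0} {b. \<exists>k\<in>K. \<iota> (b \<otimes> inv k) \<in> T0} ps"
      using ps(2)
    proof (rule reduced_mono)
      show "c \<in> H" if "c \<in> snd ` set ps" "c \<in> {b. \<exists>h\<in>H. \<iota> (b \<otimes> inv h) \<in> T0}" for c
        using that eq[of c] ps(1) H_carrier by blast
      show "c \<in> K" if "c \<in> snd ` set ps" "c \<in> {b. \<exists>h\<in>K. \<iota> (b \<otimes> inv h) \<in> T0}" for c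
        using that eq[of c] ps(1) K_carrier by blast
    qed
    then obtain T where T: "T \<in> class_normals (Group.group :: 'u monoid \<Rightarrow> bool) E" "separated T ps"
      using all.separating_class_normal[OF T0(1) ps(1)] by blast
    then have "\<iota> b \<cdot> path ps \<notin> T"
      using separated_not_base[OF _ T(2) ps(3) ps(1) b] by (simp add: class_normals_def)
    then show ?thesis
      using one_T0[OF T(1)] by metis
  qed
qed

lemma residually_base:
  assumes "residually \<C> E"
  shows "residually \<C> B"
  unfolding residually_iff[OF B.is_group]
proof (intro ballI impI)
  fix b assume b: "b \<in> carrier B" "b \<noteq> \<one>"
  then have "\<iota> b \<noteq> \<one>\<^bsub>E\<^esub>"
    using Britton(1) by blast
  then obtain M where M: "M \<in> class_normals \<C> E" "\<iota> b \<notin> M"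
    using assms[unfolded residually_iff[OF E.is_group]] \<iota>.hom_closed[OF b(1)] by blast
  then show "\<exists>N\<in>class_normals \<C> B. b \<notin> N"
    using M(2) by (intro bexI[OF _ class_normal_vimage[OF B.is_group E.is_group \<iota>.homh M(1)]]) simp
qed

text \<open>
  If \<open>x\<close> centralizes \<open>Z\<close>, then modulo \<open>M\<close> it commutes with every element of \<open>Z\<close> times the inverse image \<open>N\<close> of
  \<open>M\<close> in \<open>B\<close>. So \<open>Z N\<close> does not contain \<open>b\<close> if \<open>M\<close> does not contain the commutator of \<open>x\<close> and \<open>b\<close>.
\<close>

lemma separable_from_centralized:
  assumes res: "residually \<C> E" and Z: "Z \<lhd> B" and b: "b \<in> carrier B" and x: "x \<in> carrier E"
    and central: "\<And>z. z \<in> Z \<Longrightarrow> x \<cdot> \<iota> z = \<iota> z \<cdot> x"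
    and moves: "x \<cdot> \<iota> b \<cdot> inv\<^bsub>E\<^esub> x \<cdot> inv\<^bsub>E\<^esub> \<iota> b \<noteq> \<one>\<^bsub>E\<^esub>"
  shows "\<exists>N\<in>class_normals \<C> B. Z \<subseteq> N \<and> b \<notin> N"
proof -
  have "x \<cdot> \<iota> b \<cdot> inv\<^bsub>E\<^esub> x \<cdot> inv\<^bsub>E\<^esub> \<iota> b \<in> carrier E"
    using x b by simp
  then obtain M where M: "M \<in> class_normals \<C> E" "x \<cdot> \<iota> b \<cdot> inv\<^bsub>E\<^esub> x \<cdot> inv\<^bsub>E\<^esub> \<iota> b \<notin> M"
    using res[unfolded residually_iff[OF E.is_group]] moves by blast
  interpret M: normal M E
    using M(1) by (simp add: class_normals_def)
  define N where "N = {b \<in> carrier B. \<iota> b \<in> M}"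
  have N: "N \<in> class_normals \<C> B"
    unfolding N_def using class_normal_vimage[OF B.is_group E.is_group \<iota>.homh M(1)] .
  then have Nn: "N \<lhd> B" by (simp add: class_normals_def)
  note ZN = normal_set_mult[OF B.is_group Z Nn]
  have "b \<notin> Z <#> N"
  proof
    assume "b \<in> Z <#> N"
    then obtain z n where zn: "z \<in> Z" "n \<in> N" "b = z \<otimes> n"
      by (auto simp: set_mult_def)
    have B: "z \<in> carrier B" "n \<in> carrier B" and nM: "\<iota> n \<in> M"
      using zn subgroup.mem_carrier[OF normal_imp_subgroup[OF Z]] by (auto simp: N_def)
    have "x \<cdot> \<iota> b \<cdot> inv\<^bsub>E\<^esub> x \<cdot> inv\<^bsub>E\<^esub> \<iota> b = x \<cdot> \<iota> z \<cdot> (\<iota> n \<cdot> inv\<^bsub>E\<^esub> x \<cdot> inv\<^bsub>E\<^esub> \<iota> n \<cdot> inv\<^bsub>E\<^esub> \<iota> z)"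
      using B x by (simp add: zn(3) E.word_simps)
    also have "\<dots> = \<iota> z \<cdot> ((x \<cdot> \<iota> n \<cdot> inv\<^bsub>E\<^esub> x) \<cdot> inv\<^bsub>E\<^esub> \<iota> n) \<cdot> inv\<^bsub>E\<^esub> \<iota> z"
      unfolding central[OF zn(1)] using B x by (simp add: E.word_simps)
    also have "\<dots> \<in> M"
      using M.inv_op_closed2 x nM B by simp
    finally show False
      using M(2) by simp
  qed
  then show ?thesis
    using class_normal_superset[OF B.is_group N ZN(1,3)] ZN(2) by blast
qed

lemma H_eq_carrier_iff: "H = carrier B \<longleftrightarrow> K = carrier B"
proof
  assume H: "H = carrier B"
  then have "\<phi> ` K = K"
    using \<phi>_L subgroup.subset[OF K_subgroup] by (simp add: Int_absorb1)
  moreover have "\<phi> ` H = K"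
    by (rule \<phi>_image)
  ultimately have "\<phi> ` K = \<phi> ` H" by simp
  then have "K = H"
    using inj_on_image_eq_iff[OF \<phi>_inj, of K H] H subgroup.subset[OF K_subgroup] by blast
  then show "K = carrier B" using H by simp
next
  assume K: "K = carrier B"
  then have "\<phi> ` H = H"
    using \<phi>_L subgroup.subset[OF H_subgroup] by (simp add: Int_absorb2)
  then show "H = carrier B"
    using \<phi>_image K by simp
qed

text \<open>
  On \<open>H\<close>, conjugation by \<open>t c t\<^sup>-\<^sup>1\<close> is conjugation by \<open>c\<close> on \<open>K\<close>, carried over by \<open>\<phi>\<close>, and hence agrees with
  conjugation by \<open>c'\<close>.
\<close>

lemma H_centralizer:
  assumes c: "c \<in> carrier B" "c' \<in> carrier B" "\<forall>h\<in>H. \<phi> (c' \<otimes> h \<otimes> inv c') = c \<otimes> \<phi> h \<otimes> inv c" and h: "h \<in> H"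
  defines "x \<equiv> t \<cdot> \<iota> c \<cdot> inv\<^bsub>E\<^esub> t \<cdot> inv\<^bsub>E\<^esub> \<iota> c'"
  shows "x \<cdot> \<iota> h = \<iota> h \<cdot> x"
proof -
  define h' where "h' = inv c' \<otimes> h \<otimes> c'"
  have h': "h' \<in> H"
    unfolding h'_def using normal.inv_op_closed1[OF H_normal c(2) h] .
  have eq: "\<phi> h = c \<otimes> \<phi> h' \<otimes> inv c"
    using bspec[OF c(3) h'] c(2) h by (simp add: h'_def B.word_simps)
  have t_inv: "inv\<^bsub>E\<^esub> t \<cdot> (\<iota> g \<cdot> y) = \<iota> (\<phi> g) \<cdot> (inv\<^bsub>E\<^esub> t \<cdot> y)" if "g \<in> H" "y \<in> carrier E" for g y
    using that t_\<iota>_\<phi>[OF that(1), of "inv\<^bsub>E\<^esub> t \<cdot> y", symmetric] by (simp add: E.word_simps)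
  have "x \<cdot> \<iota> h = t \<cdot> (\<iota> c \<cdot> (inv\<^bsub>E\<^esub> t \<cdot> (\<iota> h' \<cdot> inv\<^bsub>E\<^esub> \<iota> c')))"
    using c(1,2) h by (simp add: x_def h'_def E.word_simps)
  also have "\<dots> = t \<cdot> (\<iota> c \<cdot> (\<iota> (\<phi> h') \<cdot> (inv\<^bsub>E\<^esub> t \<cdot> inv\<^bsub>E\<^esub> \<iota> c')))"
    using c(2) h' by (simp add: t_inv)
  also have "\<dots> = t \<cdot> (\<iota> (\<phi> h) \<cdot> (\<iota> c \<cdot> (inv\<^bsub>E\<^esub> t \<cdot> inv\<^bsub>E\<^esub> \<iota> c')))"
    unfolding eq using c(1,2) h' by (simp add: E.word_simps)
  also have "\<dots> = \<iota> h \<cdot> x"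
    using c(1,2) h t_\<iota>_\<phi>[OF h] by (simp add: x_def E.m_assoc)
  finally show ?thesis .
qed

text \<open>
  The commutator of \<open>b\<close> with the element that centralizes \<open>H\<close> is reduced as written when \<open>c\<close> is outside
  \<open>K\<close>.
\<close>

lemma residually_Mod_H:
  assumes "residually \<C> E"
  shows "residually \<C> (B Mod H)"
  unfolding residually_Mod_iff[OF B.is_group H_normal]
proof (intro ballI impI)
  fix b assume b: "b \<in> carrier B" "b \<notin> H"
  then obtain c where c: "c \<in> carrier B" "c \<notin> K"
    using H_eq_carrier_iff subgroup.subset[OF K_subgroup] by blast
  obtain c' where c': "c' \<in> carrier B" "\<forall>h\<in>H. \<phi> (c' \<otimes> h \<otimes> inv c') = c \<otimes> \<phi> h \<otimes> inv c"
    using conj_lift[OF c(1)] by blast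
  let ?x = "t \<cdot> \<iota> c \<cdot> inv\<^bsub>E\<^esub> t \<cdot> inv\<^bsub>E\<^esub> \<iota> c'"
  let ?ps = "[(True, c), (False, inv c' \<otimes> b \<otimes> c'), (True, inv c), (False, inv b)]"
  have "inv c \<notin> K"
    using c B.inv_inv subgroup.m_inv_closed[OF K_subgroup] by metis
  moreover have "inv c' \<otimes> b \<otimes> c' \<notin> H"
  proof
    assume "inv c' \<otimes> b \<otimes> c' \<in> H"
    then have "c' \<otimes> (inv c' \<otimes> b \<otimes> c') \<otimes> inv c' \<in> H"
      using normal.inv_op_closed2[OF H_normal c'(1)] by blast
    then show False
      using b c'(1) by (simp add: B.word_simps)
  qed
  ultimately have "\<iota> \<one> \<cdot> path ?ps \<noteq> \<one>\<^bsub>E\<^esub>"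
    using b c c' by (intro Britton(2)) simp_all
  moreover have "?x \<cdot> \<iota> b \<cdot> inv\<^bsub>E\<^esub> ?x \<cdot> inv\<^bsub>E\<^esub> \<iota> b = \<iota> \<one> \<cdot> path ?ps"
    using b(1) c(1) c'(1) by (simp add: E.word_simps)
  ultimately show "\<exists>N\<in>class_normals \<C> B. H \<subseteq> N \<and> b \<notin> N"
    using H_centralizer[OF c(1) c'] b(1) c(1) c'(1)
    by (intro separable_from_centralized[OF assms H_normal, where x = ?x]) simp_all
qed

lemma K_centralizer:
  assumes x: "x \<in> carrier E" "\<And>h. h \<in> H \<Longrightarrow> x \<cdot> \<iota> h = \<iota> h \<cdot> x" and k: "k \<in> K"
  shows "(inv\<^bsub>E\<^esub> t \<cdot> x \<cdot> t) \<cdot> \<iota> k = \<iota> k \<cdot> (inv\<^bsub>E\<^esub> t \<cdot> x \<cdot> t)"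
proof -
  obtain h where h: "h \<in> H" "k = \<phi> h"
    using k \<phi>_image by blast
  have \<iota>k: "\<iota> k = inv\<^bsub>E\<^esub> t \<cdot> (\<iota> h \<cdot> t)"
    using h t_relation[OF h(1)] by (simp add: E.inv_mult_cancel)
  have "inv\<^bsub>E\<^esub> t \<cdot> x \<cdot> t \<cdot> \<iota> k = inv\<^bsub>E\<^esub> t \<cdot> ((x \<cdot> \<iota> h) \<cdot> t)"
    unfolding \<iota>k using x(1) h(1) by (simp add: E.word_simps)
  also have "\<dots> = \<iota> k \<cdot> (inv\<^bsub>E\<^esub> t \<cdot> x \<cdot> t)"
    unfolding \<iota>k x(2)[OF h(1)] using x(1) h(1) by (simp add: E.word_simps)
  finally show ?thesis .
qed

text \<open>
  The centralizer of \<open>K\<close> is conjugate under \<open>t\<close> to that of \<open>H\<close>, and one may take \<open>c = b\<close>. If \<open>c'\<close> is outside \<open>H\<close>,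
  the first two stable letters of the conjugated element cancel and the commutator with \<open>b\<close> reduces to a word
  with four of them. If \<open>c'\<close> is in \<open>H\<close>, then cancellation is prevented by
  conjugating first by an element \<open>g0\<close> outside \<open>H\<close>, which normalizes \<open>H\<close>.
\<close>

lemma residually_Mod_K:
  assumes "residually \<C> E"
  shows "residually \<C> (B Mod K)"
  unfolding residually_Mod_iff[OF B.is_group K_normal]
proof (intro ballI impI)
  fix b assume b: "b \<in> carrier B" "b \<notin> K"
  then obtain g0 where g0: "g0 \<in> carrier B" "g0 \<notin> H"
    using H_eq_carrier_iff subgroup.subset[OF H_subgroup] by blast
  obtain c' where c': "c' \<in> carrier B" "\<forall>h\<in>H. \<phi> (c' \<otimes> h \<otimes> inv c') = b \<otimes> \<phi> h \<otimes> inv b"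
    using conj_lift[OF b(1)] by blast
  let ?x = "t \<cdot> \<iota> b \<cdot> inv\<^bsub>E\<^esub> t \<cdot> inv\<^bsub>E\<^esub> \<iota> c'"
  have H_inv: "inv g \<notin> H" if "g \<in> carrier B" "g \<notin> H" for g
    using that B.inv_inv subgroup.m_inv_closed[OF H_subgroup] by metis
  have K_inv: "inv b \<notin> K"
    using b B.inv_inv subgroup.m_inv_closed[OF K_subgroup] by metis
  have xE: "?x \<in> carrier E"
    using b c' by simp
  show "\<exists>N\<in>class_normals \<C> B. K \<subseteq> N \<and> b \<notin> N"
  proof (cases "c' \<in> H")
    case False
    let ?y = "inv\<^bsub>E\<^esub> t \<cdot> ?x \<cdot> t"
    let ?ps = "[(False, inv c'), (True, b), (False, c'), (True, inv b \<otimes> inv b)]"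
    have "\<iota> b \<cdot> path ?ps \<noteq> \<one>\<^bsub>E\<^esub>"
      using b c' False H_inv by (intro Britton(2)) simp_all
    moreover have "?y \<cdot> \<iota> b \<cdot> inv\<^bsub>E\<^esub> ?y \<cdot> inv\<^bsub>E\<^esub> \<iota> b = \<iota> b \<cdot> path ?ps"
      using b(1) c'(1) by (simp add: E.word_simps)
    ultimately show ?thesis
      using K_centralizer[OF xE H_centralizer[OF b(1) c']] b(1) c'(1)
      by (intro separable_from_centralized[OF assms K_normal, where x = ?y]) simp_all
  next
    case True
    let ?z = "\<iota> g0 \<cdot> ?x \<cdot> inv\<^bsub>E\<^esub> \<iota> g0"
    let ?y = "inv\<^bsub>E\<^esub> t \<cdot> ?z \<cdot> t"
    have zE: "?z \<in> carrier E"
      using b c' g0 by simp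
    have z: "?z \<cdot> \<iota> h = \<iota> h \<cdot> ?z" if h: "h \<in> H" for h
    proof -
      define h' where "h' = inv g0 \<otimes> h \<otimes> g0"
      have h': "h' \<in> H"
        unfolding h'_def using normal.inv_op_closed1[OF H_normal g0(1) h] .
      have "?z \<cdot> \<iota> h = \<iota> g0 \<cdot> (?x \<cdot> \<iota> h') \<cdot> inv\<^bsub>E\<^esub> \<iota> g0"
        using g0(1) h b(1) c'(1) by (simp add: h'_def E.word_simps)
      also have "\<dots> = \<iota> h \<cdot> ?z"
        unfolding H_centralizer[OF b(1) c' h'] using g0(1) h b(1) c'(1) by (simp add: h'_def E.word_simps)
      finally show ?thesis .
    qed
    have gc: "g0 \<otimes> c' \<notin> H"
    proof
      assume "g0 \<otimes> c' \<in> H"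
      then have "g0 \<otimes> c' \<otimes> inv c' \<in> H"
        using True H_closed by blast
      then show False
        using g0 c'(1) by (simp add: B.word_simps)
    qed
    let ?ps = "[(False, g0), (True, b), (False, inv (g0 \<otimes> c')), (True, b), (False, g0 \<otimes> c'),
      (True, inv b), (False, inv g0), (True, inv b)]"
    have "\<iota> \<one> \<cdot> path ?ps \<noteq> \<one>\<^bsub>E\<^esub>"
      using b c' g0 gc H_inv[OF g0] H_inv[of "g0 \<otimes> c'"] K_inv
      by (intro Britton(2)) (simp_all del: B.inv_mult_group)
    moreover have "?y \<cdot> \<iota> b \<cdot> inv\<^bsub>E\<^esub> ?y \<cdot> inv\<^bsub>E\<^esub> \<iota> b = \<iota> \<one> \<cdot> path ?ps"
      using b(1) c'(1) g0(1) by (simp add: E.word_simps B.inv_mult_group)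
    ultimately show ?thesis
      using K_centralizer[OF zE z] zE b(1)
      by (intro separable_from_centralized[OF assms K_normal, where x = ?y]) simp_all
  qed
qed

lemma residually_hnn_iff:
  assumes "quasi_regular \<C> B HK"
    and "in_class \<C> (B\<lparr>carrier := H\<rparr> Mod L) \<or>
      (\<exists>G f. \<C> G \<and> f \<in> hom B G \<and> f ` carrier B = carrier G \<and> inj_on f L)"
  shows "residually \<C> E \<longleftrightarrow> residually \<C> B \<and> residually \<C> (B Mod H) \<and> residually \<C> (B Mod K)"
  using residually_hnn[OF assms] residually_base residually_Mod_H residually_Mod_K by blast

end


section \<open>Interchanging the associated subgroups\<close>

context normal_hnn
begin

lemma swap: "normal_hnn B K H (inv_into H \<phi>)"
proof (intro normal_hnn.intro[OF B.is_group] normal_hnn_axioms.intro K_normal H_normal)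
  show "inv_into H \<phi> \<in> iso (B\<lparr>carrier := K\<rparr>) (B\<lparr>carrier := H\<rparr>)"
    using group.iso_set_sym[OF subgroup.subgroup_is_group[OF H_subgroup B.is_group] \<phi>_iso] by simp
qed

end

text \<open>
  The map that is the identity on \<open>B\<close> and sends \<open>t\<close> to \<open>t\<^sup>-\<^sup>1\<close> is an isomorphism of the two extensions.
\<close>

lemma (in quotient_closed_root_class) residually_hnn_swap:
  assumes "normal_hnn B H K \<phi>" "normal_hnn B K H \<psi>" "\<And>h. h \<in> H \<Longrightarrow> \<psi> (\<phi> h) = h"
    and res: "residually \<C> (hnn_extension B K \<psi>)"
  shows "residually \<C> (hnn_extension B H \<phi>)"
proof -
  interpret X: normal_hnn B H K \<phi> by fact
  interpret Y: normal_hnn B K H \<psi> by fact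
  have H_sub: "H \<subseteq> carrier B" "K \<subseteq> carrier B" "\<phi> ` H \<subseteq> carrier B" "\<psi> ` K \<subseteq> carrier B"
    by auto
  have t_relation': "Y.\<iota> h \<otimes>\<^bsub>Y.E\<^esub> inv\<^bsub>Y.E\<^esub> Y.t = inv\<^bsub>Y.E\<^esub> Y.t \<otimes>\<^bsub>Y.E\<^esub> Y.\<iota> (\<phi> h)" if h: "h \<in> H" for h
  proof -
    have "Y.t \<otimes>\<^bsub>Y.E\<^esub> Y.\<iota> h = Y.\<iota> (\<phi> h) \<otimes>\<^bsub>Y.E\<^esub> Y.t"
      using Y.t_relation[of "\<phi> h"] h assms(3) by simp
    then have "inv\<^bsub>Y.E\<^esub> Y.t \<otimes>\<^bsub>Y.E\<^esub> (Y.t \<otimes>\<^bsub>Y.E\<^esub> Y.\<iota> h) \<otimes>\<^bsub>Y.E\<^esub> inv\<^bsub>Y.E\<^esub> Y.t =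
        inv\<^bsub>Y.E\<^esub> Y.t \<otimes>\<^bsub>Y.E\<^esub> (Y.\<iota> (\<phi> h) \<otimes>\<^bsub>Y.E\<^esub> Y.t) \<otimes>\<^bsub>Y.E\<^esub> inv\<^bsub>Y.E\<^esub> Y.t"
      by simp
    then show ?thesis
      using h by (simp add: Y.E.word_simps)
  qed
  have t_relation: "X.\<iota> k \<otimes>\<^bsub>X.E\<^esub> inv\<^bsub>X.E\<^esub> X.t = inv\<^bsub>X.E\<^esub> X.t \<otimes>\<^bsub>X.E\<^esub> X.\<iota> (\<psi> k)" if k: "k \<in> K" for k
  proof -
    obtain h where h: "h \<in> H" "k = \<phi> h"
      using k X.\<phi>_image by blast
    have "inv\<^bsub>X.E\<^esub> X.t \<otimes>\<^bsub>X.E\<^esub> (X.\<iota> h \<otimes>\<^bsub>X.E\<^esub> X.t) \<otimes>\<^bsub>X.E\<^esub> inv\<^bsub>X.E\<^esub> X.t =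
        inv\<^bsub>X.E\<^esub> X.t \<otimes>\<^bsub>X.E\<^esub> (X.t \<otimes>\<^bsub>X.E\<^esub> X.\<iota> (\<phi> h)) \<otimes>\<^bsub>X.E\<^esub> inv\<^bsub>X.E\<^esub> X.t"
      using X.t_relation[OF h(1)] by simp
    then show ?thesis
      using h assms(3) by (simp add: X.E.word_simps)
  qed
  obtain F where F: "F \<in> hom X.E Y.E" "\<And>b. b \<in> carrier B \<Longrightarrow> F (X.\<iota> b) = Y.\<iota> b" "F X.t = inv\<^bsub>Y.E\<^esub> Y.t"
    using hnn_lift[OF X.B.is_group Y.E.is_group Y.\<iota>.homh Y.E.inv_closed[OF Y.t_closed] H_sub(1,3) t_relation'] by metis
  obtain F' where F': "F' \<in> hom Y.E X.E" "\<And>b. b \<in> carrier B \<Longrightarrow> F' (Y.\<iota> b) = X.\<iota> b" "F' Y.t = inv\<^bsub>X.E\<^esub> X.t"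
    using hnn_lift[OF X.B.is_group X.E.is_group X.\<iota>.homh X.E.inv_closed[OF X.t_closed] H_sub(2,4) t_relation] by metis
  interpret F: group_hom X.E Y.E F
    using F(1) by unfold_locales
  interpret F': group_hom Y.E X.E F'
    using F'(1) by unfold_locales
  have F'F: "F' (F x) = x" if "x \<in> carrier X.E" for x
    using that by (induction rule: X.E_induct) (simp_all add: F F')
  show ?thesis
    unfolding residually_iff[OF X.E.is_group]
  proof (intro ballI impI)
    fix x assume x: "x \<in> carrier X.E" "x \<noteq> \<one>\<^bsub>X.E\<^esub>"
    have "F x \<noteq> \<one>\<^bsub>Y.E\<^esub>"
    proof
      assume "F x = \<one>\<^bsub>Y.E\<^esub>"
      then show False
        using F'F[OF x(1)] x(2) by simp
    qed
    then obtain N where N: "N \<in> class_normals \<C> Y.E" "F x \<notin> N"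
      using res[unfolded residually_iff[OF Y.E.is_group]] F.hom_closed[OF x(1)] by blast
    then show "\<exists>N\<in>class_normals \<C> X.E. x \<notin> N"
      using N(2) by (intro bexI[OF _ class_normal_vimage[OF X.E.is_group Y.E.is_group F(1) N(1)]]) simp
  qed
qed

lemma (in class_hnn) conj_lift_if_frakK_subset:
  assumes "frakK B H K \<phi> \<subseteq> frakH B H" and b: "b \<in> carrier B"
  shows "\<exists>b'\<in>carrier B. \<forall>h\<in>H. \<phi> (b' \<otimes> h \<otimes> inv b') = b \<otimes> \<phi> h \<otimes> inv b"
proof -
  have K: "b \<otimes> k \<otimes> inv b \<in> K" if "k \<in> K" for k
    using that b normal.inv_op_closed2[OF K_normal] by blast
  have "(\<lambda>k\<in>K. inv (inv b) \<otimes> k \<otimes> inv b) \<in> Aut_restr B K"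
    unfolding Aut_restr_def using b by (intro imageI) simp
  then have "(\<lambda>h\<in>H. inv_into H \<phi> ((\<lambda>k\<in>K. inv (inv b) \<otimes> k \<otimes> inv b) (\<phi> h))) \<in> frakH B H"
    using assms(1) unfolding frakK_def by blast
  then obtain c where c: "c \<in> carrier B"
    "(\<lambda>h\<in>H. inv_into H \<phi> ((\<lambda>k\<in>K. inv (inv b) \<otimes> k \<otimes> inv b) (\<phi> h))) = (\<lambda>h\<in>H. inv c \<otimes> h \<otimes> c)"
    unfolding frakH_def Aut_restr_def by blast
  have "\<phi> (inv c \<otimes> h \<otimes> inv (inv c)) = b \<otimes> \<phi> h \<otimes> inv b" if h: "h \<in> H" for h
  proof -
    have "inv_into H \<phi> (b \<otimes> \<phi> h \<otimes> inv b) = inv c \<otimes> h \<otimes> c"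
      using fun_cong[OF c(2), of h] h b by simp
    then show ?thesis
      using f_inv_into_f[of "b \<otimes> \<phi> h \<otimes> inv b" \<phi> H] K[OF \<phi>_mem[OF h]] \<phi>_image c(1) by simp
  qed
  then show ?thesis
    using c(1) by (intro bexI[of _ "inv c"]) simp_all
qed

lemma (in class_hnn) conj_lift_if_frakH_subset:
  assumes "frakH B H \<subseteq> frakK B H K \<phi>" and b: "b \<in> carrier B"
  shows "\<exists>b'\<in>carrier B. \<forall>k\<in>K. inv_into H \<phi> (b' \<otimes> k \<otimes> inv b') = b \<otimes> inv_into H \<phi> k \<otimes> inv b"
proof -
  have "(\<lambda>h\<in>H. inv (inv b) \<otimes> h \<otimes> inv b) \<in> frakH B H"
    unfolding frakH_def Aut_restr_def using b by (intro imageI) simp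
  then obtain c where c: "c \<in> carrier B"
    "(\<lambda>h\<in>H. inv (inv b) \<otimes> h \<otimes> inv b) = (\<lambda>h\<in>H. inv_into H \<phi> ((\<lambda>k\<in>K. inv c \<otimes> k \<otimes> c) (\<phi> h)))"
    using assms(1) unfolding frakK_def Aut_restr_def by blast
  have "inv_into H \<phi> (inv c \<otimes> k \<otimes> inv (inv c)) = b \<otimes> inv_into H \<phi> k \<otimes> inv b" if k: "k \<in> K" for k
  proof -
    have "inv_into H \<phi> k \<in> H" "\<phi> (inv_into H \<phi> k) = k"
      using k \<phi>_image by (auto simp: inv_into_into f_inv_into_f)
    then show ?thesis
      using fun_cong[OF c(2), of "inv_into H \<phi> k"] k b c(1) by simp
  qed
  then show ?thesis
    using c(1) by (intro bexI[of _ "inv c"]) simp_all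
qed

lemma (in invariant_hnn) in_class_frakV_inverse:
  "in_class \<C> ((AutGrp B L)\<lparr>carrier := frakV B L (inv_into H \<phi>)\<rparr>)"
proof -
  interpret A: group "AutGrp B L" by (rule AutGrp_L(1))
  let ?\<psi> = "inv_into H \<phi>"
  let ?s = "inv\<^bsub>AutGrp B L\<^esub> restrict \<phi> L"
  note V = subgroup.subset[OF frakV_subgroup]
  have s: "?s \<in> frakV B L \<phi>"
    using subgroup.m_inv_closed[OF frakV_subgroup \<phi>_in_frakV] .
  have s_A: "?s \<in> carrier (AutGrp B L)" and \<phi>_A: "restrict \<phi> L \<in> carrier (AutGrp B L)"
    using s \<phi>_in_frakV V by blast+
  have "restrict ?\<psi> L = ?s"
  proof (rule extensionalityI[of _ L])
    show "?s \<in> extensional L"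
      using s_A by (auto simp: AutoGroup_def auto_def Bij_def)
    fix l assume l: "l \<in> L"
    have sl: "?s l \<in> L"
      using AutGrp_L(2)[OF s_A l] .
    have "(restrict \<phi> L \<otimes>\<^bsub>AutGrp B L\<^esub> ?s) l = restrict \<phi> L (?s l)"
      using AutGrp_L(3)[OF \<phi>_A s_A l] .
    moreover have "\<one>\<^bsub>AutGrp B L\<^esub> l = l"
      using l by (simp add: AutoGroup_def BijGroup_def)
    ultimately have "\<phi> (?s l) = l"
      using sl A.r_inv[OF \<phi>_A] by simp
    moreover have "?\<psi> (\<phi> (?s l)) = ?s l"
      using sl by (intro inv_into_f_f[OF \<phi>_inj]) blast
    ultimately show "restrict ?\<psi> L l = ?s l"
      using l by simp
  qed simp
  then have "frakF B L ?\<psi> \<subseteq> frakV B L \<phi>"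
    unfolding frakF_def using s by (intro A.generate_subgroup_incl[OF _ frakV_subgroup]) simp
  moreover have "frakL B L \<subseteq> frakV B L \<phi>"
    unfolding frakV_def by (auto intro: generate.incl)
  ultimately have gens: "frakL B L \<union> frakF B L ?\<psi> \<subseteq> frakV B L \<phi>"
    by blast
  then have "frakV B L ?\<psi> \<subseteq> frakV B L \<phi>"
    unfolding frakV_def[of B L ?\<psi>] by (rule A.generate_subgroup_incl[OF _ frakV_subgroup])
  moreover have "subgroup (frakV B L ?\<psi>) (AutGrp B L)"
    unfolding frakV_def[of B L ?\<psi>] using gens V by (intro A.generate_is_subgroup) blast
  ultimately have "subgroup (frakV B L ?\<psi>) ((AutGrp B L)\<lparr>carrier := frakV B L \<phi>\<rparr>)"
    using A.subgroup_incl[OF _ frakV_subgroup] by blast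
  then show ?thesis
    using in_class_subgroup[OF V_class] by simp
qed

lemma (in invariant_hnn) in_class_K_mod_L:
  assumes "in_class \<C> (B\<lparr>carrier := H\<rparr> Mod L)"
  shows "in_class \<C> (B\<lparr>carrier := K\<rparr> Mod L)"
proof -
  let ?H = "B\<lparr>carrier := H\<rparr>" and ?K = "B\<lparr>carrier := K\<rparr>"
  have H: "group ?H" and LH: "L \<lhd> ?H" and LK: "L \<lhd> ?K"
    using subgroup.subgroup_is_group[OF H_subgroup B.is_group]
      B.normal_restrict_supergroup[OF H_subgroup L_normal] B.normal_restrict_supergroup[OF K_subgroup L_normal]
    by simp_all
  have "\<phi> \<in> hom ?H ?K"
    using \<phi>_iso by (simp add: iso_def)
  then have hom: "(\<lambda>k. L #>\<^bsub>?K\<^esub> k) \<circ> \<phi> \<in> hom ?H (?K Mod L)" (is "?f \<in> _")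
    using hom_Mod[OF LK] by (rule Group.hom_compose)
  show ?thesis
  proof (rule in_class_if_class_normal_kernel[OF H normal.factorgroup_is_group[OF LK] hom])
    show "?f ` carrier ?H = carrier (?K Mod L)"
      unfolding carrier_FactGroup using \<phi>_image by (simp add: image_comp[symmetric] del: image_comp o_apply)
    show "L \<in> class_normals \<C> ?H"
      using assms LH by (simp add: class_normals_def)
    have "L #> \<phi> l = L" if "l \<in> L" for l
      using that coset_self_iff[OF L_normal, of "\<phi> l"] \<phi>_L by auto
    then show "L \<subseteq> kernel ?H (?K Mod L) ?f"
      by (auto simp: kernel_def)
  qed
qed

theorem theorem5:
  fixes \<C> :: "'u monoid \<Rightarrow> bool"
    and B :: "('b, 'm) monoid_scheme"
    and H K L :: "'b set"
    and \<phi> :: "'b \<Rightarrow> 'b"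
  assumes universe: "infinite (UNIV :: 'u set)" "carrier B \<lesssim> (UNIV :: 'u set)"
    and "group B" "H \<lhd> B" "K \<lhd> B"
    and "\<phi> \<in> iso (B\<lparr>carrier := H\<rparr>) (B\<lparr>carrier := K\<rparr>)"
    and "L = H \<inter> K" "\<phi> ` L = L"
    and "root_class \<C>" "quotient_closed \<C>"
    and "in_class \<C> (B\<lparr>carrier := H\<rparr> Mod L) \<or>
         (\<exists>G f. \<C> G \<and> f \<in> hom B G \<and> f ` carrier B = carrier G \<and> inj_on f L)"
    and "frakU B H K \<phi> = frakH B H \<or> frakU B H K \<phi> = frakK B H K \<phi>"
    and "in_class \<C> ((AutGrp B L)\<lparr>carrier := frakV B L \<phi>\<rparr>)"
    and "quasi_regular \<C> B (H <#>\<^bsub>B\<^esub> K)"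
  shows "residually \<C> (hnn_extension B H \<phi>) \<longleftrightarrow>
         residually \<C> B \<and> residually \<C> (B Mod H) \<and> residually \<C> (B Mod K)"
proof -
  have L: "L = H \<inter> K" "\<phi> ` (H \<inter> K) = H \<inter> K"
    using assms by simp_all
  interpret C: quotient_closed_root_class \<C>
    using assms by unfold_locales
  interpret X: normal_hnn B H K \<phi>
    by (intro normal_hnn.intro normal_hnn_axioms.intro assms)
  interpret X: invariant_hnn \<C> B H K \<phi>
    using assms by unfold_locales simp_all
  let ?\<psi> = "inv_into H \<phi>"
  show ?thesis
    using assms(12)
  proof
    assume "frakU B H K \<phi> = frakH B H"
    moreover have "frakK B H K \<phi> \<subseteq> frakU B H K \<phi>"
      unfolding frakU_def by (auto intro: generate.incl)
    ultimately interpret X: twisted_hnn \<C> B H K \<phi>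
      using X.conj_lift_if_frakK_subset by unfold_locales simp
    show ?thesis
      using X.residually_hnn_iff assms L by simp
  next
    assume "frakU B H K \<phi> = frakK B H K \<phi>"
    moreover have "frakH B H \<subseteq> frakU B H K \<phi>"
      unfolding frakU_def by (auto intro: generate.incl)
    ultimately have lift: "frakH B H \<subseteq> frakK B H K \<phi>"
      by simp
    interpret Y: normal_hnn B K H ?\<psi>
      by (rule X.swap)
    have \<psi>\<phi>: "?\<psi> (\<phi> h) = h" if "h \<in> H" for h
      using that X.\<phi>_inj by simp
    have \<phi>\<psi>: "\<phi> (?\<psi> k) = k" if "k \<in> K" for k
      using that X.\<phi>_image by (simp add: f_inv_into_f)
    have "?\<psi> ` L = L"
    proof -
      have "?\<psi> ` (\<phi> ` L) = L"
        using \<psi>\<phi> L(1) by (force simp: image_image)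
      then show ?thesis
        using assms(8) by simp
    qed
    interpret Y: twisted_hnn \<C> B K H ?\<psi>
    proof unfold_locales
      show "in_class \<C> ((AutGrp B (K \<inter> H))\<lparr>carrier := frakV B (K \<inter> H) ?\<psi>\<rparr>)"
        using X.in_class_frakV_inverse by (simp add: Int_commute)
      show "?\<psi> ` (K \<inter> H) = K \<inter> H"
        using \<open>?\<psi> ` L = L\<close> L(1) by (simp add: Int_commute)
      show "\<exists>b'\<in>carrier B. \<forall>k\<in>K. ?\<psi> (b' \<otimes>\<^bsub>B\<^esub> k \<otimes>\<^bsub>B\<^esub> inv\<^bsub>B\<^esub> b') = b \<otimes>\<^bsub>B\<^esub> ?\<psi> k \<otimes>\<^bsub>B\<^esub> inv\<^bsub>B\<^esub> b"
        if "b \<in> carrier B" for b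
        using X.conj_lift_if_frakH_subset[OF lift that] .
    qed (rule assms)
    have "K <#>\<^bsub>B\<^esub> H = H <#>\<^bsub>B\<^esub> K"
      using X.B.commut_normal[OF X.K_subgroup X.H_normal] .
    then have "quasi_regular \<C> B (K <#>\<^bsub>B\<^esub> H)"
      using assms(14) by simp
    moreover have "in_class \<C> (B\<lparr>carrier := K\<rparr> Mod (K \<inter> H)) \<or>
        (\<exists>G f. \<C> G \<and> f \<in> hom B G \<and> f ` carrier B = carrier G \<and> inj_on f (K \<inter> H))"
      using assms(11) X.in_class_K_mod_L L(1) by (auto simp: Int_commute)
    ultimately have "residually \<C> (hnn_extension B K ?\<psi>) \<longleftrightarrow>
        residually \<C> B \<and> residually \<C> (B Mod K) \<and> residually \<C> (B Mod H)"
      by (rule Y.residually_hnn_iff)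
    moreover have "residually \<C> (hnn_extension B H \<phi>) \<longleftrightarrow> residually \<C> (hnn_extension B K ?\<psi>)"
      using C.residually_hnn_swap[OF X.normal_hnn_axioms Y.normal_hnn_axioms \<psi>\<phi>]
        C.residually_hnn_swap[OF Y.normal_hnn_axioms X.normal_hnn_axioms \<phi>\<psi>] by blast
    ultimately show ?thesis
      by blast
  qed
qed

end
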